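(* Let $d\ge2$ and let $\Omega$ be a bounded convex open subset of $\mathbb{R}^d$, with outer unit normal $\vec n$ and area element $ds$ on $\partial\Omega$. (i) Let $A\in L^{\frac d{d-1}}_{\rm loc}(\mathbb{R}^d;\mathbf{Sym}_d)$ be such that its restriction to $\Omega$ is a divergence-free positive symmetric tensor with an integrable normal trace $A\vec n\in L^1(\partial\Omega;\mathbb{R}^d)$. Then $$\int_{\Omega}(\det A(x))^{\frac1{d-1}}dx\le\frac1{d\,|S^{d-1}|^{\frac1{d-1}}}\,\|A\vec n\|_{L^1(\partial\Omega)}^{\frac d{d-1}}.$$ (ii) If instead $A$ (with the same integrability and an integrable normal trace $A\vec n$ on $\partial\Omega$) takes values in $\mathbf{Sym}_d^+$ on $\Omega$ and $\mathrm{Div}\,A$ is a bounded measure on $\Omega$ (not necessarily zero), then $$\int_{\Omega}(\det A(x))^{\frac1{d-1}}dx\le\frac1{d\,|S^{d-1}|^{\frac1{d-1}}}\,\left(\|A\vec n\|_{L^1(\partial\Omega)}+\|\mathrm{Div}\,A\|_{\mathcal M(\Omega)}\right)^{\frac d{d-1}},$$ where $\|\mathrm{Div}\,A\|_{\mathcal M(\Omega)}$ is the total mass of the measure $|\mathrm{Div}\,A|$.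
   Context: $\mathbf{Sym}_d$ is the space of real symmetric $d\times d$ matrices, $\mathbf{Sym}_d^+$ the cone of positive semi-definite ones. $(\mathrm{Div}\,A)_i=\sum_j\partial_j a_{ij}$ (distributional row-wise divergence). A divergence-free positive symmetric tensor (DPT) over $\Omega$ is a locally integrable $A:\Omega\to\mathbf{Sym}_d$ with $A(x)\in\mathbf{Sym}_d^+$ a.e. and $\mathrm{Div}\,A=0$ in $\mathcal D'(\Omega)$. The normal trace $A\vec n$ on $\partial\Omega$ is defined by duality (generalized Green formula): it is the vector distribution on $\partial\Omega$ such that $\int_{\partial\Omega}w\,A\vec n\,ds=\int_\Omega A\nabla w\,dx+\int_\Omega w\,d(\mathrm{Div}\,A)$ for all smooth $w$ on $\overline\Omega$; it is called integrable when it is given by a function in $L^1(\partial\Omega)$, and $\|A\vec n\|_{L^1(\partial\Omega)}=\int_{\partial\Omega}|A\vec n|\,ds$ with $|\cdot|$ the Euclidean norm. $|S^{d-1}|$ is the area of the unit sphere of $\mathbb{R}^d$. *)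

theory Defs
  imports "HOL-Analysis.Analysis"
begin

definition partial_deriv :: "'n::finite \<Rightarrow> (real^'n \<Rightarrow> real) \<Rightarrow> real^'n \<Rightarrow> real" where
  "partial_deriv j f x = frechet_derivative f (at x) (axis j 1)"

definition grad :: "(real^'n::finite \<Rightarrow> real) \<Rightarrow> real^'n \<Rightarrow> real^'n" where
  "grad f x = (\<chi> j. partial_deriv j f x)"

fun Ck :: "nat \<Rightarrow> (real^'n::finite \<Rightarrow> real) \<Rightarrow> bool" where
  "Ck 0 f = continuous_on UNIV f"
| "Ck (Suc k) f = (f differentiable_on UNIV \<and> continuous_on UNIV f \<and> (\<forall>j. Ck k (partial_deriv j f)))"

definition smooth :: "(real^'n::finite \<Rightarrow> real) \<Rightarrow> bool" where
  "smooth f = (\<forall>k. Ck k f)"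

definition test_fun :: "(real^'n::finite) set \<Rightarrow> (real^'n \<Rightarrow> real) \<Rightarrow> bool" where
  "test_fun \<Omega> f = (smooth f \<and> compact (closure {x. f x \<noteq> 0}) \<and> closure {x. f x \<noteq> 0} \<subseteq> \<Omega>)"

section \<open>Hausdorff measure (normalised so that it agrees with surface area)\<close>

definition hausdorff_pre :: "real \<Rightarrow> real \<Rightarrow> ('a::metric_space) set \<Rightarrow> ennreal" where
  "hausdorff_pre s \<delta> E =
     (INF C \<in> {C :: nat \<Rightarrow> 'a set. E \<subseteq> (\<Union>i. C i) \<and> (\<forall>i. bounded (C i) \<and> diameter (C i) \<le> \<delta>)}.
        (\<Sum>i. ennreal (unit_ball_vol s * (diameter (C i) / 2) powr s)))"

definition hausdorff_outer :: "real \<Rightarrow> ('a::metric_space) set \<Rightarrow> ennreal" where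
  "hausdorff_outer s E = (SUP \<delta> \<in> {0<..}. hausdorff_pre s \<delta> E)"

definition hausdorff_measure :: "real \<Rightarrow> ('a::metric_space) measure" where
  "hausdorff_measure s = measure_of UNIV (sets borel) (hausdorff_outer s)"

definition sym_mat :: "real^'n^'n \<Rightarrow> bool" where
  "sym_mat M = (transpose M = M)"

definition psd_mat :: "real^'n^'n \<Rightarrow> bool" where
  "psd_mat M = (sym_mat M \<and> (\<forall>v. 0 \<le> v \<bullet> (M *v v)))"

definition Lp_loc_sym :: "real \<Rightarrow> (real^'n::finite \<Rightarrow> real^'n^'n) \<Rightarrow> bool" where
  "Lp_loc_sym p A = (A \<in> borel_measurable lebesgue \<and> (AE x in lebesgue. sym_mat (A x)) \<and>
     (\<forall>K. compact K \<longrightarrow> (\<integral>\<^sup>+ x. ennreal (indicator K x * norm (A x) powr p) \<partial>lebesgue) < \<infinity>))"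

end

(*
  Approximate A on small cells by constant matrices of the form L L^T. A convex potential u with
  |grad u| <= R is obtained from a semi-discrete optimal transport problem whose target is
  Lebesgue measure on the ball of radius R, with source masses proportional to
  det(A)^(1/(d-1)) placed on lattices adapted to the local factors L. The subdifferential at a lattice
  point is contained in a box cut out by second differences of u along the columns of L, so the
  AM-GM inequality bounds det(A)^(1/(d-1)) by the discrete version of tr(A D^2 u). Mollifying u
  yields smooth W with |grad W| <= R; testing the divergence identity componentwise against
  grad W bounds the integral of tr(A D^2 W) over Omega by R times the total mass of the normal
  trace and of Div A. Optimising in R gives the inequality with |S^(d-1)| replaced by d |B^d|.
  It remains to see that 0 < |S^(d-1)| <= d |B^d| for the Hausdorff measure, and this one-sided
  bound follows from slicing a Vitali covering of a thin shell by spheres.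
*)
theory Submission
  imports Defs
begin

section \<open>Linear change of variables\<close>

text \<open>The density det(A)^(1/(d-1)) solves a fixed-point equation: mass density c on the
  lattice gives, by AM-GM, the lower bound d (c det A)^(1/d) for tr(A D^2 u), and this equals d c
  exactly for c = det(A)^(1/(d-1)). The quantity to be estimated thus appears twice, as the integral
  bounded from below and as the volume of the target ball; it determines R, and the inequality
  closes on itself.

  The obstacle is regularity. A is only measurable, so a classical Monge-Ampere solution is out of
  reach, while the divergence identity accepts only smooth test functions. But only a lower bound on
  the trace is wanted, and that survives discretisation: the subgradient sets at the atoms have at
  least the prescribed volume, and second differences pass to mollified Hessians with an error
  uniform over all R-Lipschitz potentials. Uniformity matters because the potential is built after
  the mesh size is fixed.

  Linear changes of variables enter because lattice cells and subgradient boxes are preimages of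
  boxes under matrices built from the factors L.\<close>

text \<open>The change of variables in the library needs a well-ordered index type.\<close>

definition lin_scale :: "real^'n^'n \<Rightarrow> real \<Rightarrow> bool" where
  "lin_scale T c \<longleftrightarrow> 0 \<le> c \<and> (\<forall>\<phi>\<in>borel_measurable borel.
     (\<integral>\<^sup>+x. \<phi> (T *v x) \<partial>lborel) = ennreal c * (\<integral>\<^sup>+x. \<phi> x \<partial>lborel))"

lemma lin_scaleD:
  "lin_scale T c \<Longrightarrow> \<phi> \<in> borel_measurable borel \<Longrightarrow>
    (\<integral>\<^sup>+x. \<phi> (T *v x) \<partial>lborel) = ennreal c * (\<integral>\<^sup>+x. \<phi> x \<partial>lborel)"
  by (simp add: lin_scale_def)

lemma borel_measurable_matrix_vector [measurable]:
  "(\<lambda>x. (T :: real^'n^'m) *v x) \<in> borel_measurable borel"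
  by (intro borel_measurable_continuous_onI matrix_vector_mult_linear_continuous_on)

lemma nn_integral_lborel_translate:
  fixes a :: "'a::euclidean_space"
  assumes [measurable]: "f \<in> borel_measurable borel"
  shows "(\<integral>\<^sup>+x. f (a + x) \<partial>lborel) = (\<integral>\<^sup>+x. f x \<partial>lborel)"
proof -
  have "(\<integral>\<^sup>+x. f x \<partial>lborel) = (\<integral>\<^sup>+x. f x \<partial>distr lborel borel ((+) a))"
    by (simp only: lborel_distr_plus)
  also have "\<dots> = (\<integral>\<^sup>+x. f (a + x) \<partial>lborel)"
    by (subst nn_integral_distr) auto
  finally show ?thesis ..
qed

text \<open>Uniqueness of translation-invariant measures: unfold
  \<open>\<integral>\<integral> \<phi>(Tx) g(y) dx dy\<close>, translating \<open>x\<close> by \<open>T\<inverse>y\<close> and \<open>y\<close> by \<open>-Tx\<close>.\<close>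

lemma lin_scale_exists:
  fixes T T' :: "real^'n^'n"
  assumes inv: "T ** T' = mat 1" "T' ** T = mat 1"
  shows "\<exists>c. lin_scale T c"
proof -
  define g :: "real^'n \<Rightarrow> ennreal" where "g = indicator (cbox 0 One)"
  have [measurable]: "g \<in> borel_measurable borel" by (simp add: g_def)
  have g1: "(\<integral>\<^sup>+y. g y \<partial>lborel) = 1"
    by (simp add: g_def emeasure_lborel_cbox_eq)
  have TT': "T *v (T' *v y) = y" "T' *v (T *v y) = y" for y
    by (simp_all add: matrix_vector_mul_assoc inv)
  define C where "C = (\<integral>\<^sup>+x. g (- (T *v x)) \<partial>lborel)"
  have key: "(\<integral>\<^sup>+x. \<phi> (T *v x) \<partial>lborel) = C * (\<integral>\<^sup>+x. \<phi> x \<partial>lborel)"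
    if [measurable]: "\<phi> \<in> borel_measurable borel" for \<phi> :: "real^'n \<Rightarrow> ennreal"
  proof -
    have "(\<integral>\<^sup>+x. \<phi> (T *v x) \<partial>lborel) = (\<integral>\<^sup>+y. (\<integral>\<^sup>+x. \<phi> (T *v x) \<partial>lborel) * g y \<partial>lborel)"
      using g1 by (simp add: nn_integral_cmult)
    also have "\<dots> = (\<integral>\<^sup>+y. (\<integral>\<^sup>+x. \<phi> (T *v (T' *v y + x)) \<partial>lborel) * g y \<partial>lborel)"
      by (subst nn_integral_lborel_translate[where f = "\<lambda>x. \<phi> (T *v x)"]) simp_all
    also have "\<dots> = (\<integral>\<^sup>+y. (\<integral>\<^sup>+x. \<phi> (y + T *v x) * g y \<partial>lborel) \<partial>lborel)"
      by (simp add: matrix_vector_right_distrib TT' nn_integral_multc)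
    also have "\<dots> = (\<integral>\<^sup>+x. (\<integral>\<^sup>+y. \<phi> (y + T *v x) * g y \<partial>lborel) \<partial>lborel)"
      by (rule lborel_pair.Fubini') measurable
    also have "\<dots> = (\<integral>\<^sup>+x. (\<integral>\<^sup>+y. \<phi> y * g (y - T *v x) \<partial>lborel) \<partial>lborel)"
    proof (rule nn_integral_cong)
      fix x :: "real^'n"
      show "(\<integral>\<^sup>+y. \<phi> (y + T *v x) * g y \<partial>lborel) = (\<integral>\<^sup>+y. \<phi> y * g (y - T *v x) \<partial>lborel)"
        by (subst nn_integral_lborel_translate[where a = "T *v x", symmetric]) (simp_all add: add.commute)
    qed
    also have "\<dots> = (\<integral>\<^sup>+y. (\<integral>\<^sup>+x. \<phi> y * g (y - T *v x) \<partial>lborel) \<partial>lborel)"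
      by (rule lborel_pair.Fubini') measurable
    also have "\<dots> = (\<integral>\<^sup>+y. \<phi> y * C \<partial>lborel)"
    proof (rule nn_integral_cong)
      fix y :: "real^'n"
      have "(\<integral>\<^sup>+x. g (y - T *v x) \<partial>lborel) = (\<integral>\<^sup>+x. g (y - T *v (T' *v y + x)) \<partial>lborel)"
        by (subst nn_integral_lborel_translate[where f = "\<lambda>x. g (y - T *v x)"]) simp_all
      then show "(\<integral>\<^sup>+x. \<phi> y * g (y - T *v x) \<partial>lborel) = \<phi> y * C"
        by (simp add: nn_integral_cmult C_def matrix_vector_right_distrib TT')
    qed
    finally show ?thesis by (subst (asm) nn_integral_multc) (auto simp: mult.commute)
  qed
  \<comment> \<open>Finiteness of \<open>C\<close>: \<open>g (- (T *v x))\<close> vanishes unless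
    \<open>x\<close> lies in the image under \<open>T'\<close> of a box, which is bounded. Only then
    can \<open>C\<close> be replaced by a real number.\<close>
  have "bounded ((*v) T' ` cbox (-One) 0)"
    by (intro bounded_linear_image bounded_cbox) (simp add: matrix_vector_mul_bounded_linear)
  then obtain a where a: "(*v) T' ` cbox (-One) 0 \<subseteq> cbox (-a) a"
    using bounded_subset_cbox_symmetric by metis
  have "C \<le> (\<integral>\<^sup>+x. indicator (cbox (-a) a) x \<partial>lborel)"
    unfolding C_def
  proof (rule nn_integral_mono)
    fix x
    have "x \<in> cbox (-a) a" if "- (T *v x) \<in> cbox 0 One"
    proof -
      have "T *v x \<in> cbox (-One) 0" using that by (auto simp: mem_box)
      then have "T' *v (T *v x) \<in> cbox (-a) a" using a by blast
      then show ?thesis by (simp add: TT')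
    qed
    then show "g (- (T *v x)) \<le> indicator (cbox (-a) a) x"
      by (auto simp: g_def indicator_def)
  qed
  also have "\<dots> < \<infinity>" by (simp add: emeasure_lborel_cbox_eq)
  finally have "C = ennreal (enn2real C)" by simp
  with key show ?thesis
    unfolding lin_scale_def by (intro exI[of _ "enn2real C"]) simp
qed

lemma lin_scale_mult:
  fixes A B :: "real^'n^'n"
  assumes "lin_scale A a" "lin_scale B b"
  shows "lin_scale (A ** B) (a * b)"
proof -
  have "(\<integral>\<^sup>+x. \<phi> ((A ** B) *v x) \<partial>lborel) = ennreal (a * b) * (\<integral>\<^sup>+x. \<phi> x \<partial>lborel)"
    if [measurable]: "\<phi> \<in> borel_measurable borel" for \<phi> :: "real^'n \<Rightarrow> ennreal"
  proof -
    have "(\<integral>\<^sup>+x. \<phi> ((A ** B) *v x) \<partial>lborel) = (\<integral>\<^sup>+x. (\<lambda>y. \<phi> (A *v y)) (B *v x) \<partial>lborel)"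
      by (simp add: matrix_vector_mul_assoc)
    also have "\<dots> = ennreal b * (\<integral>\<^sup>+x. \<phi> (A *v x) \<partial>lborel)"
      by (rule lin_scaleD[OF assms(2)]) measurable
    also have "\<dots> = ennreal b * (ennreal a * (\<integral>\<^sup>+x. \<phi> x \<partial>lborel))"
      by (simp add: lin_scaleD[OF assms(1)])
    finally show ?thesis
      using assms unfolding lin_scale_def by (simp add: ennreal_mult mult_ac)
  qed
  with assms show ?thesis by (simp add: lin_scale_def)
qed

lemma lin_scale_unique:
  assumes "lin_scale (T :: real^'n^'n) a" "lin_scale T b" shows "a = b"
proof -
  define g :: "real^'n \<Rightarrow> ennreal" where "g = indicator (cbox 0 One)"
  have [measurable]: "g \<in> borel_measurable borel" by (simp add: g_def)
  have g1: "(\<integral>\<^sup>+y. g y \<partial>lborel) = 1"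
    by (simp add: g_def emeasure_lborel_cbox_eq)
  have "ennreal a * 1 = ennreal b * 1"
    using lin_scaleD[OF assms(1), of g] lin_scaleD[OF assms(2), of g] by (simp add: g1)
  then show ?thesis using assms by (simp add: lin_scale_def)
qed

lemma lin_scale_mat_1: "lin_scale (mat 1) 1"
  by (simp add: lin_scale_def)

lemma Basis_vec_eq_range: "(Basis :: (real^'n) set) = range (\<lambda>i. axis i 1)"
  by (auto simp: Basis_vec_def)

lemma inj_axis_1: "inj (\<lambda>i::'n::finite. axis i (1::real))"
  by (auto simp: inj_def axis_eq_axis)

lemma sum_Basis_vec: "(\<Sum>j\<in>(Basis :: (real^'n) set). f j) = (\<Sum>i\<in>UNIV. f (axis i 1))"
  unfolding Basis_vec_eq_range by (subst sum.reindex[OF inj_axis_1]) simp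

lemma prod_Basis_vec: "(\<Prod>j\<in>(Basis :: (real^'n) set). f j) = (\<Prod>i\<in>UNIV. f (axis i 1))"
  unfolding Basis_vec_eq_range by (subst prod.reindex[OF inj_axis_1]) simp

lemma lin_scale_diagonal:
  fixes A :: "real^'n^'n"
  assumes diag: "\<And>i j. i \<noteq> j \<Longrightarrow> A$i$j = 0" and det: "det A \<noteq> 0"
  shows "lin_scale A (1 / \<bar>det A\<bar>)"
proof -
  have dA: "det A = (\<Prod>i\<in>UNIV. A$i$i)" using det_diagonal[of A] diag by simp
  then have nz: "A$i$i \<noteq> 0" for i using det by auto
  define c :: "real^'n \<Rightarrow> real" where "c b = A $ (axis_index b) $ (axis_index b)" for b
  have cax: "c (axis i 1) = A$i$i" for i
    by (simp add: c_def)
  have cnz: "c j \<noteq> 0" if "j \<in> Basis" for j using that nz by (auto simp: Basis_vec_def cax)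
  have T: "0 + (\<Sum>j\<in>Basis. (c j * (x \<bullet> j)) *\<^sub>R j) = A *v x" for x :: "real^'n"
  proof -
    have "(A *v x) $ i = A$i$i * x$i" for i
    proof -
      have "(\<Sum>j\<in>UNIV. A$i$j * x$j) = (\<Sum>j\<in>UNIV. if j = i then A$i$i * x$i else 0)"
        by (rule sum.cong) (auto simp: diag)
      then show ?thesis by (simp add: matrix_vector_mult_def)
    qed
    moreover have ax: "t * axis i (1::real) $ k = (if i = k then t else 0)" for t and i k :: 'n
      by (simp add: axis_def)
    ultimately show ?thesis
      by (simp add: sum_Basis_vec cax inner_axis vec_eq_iff ax)
  qed
  have D: "lborel = density (distr lborel borel ((*v) A)) (\<lambda>_. ennreal \<bar>det A\<bar>)"
    using lborel_affine_euclidean[of c 0] cnz unfolding T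
    by (simp add: prod_Basis_vec cax dA abs_prod)
  have "(\<integral>\<^sup>+x. \<phi> (A *v x) \<partial>lborel) = ennreal (1 / \<bar>det A\<bar>) * (\<integral>\<^sup>+x. \<phi> x \<partial>lborel)"
    if [measurable]: "\<phi> \<in> borel_measurable borel" for \<phi> :: "real^'n \<Rightarrow> ennreal"
  proof -
    have "(\<integral>\<^sup>+x. \<phi> x \<partial>lborel) = ennreal \<bar>det A\<bar> * (\<integral>\<^sup>+x. \<phi> (A *v x) \<partial>lborel)"
      by (subst D) (simp add: nn_integral_density nn_integral_distr nn_integral_cmult)
    then show ?thesis
      using det by (simp add: mult.assoc[symmetric] ennreal_mult[symmetric])
  qed
  then show ?thesis by (simp add: lin_scale_def)
qed

text \<open>Applying the map twice gives \<open>c * c = 1\<close>, and scaling factors are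
  nonnegative. Applied to matrices that exchange two coordinates.\<close>

lemma lin_scale_involution:
  fixes A :: "real^'n^'n"
  assumes "A ** A = mat 1"
  shows "lin_scale A 1"
proof -
  obtain c where c: "lin_scale A c" using lin_scale_exists[OF assms assms] by blast
  have "c * c = 1"
    using lin_scale_unique[OF lin_scale_mult[OF c c, unfolded assms] lin_scale_mat_1] .
  moreover have "0 \<le> c" using c by (simp add: lin_scale_def)
  ultimately have "c = 1" using power2_eq_1_iff[of c] by (simp add: power2_eq_square)
  with c show ?thesis by simp
qed

text \<open>A shear \<open>S\<close> is conjugate to \<open>S\<^sup>2\<close> by a dilation, so its scaling factor
  satisfies \<open>c = c\<^sup>2\<close>.\<close>

lemma lin_scale_shear:
  fixes m n :: "'n::finite"
  assumes "m \<noteq> n"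
  shows "lin_scale (\<chi> i j. of_bool (i = m \<and> j = n \<or> i = j)) 1"
proof -
  define E :: "real \<Rightarrow> real^'n^'n" where
    "E t = (\<chi> i j. if i = m \<and> j = n then t else of_bool (i = j))" for t
  define D :: "real \<Rightarrow> real^'n^'n" where
    "D t = (\<chi> i j. if i = j then (if j = m then t else 1) else 0)" for t
  have EE: "E s ** E t = E (s + t)" for s t
  proof -
    have "(\<Sum>k\<in>UNIV. E s $ i $ k * E t $ k $ j) = E (s + t) $ i $ j" for i j
    proof (cases "i = m")
      case True
      have "(\<Sum>k\<in>UNIV. E s $ i $ k * E t $ k $ j)
        = (\<Sum>k\<in>UNIV. (if k = n then s * of_bool (n = j) else 0) + (if k = m then E t $ m $ j else 0))"
        using assms True by (intro sum.cong) (auto simp: E_def)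
      also have "\<dots> = s * of_bool (n = j) + E t $ m $ j" by (simp add: sum.distrib)
      finally show ?thesis using assms True by (auto simp: E_def)
    next
      case False
      have "(\<Sum>k\<in>UNIV. E s $ i $ k * E t $ k $ j) = (\<Sum>k\<in>UNIV. if k = i then E t $ i $ j else 0)"
        using False by (intro sum.cong) (auto simp: E_def)
      then show ?thesis using False by (simp add: E_def)
    qed
    then show ?thesis by (simp add: matrix_matrix_mult_def vec_eq_iff)
  qed
  have E0: "E 0 = mat 1"
    using assms by (auto simp: E_def mat_def vec_eq_iff)
  have DE: "D t ** M = (\<chi> i j. if i = m then t * M$i$j else M$i$j)" for t M
  proof -
    have "(\<Sum>k\<in>UNIV. D t $ i $ k * M $ k $ j) = (\<Sum>k\<in>UNIV. if k = i then (if i = m then t else 1) * M$i$j else 0)" for i j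
      by (intro sum.cong) (auto simp: D_def)
    then show ?thesis by (simp add: matrix_matrix_mult_def vec_eq_iff)
  qed
  have ED: "M ** D t = (\<chi> i j. if j = m then t * M$i$j else M$i$j)" for t M
  proof -
    have "(\<Sum>k\<in>UNIV. M $ i $ k * D t $ k $ j) = (\<Sum>k\<in>UNIV. if k = j then (if j = m then t else 1) * M$i$j else 0)" for i j
      by (intro sum.cong) (auto simp: D_def)
    then show ?thesis by (simp add: matrix_matrix_mult_def vec_eq_iff)
  qed
  \<comment> \<open>Multiplying row \<open>m\<close> by 2 and column \<open>m\<close> by 1/2 leaves
    the diagonal alone and doubles the entry at \<open>(m, n)\<close>.\<close>
  have conj: "D 2 ** E 1 ** D (1/2) = E 2"
    unfolding DE ED using assms by (auto simp: E_def vec_eq_iff)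
  have DD: "D (1/2) ** D 2 = mat 1" "D 2 ** D (1/2) = mat 1"
    unfolding DE by (auto simp: D_def mat_def vec_eq_iff)
  obtain c where c: "lin_scale (E 1) c"
    using lin_scale_exists[of "E 1" "E (-1)"] by (auto simp: EE E0)
  obtain c' where c': "lin_scale (E (-1)) c'"
    using lin_scale_exists[of "E (-1)" "E 1"] by (auto simp: EE E0)
  obtain a where a: "lin_scale (D 2) a" using lin_scale_exists[OF DD(2) DD(1)] by blast
  obtain b where b: "lin_scale (D (1/2)) b" using lin_scale_exists[OF DD] by blast
  have ab: "a * b = 1" using lin_scale_unique[OF lin_scale_mult[OF a b, unfolded DD] lin_scale_mat_1] .
  have cc': "c * c' = 1"
    using lin_scale_unique[OF _ lin_scale_mat_1, of "c * c'"] lin_scale_mult[OF c c'] EE[of 1 "-1"] E0 by simp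
  have "lin_scale (E 2) (a * c * b)"
    using lin_scale_mult[OF lin_scale_mult[OF a c] b] conj by simp
  moreover have "lin_scale (E 2) (c * c)" using lin_scale_mult[OF c c] by (simp add: EE)
  ultimately have "a * c * b = c * c" by (rule lin_scale_unique)
  moreover have "a * c * b = c * (a * b)" by simp
  ultimately have "c = c * c" using ab by simp
  \<comment> \<open>\<open>c = c * c\<close> still allows \<open>c = 0\<close>; the inverse shear,
    through \<open>c * c' = 1\<close>, excludes it.\<close>
  then have "c = 1" using cc' by auto
  moreover have "E 1 = (\<chi> i j. of_bool (i = m \<and> j = n \<or> i = j))" by (auto simp: E_def vec_eq_iff)
  ultimately show ?thesis using c by simp
qed

lemma det_shear:
  fixes m n :: "'n::finite"
  assumes "m \<noteq> n"
  shows "det (\<chi> i j. of_bool (i = m \<and> j = n \<or> i = j) :: real^'n^'n) = 1"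
proof -
  have "det (\<chi> k. if k = m then row m (mat 1) + 1 *s row n (mat 1) else row k (mat 1 :: real^'n^'n)) = 1"
    using det_row_operation[OF assms, of "mat 1" 1] by simp
  moreover have "(\<chi> k. if k = m then row m (mat 1) + 1 *s row n (mat 1) else row k (mat 1 :: real^'n^'n))
      = (\<chi> i j. of_bool (i = m \<and> j = n \<or> i = j))"
    using assms by (auto simp: vec_eq_iff row_def mat_def)
  ultimately show ?thesis by simp
qed

text \<open>Scaling factors are multiplicative in \<open>A\<close>, so it suffices to treat diagonal
  matrices, coordinate exchanges and shears. The induction also meets singular matrices, hence the
  implication from \<open>det A \<noteq> 0\<close> inside it; a zero row makes it vacuous.\<close>

lemma nn_integral_linear_vec:
  fixes A :: "real^'n^'n"
  assumes "det A \<noteq> 0" and [measurable]: "\<phi> \<in> borel_measurable borel"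
  shows "(\<integral>\<^sup>+x. \<phi> (A *v x) \<partial>lborel) = ennreal (1 / \<bar>det A\<bar>) * (\<integral>\<^sup>+x. \<phi> x \<partial>lborel)"
proof -
  have "det A \<noteq> 0 \<longrightarrow> lin_scale A (1 / \<bar>det A\<bar>)"
  proof (induction A rule: induct_matrix_elementary_alt)
    case (1 A B)
    then show ?case
      using lin_scale_mult[of A "1 / \<bar>det A\<bar>" B "1 / \<bar>det B\<bar>"] by (auto simp: det_mul abs_mult)
  next
    case (2 A i)
    then show ?case by (simp add: det_zero_row)
  next
    case (3 A)
    then show ?case using lin_scale_diagonal by blast
  next
    case (4 m n)
    define P where "P = ((\<chi> i j. mat 1 $ i $ Transposition.transpose m n j) :: real^'n^'n)"
    have Pn: "P $ k $ l = of_bool (l = Transposition.transpose m n k)" for k l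
      by (auto simp: P_def mat_def)
    have "(\<Sum>k\<in>UNIV. P $ i $ k * P $ k $ j) = (mat 1 :: real^'n^'n) $ i $ j" for i j
    proof -
      have "(\<Sum>k\<in>UNIV. P $ i $ k * P $ k $ j)
        = (\<Sum>k\<in>UNIV. if k = Transposition.transpose m n i then of_bool (i = j) else (0::real))"
        by (rule sum.cong) (auto simp: Pn)
      then show ?thesis by (simp add: mat_def)
    qed
    then have PP: "P ** P = mat 1" by (simp add: matrix_matrix_mult_def vec_eq_iff)
    have "det (P ** P) = 1" unfolding PP by (rule det_I)
    then have "det P * det P = 1" by (simp only: det_mul)
    then have "\<bar>det P\<bar> = 1" by (simp add: abs_square_eq_1[symmetric] power2_eq_square)
    then show ?case using lin_scale_involution[OF PP] by (simp add: P_def)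
  next
    case (5 m n)
    then show ?case using lin_scale_shear[OF 5] det_shear[OF 5] by simp
  qed
  with assms have "lin_scale A (1 / \<bar>det A\<bar>)" by simp
  then show ?thesis using assms(2) by (simp add: lin_scale_def)
qed

section \<open>Semi-discrete optimal transport\<close>

text \<open>Legendre transform of the heights \<open>h\<close> on \<open>X\<close>: a convex,
  piecewise affine function of the slope \<open>p\<close>. The regions where one \<open>x\<close>
  attains the maximum are the Laguerre cells of the transport problem.\<close>

definition max_affine :: "('a::real_inner) set \<Rightarrow> ('a \<Rightarrow> real) \<Rightarrow> 'a \<Rightarrow> real" where
  "max_affine X h p = Max ((\<lambda>x. p \<bullet> x - h x) ` X)"

lemma max_affine_ge: "finite X \<Longrightarrow> x \<in> X \<Longrightarrow> p \<bullet> x - h x \<le> max_affine X h p"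
  unfolding max_affine_def by (rule Max_ge) auto

lemma max_affine_le:
  "finite X \<Longrightarrow> X \<noteq> {} \<Longrightarrow> (\<And>x. x \<in> X \<Longrightarrow> p \<bullet> x - h x \<le> c) \<Longrightarrow> max_affine X h p \<le> c"
  unfolding max_affine_def by (subst Max_le_iff) auto

lemma max_affine_attained:
  assumes "finite X" "X \<noteq> {}"
  obtains x where "x \<in> X" "max_affine X h p = p \<bullet> x - h x"
proof -
  have "max_affine X h p \<in> (\<lambda>x. p \<bullet> x - h x) ` X"
    unfolding max_affine_def by (rule Max_in) (use assms in auto)
  then show thesis using that by blast
qed

lemma borel_measurable_max_affine [measurable]:
  fixes X :: "'a::euclidean_space set"
  assumes "finite X"
  shows "max_affine X h \<in> borel_measurable borel"
proof -
  have "(\<lambda>p. Max ((\<lambda>x. p \<bullet> x - h x) ` X)) \<in> borel_measurable borel"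
    using assms by (intro borel_measurable_Max) auto
  then show ?thesis by (simp add: max_affine_def[abs_def])
qed

lemma max_affine_diff:
  assumes "finite X" "X \<noteq> {}" "\<And>x. x \<in> X \<Longrightarrow> \<bar>h x - k x\<bar> \<le> e"
  shows "\<bar>max_affine X h p - max_affine X k p\<bar> \<le> e"
proof -
  have "max_affine X f p \<le> max_affine X g p + e"
    if "\<And>x. x \<in> X \<Longrightarrow> \<bar>f x - g x\<bar> \<le> e" for f g
  proof (rule max_affine_le[OF assms(1,2)])
    fix x assume "x \<in> X"
    then show "p \<bullet> x - f x \<le> max_affine X g p + e"
      using max_affine_ge[OF assms(1) \<open>x \<in> X\<close>, of p g] that[OF \<open>x \<in> X\<close>] by linarith
  qed
  from this[of h k] this[of k h] show ?thesis
    using assms(3) by (fastforce simp: abs_minus_commute abs_le_iff)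
qed

lemma set_integrable_max_affine:
  fixes X :: "'a::euclidean_space set"
  assumes "finite X" "X \<noteq> {}"
  shows "set_integrable lborel (cball 0 R) (max_affine X h)"
proof -
  define B where "B = (\<Sum>x\<in>X. \<bar>R\<bar> * norm x + \<bar>h x\<bar>)"
  have B: "\<bar>max_affine X h p\<bar> \<le> B" if "p \<in> cball 0 R" for p
  proof -
    obtain x where x: "x \<in> X" "max_affine X h p = p \<bullet> x - h x"
      using max_affine_attained[OF assms] .
    have "\<bar>p \<bullet> x\<bar> \<le> norm p * norm x" by (rule Cauchy_Schwarz_ineq2)
    also have "\<dots> \<le> \<bar>R\<bar> * norm x" using that by (intro mult_right_mono) auto
    finally have "\<bar>max_affine X h p\<bar> \<le> \<bar>R\<bar> * norm x + \<bar>h x\<bar>" using x by linarith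
    also have "\<dots> \<le> B"
      unfolding B_def by (rule member_le_sum[OF x(1)]) (auto simp: assms)
    finally show ?thesis .
  qed
  have "max_affine X h \<in> borel_measurable borel" by (rule borel_measurable_max_affine[OF assms(1)])
  have "integrable lborel (\<lambda>p. indicat_real (cball 0 R) p *\<^sub>R max_affine X h p)"
  proof (rule Bochner_Integration.integrable_bound)
    show "integrable lborel (\<lambda>p. B * indicator (cball (0::'a) R) p)"
      using emeasure_bounded_finite[OF bounded_cball[of "0::'a" R]]
      by (intro integrable_mult_right integrable_real_indicator) auto
    show "AE p in lborel. norm (indicat_real (cball 0 R) p *\<^sub>R max_affine X h p)
        \<le> norm (B * indicat_real (cball 0 R) p)"
      using B by (intro AE_I2) (force simp: indicator_def)
    show "(\<lambda>p. indicat_real (cball 0 R) p *\<^sub>R max_affine X h p) \<in> borel_measurable lborel"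
      using \<open>max_affine X h \<in> borel_measurable borel\<close>
      by (intro borel_measurable_scaleR borel_measurable_indicator) simp_all
  qed
  then show ?thesis by (simp add: set_integrable_def)
qed

context
  fixes X :: "'a::euclidean_space set" and m :: "'a \<Rightarrow> real" and R :: real
  assumes X: "finite X" "X \<noteq> {}"
    and m: "\<And>x. x \<in> X \<Longrightarrow> 0 < m x" and R: "0 \<le> R"
    and total: "(\<Sum>x\<in>X. m x) = measure lborel (cball (0::'a) R)"
begin

text \<open>Dual functional of optimal transport between Lebesgue measure on the ball and the atoms
  \<open>m x\<close>. It is convex in \<open>h\<close>, and its formal derivative in
  \<open>h x\<close> is \<open>m x\<close> minus the volume of the cell of \<open>x\<close>, so a
  minimiser has cells of the prescribed volumes.\<close>

definition kantorovich :: "('a \<Rightarrow> real) \<Rightarrow> real" where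
  "kantorovich h = (LINT p:cball 0 R|lborel. max_affine X h p) + (\<Sum>x\<in>X. m x * h x)"

lemma finite_ball: "emeasure lborel (cball (0::'a) R) < \<infinity>"
  using emeasure_bounded_finite[OF bounded_cball[of "0::'a" R]] by simp

text \<open>The set \<open>W\<close> lets one estimate serve two uses: \<open>W\<close> is the whole
  ball when all heights are perturbed, and an enlarged cell when a single height is lowered.\<close>

lemma kantorovich_diff:
  assumes "\<And>p. p \<in> cball 0 R \<Longrightarrow> max_affine X h p - max_affine X k p \<le> e * indicator W p"
    and W: "W \<subseteq> cball 0 R" "W \<in> sets borel"
  shows "kantorovich h - kantorovich k \<le> e * measure lborel W + (\<Sum>x\<in>X. m x * (h x - k x))"
proof -
  have fW: "emeasure lborel W < \<infinity>"
    using emeasure_mono[OF W(1), of lborel] finite_ball by (simp add: le_less_trans)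
  have iW: "set_integrable lborel (cball 0 R) (\<lambda>p. e * indicator W p)"
  proof -
    have "(\<lambda>p. indicator (cball 0 R) p *\<^sub>R (e * indicator W p)) = (\<lambda>p. e * indicator W p)"
      using W by (force simp: indicator_def)
    then show ?thesis unfolding set_integrable_def
      using fW W by (simp add: integrable_real_indicator integrable_mult_right)
  qed
  have "(LINT p:cball 0 R|lborel. max_affine X h p) - (LINT p:cball 0 R|lborel. max_affine X k p)
      = (LINT p:cball 0 R|lborel. max_affine X h p - max_affine X k p)"
    by (rule set_integral_diff(2)[symmetric]; rule set_integrable_max_affine[OF X])
  also have "\<dots> \<le> (LINT p:cball 0 R|lborel. e * indicator W p)"
    by (intro set_integral_mono iW set_integral_diff(1) set_integrable_max_affine[OF X] assms(1))
  also have "\<dots> = (LINT p|lborel. e * indicator W p)"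
    unfolding set_lebesgue_integral_def using W by (intro Bochner_Integration.integral_cong) (auto simp: indicator_def)
  also have "\<dots> = e * measure lborel W" using W by simp
  finally show ?thesis
    by (simp add: kantorovich_def right_diff_distrib sum_subtractf)
qed

lemma kantorovich_lipschitz:
  assumes "\<And>x. x \<in> X \<Longrightarrow> \<bar>h x - k x\<bar> \<le> e"
  shows "kantorovich h - kantorovich k \<le> 2 * measure lborel (cball (0::'a) R) * e"
proof -
  have "kantorovich h - kantorovich k
      \<le> e * measure lborel (cball (0::'a) R) + (\<Sum>x\<in>X. m x * (h x - k x))"
    using max_affine_diff[OF X assms] by (intro kantorovich_diff) (fastforce simp: abs_le_iff)+
  also have "(\<Sum>x\<in>X. m x * (h x - k x)) \<le> (\<Sum>x\<in>X. m x * e)"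
    using assms m by (intro sum_mono mult_left_mono) (fastforce simp: less_imp_le)+
  also have "\<dots> = measure lborel (cball (0::'a) R) * e"
    by (simp add: total sum_distrib_right[symmetric])
  finally show ?thesis by (simp add: algebra_simps)
qed

text \<open>Mass balance: a shift by \<open>c\<close> changes the integral by \<open>-c\<close>
  times the volume of the ball and the sum by \<open>c\<close> times the total mass, and these
  cancel by \<open>total\<close>. The inequality proved for arbitrary \<open>g\<close> and
  \<open>c\<close> is applied in both directions.\<close>

lemma kantorovich_shift: "kantorovich (\<lambda>x. h x + c) = kantorovich h"
proof -
  have "kantorovich (\<lambda>x. g x + c) - kantorovich g \<le> 0" for g c
  proof -
    have "max_affine X (\<lambda>x. g x + c) p - max_affine X g p \<le> -c" for p
    proof -
      have "max_affine X (\<lambda>x. g x + c) p \<le> max_affine X g p - c"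
      proof (rule max_affine_le[OF X])
        fix x assume "x \<in> X"
        then show "p \<bullet> x - (g x + c) \<le> max_affine X g p - c"
          using max_affine_ge[OF X(1), of x p g] by linarith
      qed
      then show ?thesis by simp
    qed
    then have "kantorovich (\<lambda>x. g x + c) - kantorovich g
      \<le> (-c) * measure lborel (cball (0::'a) R) + (\<Sum>x\<in>X. m x * ((g x + c) - g x))"
      by (intro kantorovich_diff) auto
    also have "(\<Sum>x\<in>X. m x * ((g x + c) - g x)) = c * measure lborel (cball (0::'a) R)"
      by (simp add: total sum_distrib_right[symmetric])
    finally show ?thesis by simp
  qed
  from this[of h c] this[of "\<lambda>x. h x + c" "-c"] show ?thesis by simp
qed

text \<open>Continuity refers to the product topology on all functions, because the minimiser is
  found on a product of compact intervals; the Lipschitz bound involves only the finitely many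
  coordinates in \<open>X\<close>.\<close>

lemma continuous_kantorovich: "continuous_on UNIV kantorovich"
proof -
  define C where "C = 2 * measure lborel (cball (0::'a) R)"
  have L: "\<bar>kantorovich k - kantorovich h\<bar> \<le> C * (\<Sum>x\<in>X. \<bar>k x - h x\<bar>)" for h k
  proof -
    have "\<bar>k x - h x\<bar> \<le> (\<Sum>x\<in>X. \<bar>k x - h x\<bar>)" if "x \<in> X" for x
      using that X by (intro member_le_sum) auto
    then show ?thesis
      using kantorovich_lipschitz[of k h "\<Sum>x\<in>X. \<bar>k x - h x\<bar>"]
        kantorovich_lipschitz[of h k "\<Sum>x\<in>X. \<bar>k x - h x\<bar>"]
      by (simp add: C_def abs_minus_commute abs_le_iff)
  qed
  show ?thesis unfolding continuous_on_def
  proof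
    fix h :: "'a \<Rightarrow> real"
    have "continuous_on UNIV (\<lambda>k. C * (\<Sum>x\<in>X. \<bar>k x - h x\<bar>))"
      by (intro continuous_intros continuous_on_product_coordinates)
    then have "((\<lambda>k. C * (\<Sum>x\<in>X. \<bar>k x - h x\<bar>)) \<longlongrightarrow> C * (\<Sum>x\<in>X. \<bar>h x - h x\<bar>)) (at h)"
      unfolding continuous_on_def by blast
    then have "((\<lambda>k. C * (\<Sum>x\<in>X. \<bar>k x - h x\<bar>)) \<longlongrightarrow> 0) (at h)" by simp
    then have "((\<lambda>k. kantorovich k - kantorovich h) \<longlongrightarrow> 0) (at h)"
      by (rule Lim_null_comparison[rotated]) (simp add: L)
    then show "(kantorovich \<longlongrightarrow> kantorovich h) (at h)" by (simp add: Lim_null[symmetric])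
  qed
qed

text \<open>Coercivity modulo constants: after a shift the least height on \<open>X\<close> is 0,
  which bounds \<open>max_affine\<close> from below on the ball. A height above \<open>M\<close>
  then makes the linear term outweigh any gain of the integral over heights 0. The remaining heights
  form a compact product of intervals.\<close>

lemma kantorovich_minimiser: "\<exists>h0. \<forall>h. kantorovich h0 \<le> kantorovich h"
proof -
  define B where "B = (\<Sum>x\<in>X. norm x)"
  define \<mu> where "\<mu> = measure lborel (cball (0::'a) R)"
  define m0 where "m0 = Min (m ` X)"
  have m0: "0 < m0" "\<And>x. x \<in> X \<Longrightarrow> m0 \<le> m x"
    unfolding m0_def using X m by auto
  \<comment> \<open>Chosen so that \<open>m0 * M\<close> equals \<open>2 * (R * B * \<mu>)\<close>,
    the largest amount by which the integral for heights 0 can exceed the integral for normalised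
    heights.\<close>
  define M where "M = 2 * (R * B * \<mu>) / m0"
  have B: "norm x \<le> B" if "x \<in> X" for x
    unfolding B_def using that X by (intro member_le_sum) auto
  have B0: "0 \<le> B" unfolding B_def by (rule sum_nonneg) simp
  have \<mu>0: "0 \<le> \<mu>" by (simp add: \<mu>_def)
  have M0: "0 \<le> M" unfolding M_def using R B0 \<mu>0 m0 by simp
  have px: "\<bar>p \<bullet> x\<bar> \<le> R * B" if "p \<in> cball 0 R" "x \<in> X" for p x
  proof -
    have "\<bar>p \<bullet> x\<bar> \<le> norm p * norm x" by (rule Cauchy_Schwarz_ineq2)
    also have "\<dots> \<le> R * B" using that R B by (intro mult_mono) auto
    finally show ?thesis .
  qed
  define K where "K = PiE (UNIV :: 'a set) (\<lambda>_. {0..M})"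
  have "compactin (product_topology (\<lambda>_. euclidean) UNIV) K"
    unfolding K_def by (simp add: compactin_PiE)
  then have "compact K"
    by (simp add: euclidean_product_topology flip: compactin_euclidean_iff)
  moreover have zK: "(\<lambda>_. 0) \<in> K" using M0 by (auto simp: K_def)
  moreover have "continuous_on K kantorovich"
    by (rule continuous_on_subset[OF continuous_kantorovich]) simp
  ultimately have "\<exists>h0\<in>K. \<forall>h\<in>K. kantorovich h0 \<le> kantorovich h"
    by (intro continuous_attains_inf) auto
  then obtain h0 where h0: "h0 \<in> K" "\<And>h. h \<in> K \<Longrightarrow> kantorovich h0 \<le> kantorovich h"
    by blast
  have "kantorovich h0 \<le> kantorovich h" for h
  proof -
    define c where "c = Min (h ` X)"
    \<comment> \<open>Heights off \<open>X\<close> do not affect the functional; setting them to 0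
      makes membership in \<open>K\<close> depend on \<open>X\<close> alone.\<close>
    define k where "k x = (if x \<in> X then h x - c else 0)" for x
    obtain x0 where x0: "x0 \<in> X" "h x0 = c"
    proof -
      have "c \<in> h ` X" unfolding c_def by (rule Min_in) (use X in auto)
      then show thesis using that by blast
    qed
    have k0: "0 \<le> k x" for x unfolding k_def c_def using X by auto
    have "kantorovich k = kantorovich (\<lambda>x. h x - c)"
      using kantorovich_lipschitz[of k "\<lambda>x. h x - c" 0] kantorovich_lipschitz[of "\<lambda>x. h x - c" k 0]
      by (simp add: k_def)
    also have "\<dots> = kantorovich h" using kantorovich_shift[of h "-c"] by simp
    finally have kh: "kantorovich k = kantorovich h" .
    show ?thesis
    proof (cases "\<forall>x. k x \<le> M")
      case True
      then have "k \<in> K" using k0 by (auto simp: K_def)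
      then show ?thesis using h0(2)[of k] kh by simp
    next
      case False
      then obtain x1 where x1: "k x1 > M" by (auto simp: not_le)
      then have "x1 \<in> X" using M0 by (auto simp: k_def split: if_splits)
      have "max_affine X (\<lambda>_. 0) p - max_affine X k p \<le> 2 * (R * B)" if p: "p \<in> cball 0 R" for p
      proof -
        have "max_affine X (\<lambda>_. 0) p \<le> R * B"
          using px[OF p] by (intro max_affine_le[OF X]) (simp add: abs_le_iff)
        moreover have "- (R * B) \<le> max_affine X k p"
          using max_affine_ge[OF X(1) x0(1), of p k] px[OF p x0(1)] x0 by (simp add: k_def abs_le_iff)
        ultimately show ?thesis by simp
      qed
      then have "kantorovich (\<lambda>_. 0) - kantorovich k \<le> 2 * (R * B) * \<mu> + (\<Sum>x\<in>X. m x * (0 - k x))"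
        unfolding \<mu>_def by (intro kantorovich_diff) auto
      moreover have "(\<Sum>x\<in>X. m x * (0 - k x)) = - (\<Sum>x\<in>X. m x * k x)"
        by (simp add: sum_negf)
      moreover have "m x1 * k x1 \<le> (\<Sum>x\<in>X. m x * k x)"
        using \<open>x1 \<in> X\<close> X k0 m by (intro member_le_sum) (auto simp: less_imp_le)
      moreover have "m0 * M \<le> m x1 * k x1"
        using m0(1) m0(2)[OF \<open>x1 \<in> X\<close>] x1 M0 by (intro mult_mono) auto
      ultimately have "kantorovich (\<lambda>_. 0) - kantorovich k \<le> 2 * (R * B) * \<mu> - m0 * M" by linarith
      also have "\<dots> = 0" using m0 by (simp add: M_def)
      finally show ?thesis using h0(2)[OF zK] kh by linarith
    qed
  qed
  then show ?thesis by blast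
qed

text \<open>Lowering the height \<open>h x\<close> by \<open>t\<close> changes the functional by at most
  \<open>t (|W\<^sub>t| - m x)\<close>, where \<open>W\<^sub>t\<close> decreases to the cell of \<open>x\<close> as \<open>t \<rightarrow> 0\<close>;
  no differentiability is required.\<close>

lemma laguerre_cells:
  obtains h where "\<And>x. x \<in> X \<Longrightarrow>
    m x \<le> measure lborel {p \<in> cball 0 R. max_affine X h p = p \<bullet> x - h x}"
proof -
  obtain h where h: "\<And>k. kantorovich h \<le> kantorovich k"
    using kantorovich_minimiser by blast
  have [measurable]: "max_affine X h \<in> borel_measurable borel"
    by (rule borel_measurable_max_affine[OF X(1)])
  have "m x \<le> measure lborel {p \<in> cball 0 R. max_affine X h p = p \<bullet> x - h x}" if x: "x \<in> X" for x
  proof -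
    define W where "W t = {p \<in> cball 0 R. max_affine X h p \<le> p \<bullet> x - h x + t}" for t
    have [measurable]: "W t \<in> sets borel" for t
      unfolding W_def by measurable
    have mW: "m x \<le> measure lborel (W t)" if t: "0 < t" for t
    proof -
      \<comment> \<open>Only the affine function of \<open>x\<close> rises, by \<open>t\<close>, so
        the maximum can grow only where that function was within \<open>t\<close> of it, and by at
        most \<open>t\<close>.\<close>
      define k where "k = h(x := h x - t)"
      have "max_affine X k p - max_affine X h p \<le> t * indicator (W t) p" if p: "p \<in> cball 0 R" for p
      proof -
        have "max_affine X k p \<le> max_affine X h p + t * indicator (W t) p"
        proof (rule max_affine_le[OF X])
          fix y assume y: "y \<in> X"
          have ge: "p \<bullet> y - h y \<le> max_affine X h p" by (rule max_affine_ge[OF X(1) y])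
          show "p \<bullet> y - k y \<le> max_affine X h p + t * indicator (W t) p"
            using ge p t by (auto simp: k_def W_def indicator_def)
        qed
        then show ?thesis by simp
      qed
      then have "kantorovich k - kantorovich h \<le> t * measure lborel (W t) + (\<Sum>y\<in>X. m y * (k y - h y))"
        by (intro kantorovich_diff) (auto simp: W_def[of t])
      also have "(\<Sum>y\<in>X. m y * (k y - h y)) = (\<Sum>y\<in>X. if y = x then - (m x * t) else 0)"
        by (intro sum.cong) (auto simp: k_def)
      also have "\<dots> = - (m x * t)" using X x by simp
      finally have "0 \<le> t * (measure lborel (W t) - m x)"
        using h[of k] by (simp add: algebra_simps)
      then show ?thesis using t by (simp add: zero_le_mult_iff)
    qed
    have fin: "emeasure lborel (W t) \<noteq> \<infinity>" for t
    proof -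
      have "emeasure lborel (W t) \<le> emeasure lborel (cball (0::'a) R)"
        by (rule emeasure_mono) (auto simp: W_def)
      then show ?thesis using finite_ball by (auto simp: top_unique)
    qed
    have "(\<lambda>n. measure lborel (W (1 / Suc n))) \<longlonglongrightarrow> measure lborel (\<Inter>n. W (1 / Suc n))"
    proof (rule Lim_measure_decseq)
      show "decseq (\<lambda>n. W (1 / Suc n))"
      proof (rule antimonoI)
        fix a b :: nat assume "a \<le> b"
        then have "1 / real (Suc b) \<le> 1 / real (Suc a)" by (intro divide_left_mono) auto
        then show "W (1 / Suc b) \<subseteq> W (1 / Suc a)" unfolding W_def by (intro Collect_mono) linarith
      qed
    qed (use fin in auto)
    then have "m x \<le> measure lborel (\<Inter>n. W (1 / Suc n))"
      by (rule LIMSEQ_le_const) (use mW in auto)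
    also have "(\<Inter>n. W (1 / Suc n)) = {p \<in> cball 0 R. max_affine X h p = p \<bullet> x - h x}"
    proof (intro equalityI subsetI)
      fix p assume p: "p \<in> (\<Inter>n. W (1 / Suc n))"
      have "max_affine X h p \<le> p \<bullet> x - h x"
      proof (rule field_le_epsilon)
        fix e :: real assume "0 < e"
        then obtain n where "1 / Suc n < e" using nat_approx_posE by blast
        moreover have "max_affine X h p \<le> p \<bullet> x - h x + 1 / Suc n" using p by (auto simp: W_def)
        ultimately show "max_affine X h p \<le> p \<bullet> x - h x + e" by linarith
      qed
      then show "p \<in> {p \<in> cball 0 R. max_affine X h p = p \<bullet> x - h x}"
        using max_affine_ge[OF X(1) x, of p h] p by (auto simp: W_def)
    qed (auto simp: W_def)
    finally show ?thesis .
  qed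
  then show thesis by (rule that)
qed

text \<open>\<open>u\<close> is the conjugate of \<open>max_affine X h\<close> with slopes
  restricted to the ball. The restriction gives the Lipschitz constant \<open>R\<close>, and a slope
  in the cell of \<open>x\<close> attains the supremum at \<open>x\<close>, which makes it a
  subgradient there.\<close>

lemma semidiscrete_potential_aux:
  obtains u :: "'a \<Rightarrow> real" where "convex_on UNIV u" "\<And>x y. u x - u y \<le> R * norm (x - y)"
    "\<And>x. x \<in> X \<Longrightarrow> \<exists>W\<in>sets borel. W \<subseteq> cball 0 R \<and> m x \<le> measure lborel W \<and>
       (\<forall>p\<in>W. \<forall>y. u x + p \<bullet> (y - x) \<le> u y)"
proof -
  obtain h where h: "\<And>x. x \<in> X \<Longrightarrow>
    m x \<le> measure lborel {p \<in> cball 0 R. max_affine X h p = p \<bullet> x - h x}"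
    using laguerre_cells by blast
  have [measurable]: "max_affine X h \<in> borel_measurable borel"
    by (rule borel_measurable_max_affine[OF X(1)])
  define u where "u y = (SUP p\<in>cball 0 R. p \<bullet> y - max_affine X h p)" for y
  obtain x0 where x0: "x0 \<in> X" using X by blast
  have bdd: "bdd_above ((\<lambda>p. p \<bullet> y - max_affine X h p) ` cball 0 R)" for y
  proof (rule bdd_aboveI2)
    fix p :: 'a assume p: "p \<in> cball 0 R"
    have "p \<bullet> (y - x0) \<le> norm p * norm (y - x0)" by (rule norm_cauchy_schwarz)
    also have "\<dots> \<le> R * norm (y - x0)" using p by (intro mult_right_mono) auto
    finally show "p \<bullet> y - max_affine X h p \<le> R * norm (y - x0) + h x0"
      using max_affine_ge[OF X(1) x0, of p h] by (simp add: inner_diff_right)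
  qed
  have ne: "cball (0::'a) R \<noteq> {}" using R by simp
  have upper: "p \<bullet> y - max_affine X h p \<le> u y" if "p \<in> cball 0 R" for p y
    unfolding u_def using that bdd by (rule cSUP_upper)
  have least: "u y \<le> c" if "\<And>p. p \<in> cball 0 R \<Longrightarrow> p \<bullet> y - max_affine X h p \<le> c" for y c
    unfolding u_def using ne that by (rule cSUP_least)
  have "convex_on UNIV u"
  proof (rule convex_onI)
    fix t :: real and x y :: 'a assume t: "0 < t" "t < 1"
    show "u ((1 - t) *\<^sub>R x + t *\<^sub>R y) \<le> (1 - t) * u x + t * u y"
    proof (rule least)
      fix p :: 'a assume p: "p \<in> cball 0 R"
      have "p \<bullet> ((1 - t) *\<^sub>R x + t *\<^sub>R y) - max_affine X h p
         = (1 - t) * (p \<bullet> x - max_affine X h p) + t * (p \<bullet> y - max_affine X h p)"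
        by (simp add: inner_add_right algebra_simps)
      also have "\<dots> \<le> (1 - t) * u x + t * u y"
        using upper[OF p] t by (intro add_mono mult_left_mono) auto
      finally show "p \<bullet> ((1 - t) *\<^sub>R x + t *\<^sub>R y) - max_affine X h p \<le> (1 - t) * u x + t * u y" .
    qed
  qed simp
  moreover have "u x - u y \<le> R * norm (x - y)" for x y
  proof -
    have "u x \<le> u y + R * norm (x - y)"
    proof (rule least)
      fix p :: 'a assume p: "p \<in> cball 0 R"
      have "p \<bullet> (x - y) \<le> norm p * norm (x - y)" by (rule norm_cauchy_schwarz)
      also have "\<dots> \<le> R * norm (x - y)" using p by (intro mult_right_mono) auto
      finally show "p \<bullet> x - max_affine X h p \<le> u y + R * norm (x - y)"
        using upper[OF p, of y] by (simp add: inner_diff_right)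
    qed
    then show ?thesis by simp
  qed
  moreover have "\<exists>W\<in>sets borel. W \<subseteq> cball 0 R \<and> m x \<le> measure lborel W \<and>
       (\<forall>p\<in>W. \<forall>y. u x + p \<bullet> (y - x) \<le> u y)" if x: "x \<in> X" for x
  proof (intro bexI conjI ballI allI)
    let ?W = "{p \<in> cball 0 R. max_affine X h p = p \<bullet> x - h x}"
    show "?W \<subseteq> cball 0 R" by auto
    show "?W \<in> sets borel" by measurable
    show "m x \<le> measure lborel ?W" by (rule h[OF x])
    fix p y assume p: "p \<in> ?W"
    \<comment> \<open>Since \<open>max_affine X h p = p \<bullet> x - h x\<close> for
      \<open>p\<close> in the cell, this turns
      \<open>p \<bullet> y - max_affine X h p \<le> u y\<close> into the subgradient
      inequality.\<close>
    have "u x \<le> h x"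
    proof (rule least)
      fix q :: 'a
      show "q \<bullet> x - max_affine X h q \<le> h x" using max_affine_ge[OF X(1) x, of q h] by simp
    qed
    then show "u x + p \<bullet> (y - x) \<le> u y"
      using upper[of p y] p by (simp add: inner_diff_right)
  qed
  ultimately show thesis by (rule that)
qed

end

text \<open>The Brenier potential of a semi-discrete transport problem.\<close>

lemma semidiscrete_potential:
  fixes X :: "'a::euclidean_space set"
  assumes "finite X" "\<And>x. x \<in> X \<Longrightarrow> 0 < m x" "0 \<le> R"
    and total: "(\<Sum>x\<in>X. m x) = measure lborel (cball (0::'a) R)"
  obtains u :: "'a \<Rightarrow> real" where "convex_on UNIV u" "\<And>x y. \<bar>u x - u y\<bar> \<le> R * norm (x - y)" "u 0 = 0"
    "\<And>x. x \<in> X \<Longrightarrow> \<exists>W\<in>sets borel. W \<subseteq> cball 0 R \<and> m x \<le> measure lborel W \<and>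
       (\<forall>p\<in>W. \<forall>y. u x + p \<bullet> (y - x) \<le> u y)"
proof (cases "X = {}")
  case True
  show thesis
    by (rule that[of "\<lambda>_. 0"]) (use True assms in \<open>auto simp: convex_on_const\<close>)
next
  case False
  obtain u where u: "convex_on UNIV u" "\<And>x y. u x - u y \<le> R * norm (x - y)"
    "\<And>x. x \<in> X \<Longrightarrow> \<exists>W\<in>sets borel. W \<subseteq> cball 0 R \<and> m x \<le> measure lborel W \<and>
       (\<forall>p\<in>W. \<forall>y. u x + p \<bullet> (y - x) \<le> u y)"
    using semidiscrete_potential_aux[of X m R] False assms by blast
  show thesis
  \<comment> \<open>Fixing the additive constant gives
    \<open>\<bar>u y\<bar> \<le> R * norm y\<close>, hence bounds on \<open>u\<close> over bounded
    sets that depend on \<open>R\<close> alone.\<close>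
  proof (rule that[of "\<lambda>x. u x - u 0"])
    show "convex_on UNIV (\<lambda>x. u x - u 0)"
      using convex_on_add[OF u(1), of "\<lambda>_. - u 0"] by (simp add: convex_on_const)
    show "\<bar>u x - u 0 - (u y - u 0)\<bar> \<le> R * norm (x - y)" for x y
      using u(2)[of x y] u(2)[of y x] by (simp add: norm_minus_commute abs_le_iff)
  qed (use u(3) in auto)
qed

section \<open>Mollification\<close>

lemma partial_deriv_eq:
  "(F has_derivative D) (at x) \<Longrightarrow> partial_deriv j F x = D (axis j 1)"
  by (simp add: partial_deriv_def frechet_derivative_at[symmetric])

section \<open>Smooth kernels with compact support\<close>

definition exp_bump :: "nat \<Rightarrow> real \<Rightarrow> real" where
  "exp_bump n t = (if t \<le> 0 then 0 else exp (- (1 / t)) / t ^ n)"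

lemma exp_bump_tendsto_0: "(exp_bump n \<longlongrightarrow> 0) (at 0)"
proof -
  have "((\<lambda>s::real. s ^ n / exp s) \<longlongrightarrow> 0) at_top" by (rule tendsto_power_div_exp_0)
  then have "((\<lambda>t::real. inverse t ^ n / exp (inverse t)) \<longlongrightarrow> 0) (at_right 0)"
    by (rule filterlim_compose) (rule filterlim_inverse_at_top_right)
  then have "(exp_bump n \<longlongrightarrow> 0) (at_right 0)"
    by (rule Lim_transform_eventually)
       (auto simp: eventually_at_right_field exp_bump_def exp_minus field_simps intro!: exI[of _ 1])
  moreover have "(exp_bump n \<longlongrightarrow> 0) (at_left 0)"
    by (rule Lim_transform_eventually[OF tendsto_const])
       (auto simp: eventually_at_left_field exp_bump_def intro!: exI[of _ "-1"])
  ultimately show ?thesis by (simp add: filterlim_at_split)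
qed

text \<open>The powers of \<open>1 / t\<close> in \<open>exp_bump\<close> are there for this
  formula: the derivative is again a combination of members of the family.\<close>

lemma exp_bump_has_derivative:
  "(exp_bump n has_real_derivative exp_bump (n + 2) t - real n * exp_bump (n + 1) t) (at t)"
proof (cases t "0::real" rule: linorder_cases)
  case less
  have "((\<lambda>_. 0) has_real_derivative 0) (at t)" by simp
  then have "(exp_bump n has_real_derivative 0) (at t)"
    by (rule has_field_derivative_transform_within_open[of _ _ _ "{..<0}"])
       (use less in \<open>auto simp: exp_bump_def\<close>)
  then show ?thesis using less by (simp add: exp_bump_def)
next
  case equal
  \<comment> \<open>At 0 the difference quotient of \<open>exp_bump n\<close> is
    \<open>exp_bump (n + 1)\<close>, whose limit is already known to be 0.\<close>
  have "((\<lambda>h. (exp_bump n (0 + h) - exp_bump n 0) / h) \<longlongrightarrow> 0) (at 0)"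
  proof (rule Lim_transform_eventually[OF exp_bump_tendsto_0[of "n + 1"]])
    show "\<forall>\<^sub>F h in at 0. exp_bump (n + 1) h = (exp_bump n (0 + h) - exp_bump n 0) / h"
      by (rule always_eventually) (simp add: exp_bump_def)
  qed
  then show ?thesis using equal by (simp add: DERIV_def exp_bump_def)
next
  case greater
  have "((\<lambda>t. exp (- (1 / t)) / t ^ n) has_real_derivative
      (exp (- (1 / t)) * (1 / t^2) * t ^ n - exp (- (1 / t)) * (real n * t ^ (n - 1))) / (t ^ n * t ^ n)) (at t)"
    using greater by (auto intro!: derivative_eq_intros simp: power2_eq_square)
  also have "(exp (- (1 / t)) * (1 / t^2) * t ^ n - exp (- (1 / t)) * (real n * t ^ (n - 1))) / (t ^ n * t ^ n)
      = exp_bump (n + 2) t - real n * exp_bump (n + 1) t"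
    using greater by (cases n) (auto simp: exp_bump_def field_simps power2_eq_square)
  finally have "((\<lambda>t. exp (- (1 / t)) / t ^ n) has_real_derivative
      exp_bump (n + 2) t - real n * exp_bump (n + 1) t) (at t)" .
  then show ?thesis
    by (rule has_field_derivative_transform_within_open[of _ _ _ "{0<..}"])
       (use greater in \<open>auto simp: exp_bump_def\<close>)
qed

text \<open>An algebra of functions that contains the bump and is closed under partial derivatives.
  Smoothness of its members then follows from differentiability alone, by induction on the order in
  \<open>Ck\<close>.\<close>

inductive bump_algebra :: "real \<Rightarrow> (real^'n \<Rightarrow> real) \<Rightarrow> bool" for e where
  const: "bump_algebra e (\<lambda>_. c)"
| coord: "bump_algebra e (\<lambda>x. x $ i)"
| bump: "bump_algebra e (\<lambda>x. exp_bump n (e - x \<bullet> x))"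
| add: "bump_algebra e F \<Longrightarrow> bump_algebra e G \<Longrightarrow> bump_algebra e (\<lambda>x. F x + G x)"
| mult: "bump_algebra e F \<Longrightarrow> bump_algebra e G \<Longrightarrow> bump_algebra e (\<lambda>x. F x * G x)"

lemma bump_algebra_deriv:
  fixes F :: "real^'n \<Rightarrow> real"
  assumes "bump_algebra e F"
  shows "(\<forall>x. F differentiable (at x)) \<and> (\<forall>j. bump_algebra e (partial_deriv j F))"
  using assms
proof induction
  case (const c)
  have "((\<lambda>_::real^'n. c) has_derivative (\<lambda>_. 0)) (at x)" for x by simp
  then have "partial_deriv j (\<lambda>_::real^'n. c) = (\<lambda>_. 0)" for j
    using partial_deriv_eq by fastforce
  then show ?case using bump_algebra.const[of e] by simp
next
  case (coord i)
  have D: "((\<lambda>x::real^'n. x $ i) has_derivative (\<lambda>x. x $ i)) (at x)" for x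
    by (rule bounded_linear_imp_has_derivative) (rule bounded_linear_vec_nth)
  then have "partial_deriv j (\<lambda>x::real^'n. x $ i) = (\<lambda>_. axis j 1 $ i)" for j
    using partial_deriv_eq[OF D] by auto
  then show ?case using differentiableI[OF D] by (auto intro: bump_algebra.const)
next
  case (bump n)
  have D: "((\<lambda>x::real^'n. exp_bump n (e - x \<bullet> x)) has_derivative
     (\<lambda>v. (- 2 * (x \<bullet> v)) * (exp_bump (n + 2) (e - x \<bullet> x) - real n * exp_bump (n + 1) (e - x \<bullet> x)))) (at x)" for x
  proof -
    have "((\<lambda>x::real^'n. e - x \<bullet> x) has_derivative (\<lambda>v. - 2 * (x \<bullet> v))) (at x)"
      by (auto intro!: derivative_eq_intros simp: inner_commute)
    from has_derivative_compose[where f = "\<lambda>x::real^'n. e - x \<bullet> x" and g = "exp_bump n",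
        OF this exp_bump_has_derivative[unfolded has_field_derivative_def]]
    show ?thesis by (rule has_derivative_eq_rhs) (auto simp: algebra_simps)
  qed
  have P: "partial_deriv j (\<lambda>x::real^'n. exp_bump n (e - x \<bullet> x)) =
      (\<lambda>x. ((- 2) * (x $ j)) * (exp_bump (n + 2) (e - x \<bullet> x) + (- real n) * exp_bump (n + 1) (e - x \<bullet> x)))" for j
    using partial_deriv_eq[OF D] by (auto simp: inner_axis)
  show ?case
    unfolding P using differentiableI[OF D] by (intro conjI allI bump_algebra.intros) simp
next
  case (add F G)
  then have D: "((\<lambda>x. F x + G x) has_derivative
      (\<lambda>v. frechet_derivative F (at x) v + frechet_derivative G (at x) v)) (at x)" for x
    by (intro has_derivative_add) (auto simp: frechet_derivative_works[symmetric])
  have P: "partial_deriv j (\<lambda>x. F x + G x) = (\<lambda>x. partial_deriv j F x + partial_deriv j G x)" for j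
    using partial_deriv_eq[OF D] by (auto simp: partial_deriv_def)
  show ?case
    unfolding P using differentiableI[OF D] add.IH add.hyps by (intro conjI allI bump_algebra.intros) simp_all
next
  case (mult F G)
  then have D: "((\<lambda>x. F x * G x) has_derivative
      (\<lambda>v. F x * frechet_derivative G (at x) v + frechet_derivative F (at x) v * G x)) (at x)" for x
    by (intro has_derivative_mult) (auto simp: frechet_derivative_works[symmetric])
  have P: "partial_deriv j (\<lambda>x. F x * G x) = (\<lambda>x. F x * partial_deriv j G x + partial_deriv j F x * G x)" for j
    using partial_deriv_eq[OF D] by (auto simp: partial_deriv_def)
  show ?case
    unfolding P using differentiableI[OF D] mult.IH mult.hyps by (intro conjI allI bump_algebra.intros) simp_all
qed

lemma bump_algebra_smooth:
  assumes "bump_algebra e F" shows "smooth F"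
proof -
  have "Ck k F" for k
    using assms
  proof (induction k arbitrary: F)
    case 0
    then show ?case
      using bump_algebra_deriv
      by (auto simp: continuous_on_eq_continuous_at intro!: differentiable_imp_continuous_within)
  next
    case (Suc k)
    then show ?case
      using bump_algebra_deriv[OF Suc.prems]
      by (auto simp: continuous_on_eq_continuous_at differentiable_on_def
          intro!: differentiable_imp_continuous_within)
  qed
  then show ?thesis by (simp add: smooth_def)
qed

text \<open>Sign and total mass are left out so that partial derivatives of kernels are kernels of
  the same radius.\<close>

definition smooth_kernel :: "real \<Rightarrow> (real^'n \<Rightarrow> real) \<Rightarrow> bool" where
  "smooth_kernel \<epsilon> F \<longleftrightarrow> smooth F \<and> (\<forall>x. \<epsilon> < norm x \<longrightarrow> F x = 0)"

lemma smooth_continuous: "smooth F \<Longrightarrow> continuous_on UNIV F"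
  using Ck.simps(1) unfolding smooth_def by blast

lemma smooth_partial_deriv: "smooth F \<Longrightarrow> smooth (partial_deriv j F)"
  using Ck.simps(2) unfolding smooth_def by blast

lemma smooth_differentiable: "smooth F \<Longrightarrow> F differentiable (at x)"
  using Ck.simps(2)[of 0 F] unfolding smooth_def by (auto simp: differentiable_on_def)

lemma smooth_has_derivative:
  assumes "smooth (F :: real^'n \<Rightarrow> real)"
  shows "(F has_derivative (\<lambda>v. \<Sum>j\<in>UNIV. v $ j * partial_deriv j F x)) (at x)"
proof -
  let ?D = "frechet_derivative F (at x)"
  have D: "(F has_derivative ?D) (at x)"
    using smooth_differentiable[OF assms] by (simp add: frechet_derivative_works[symmetric])
  then have lin: "linear ?D" by (rule has_derivative_linear)
  have "?D v = (\<Sum>j\<in>UNIV. v $ j * partial_deriv j F x)" for v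
  proof -
    have "?D v = ?D (\<Sum>j\<in>UNIV. v $ j *\<^sub>R axis j 1)"
      using basis_expansion[of v] by (simp add: scalar_mult_eq_scaleR)
    then show ?thesis
      by (simp add: linear_sum[OF lin] linear_cmul[OF lin] partial_deriv_def)
  qed
  then have "?D = (\<lambda>v. \<Sum>j\<in>UNIV. v $ j * partial_deriv j F x)" by blast
  with D show ?thesis by metis
qed

lemma smooth_kernel_partial_deriv:
  assumes "smooth_kernel \<epsilon> F" shows "smooth_kernel \<epsilon> (partial_deriv j F)"
proof -
  have "partial_deriv j F x = 0" if "\<epsilon> < norm x" for x
  proof -
    have "((\<lambda>_. 0::real) has_derivative (\<lambda>_. 0)) (at x)" by simp
    moreover have "open {y::real^'a. \<epsilon> < norm y}"
      by (rule open_Collect_less) (auto intro!: continuous_intros)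
    ultimately have "(F has_derivative (\<lambda>_. 0)) (at x)"
      using assms that
      by (intro has_derivative_transform_within_open[of "\<lambda>_. 0" "\<lambda>_. 0" x UNIV "{y. \<epsilon> < norm y}" F])
         (auto simp: smooth_kernel_def)
    then show ?thesis using partial_deriv_eq by fastforce
  qed
  with assms show ?thesis by (simp add: smooth_kernel_def smooth_partial_deriv)
qed

lemma integrable_continuous_support:
  fixes f :: "'a::euclidean_space \<Rightarrow> real"
  assumes "continuous_on UNIV f" "\<And>y. y \<notin> cball x r \<Longrightarrow> f y = 0"
  shows "integrable lborel f"
proof -
  have "integrable lborel (\<lambda>y. indicator (cball x r) y *\<^sub>R f y)"
    by (rule borel_integrable_compact) (auto intro: continuous_on_subset[OF assms(1)])
  moreover have "(\<lambda>y. indicator (cball x r) y *\<^sub>R f y) = f"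
    using assms(2) by (intro ext) (auto simp: indicator_def)
  ultimately show ?thesis by simp
qed

lemma abs_integral_le_cball:
  fixes f :: "'a::euclidean_space \<Rightarrow> real"
  assumes "\<And>y. y \<notin> cball x r \<Longrightarrow> f y = 0" "\<And>y. y \<in> cball x r \<Longrightarrow> \<bar>f y\<bar> \<le> b" "0 \<le> b"
  shows "\<bar>LINT y|lborel. f y\<bar> \<le> b * measure lborel (cball x r)"
\<comment> \<open>A function that is not integrable has integral 0 by convention, so the bound
  covers that case too.\<close>
proof (cases "integrable lborel f")
  case True
  have "\<bar>LINT y|lborel. f y\<bar> \<le> (LINT y|lborel. \<bar>f y\<bar>)" by (rule integral_abs_bound)
  also have "\<dots> \<le> (LINT y|lborel. b * indicator (cball x r) y)"
  proof (rule integral_mono)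
    show "integrable lborel (\<lambda>y. b * indicat_real (cball x r) y)"
      using emeasure_bounded_finite[OF bounded_cball[of x r]]
      by (intro integrable_mult_right integrable_real_indicator) auto
    show "\<bar>f y\<bar> \<le> b * indicat_real (cball x r) y" for y
      using assms by (cases "y \<in> cball x r") (auto simp: indicator_def)
  qed (use True in auto)
  also have "\<dots> = b * measure lborel (cball x r)" by simp
  finally show ?thesis .
qed (use assms in \<open>simp add: not_integrable_integral_eq\<close>)

lemma smooth_kernel_exists:
  fixes dummy :: "'n::finite itself"
  assumes "0 < \<epsilon>"
  obtains \<rho> :: "real^'n \<Rightarrow> real" where "smooth_kernel \<epsilon> \<rho>" "\<And>x. 0 \<le> \<rho> x" "(LINT x|lborel. \<rho> x) = 1"
proof -
  define F :: "real^'n \<Rightarrow> real" where "F x = exp_bump 0 (\<epsilon>\<^sup>2 - x \<bullet> x)" for x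
  have F0: "F x = 0" if "\<epsilon> < norm x" for x
  proof -
    have "\<epsilon>\<^sup>2 \<le> (norm x)\<^sup>2" using that assms by (intro power_mono) auto
    then show ?thesis by (simp add: F_def exp_bump_def power2_norm_eq_inner)
  qed
  have Fpos: "0 \<le> F x" for x by (simp add: F_def exp_bump_def)
  have sF: "bump_algebra (\<epsilon>\<^sup>2) F" unfolding F_def[abs_def] by (rule bump_algebra.bump)
  have cF: "continuous_on UNIV F" by (rule smooth_continuous[OF bump_algebra_smooth[OF sF]])
  have iF: "integrable lborel F"
    by (rule integrable_continuous_support[OF cF, of 0 \<epsilon>]) (use F0 in auto)
  define I where "I = (LINT x|lborel. F x)"
  \<comment> \<open>The bump is positive on the open ball of radius \<open>\<epsilon>\<close>, which
    is not a null set.\<close>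
  have "I \<noteq> 0"
  proof
    assume "I = 0"
    then have "AE x in lborel. F x = 0"
      using integral_nonneg_eq_0_iff_AE[OF iF] Fpos by (simp add: I_def)
    then have "AE x in lborel. x \<notin> ball (0::real^'n) \<epsilon>"
    proof eventually_elim
      case (elim x)
      show ?case
      proof
        assume "x \<in> ball 0 \<epsilon>"
        then have "(norm x)\<^sup>2 < \<epsilon>\<^sup>2" by (intro power_strict_mono) auto
        then show False using elim by (simp add: F_def exp_bump_def power2_norm_eq_inner)
      qed
    qed
    then have "ball 0 \<epsilon> \<in> null_sets (lborel :: (real^'n) measure)"
      by (subst AE_iff_null_sets) auto
    then have "emeasure lborel (ball (0::real^'n) \<epsilon>) = 0" by auto
    then show False using assms content_ball_pos[of \<epsilon> "0::real^'n"] by (simp add: measure_def)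
  qed
  moreover have "0 \<le> I" unfolding I_def by (rule Bochner_Integration.integral_nonneg) (simp add: Fpos)
  ultimately have I: "0 < I" by simp
  show thesis
  proof (rule that[of "\<lambda>x. (1 / I) * F x"])
    show "smooth_kernel \<epsilon> (\<lambda>x. 1 / I * F x)"
      unfolding smooth_kernel_def
      using bump_algebra_smooth[OF bump_algebra.mult[OF bump_algebra.const[of _ "1 / I"] sF]] F0 by auto
  qed (use I Fpos in \<open>auto simp: I_def[symmetric] zero_le_divide_iff\<close>)
qed

text \<open>Uniform continuity on the compact ball of radius \<open>\<epsilon> + 1\<close> suffices:
  if one of two points at distance below 1 leaves that ball, both are outside the support.\<close>

lemma uniformly_continuous_kernel:
  fixes F :: "'a::euclidean_space \<Rightarrow> real"
  assumes "continuous_on UNIV F" "\<And>x. \<epsilon> < norm x \<Longrightarrow> F x = 0" "0 < e"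
  obtains d where "0 < d" "\<And>x y. norm (x - y) < d \<Longrightarrow> \<bar>F x - F y\<bar> < e"
proof -
  have "uniformly_continuous_on (cball 0 (\<epsilon> + 1)) F"
    by (intro compact_uniformly_continuous continuous_on_subset[OF assms(1)]) auto
  then obtain d where d: "0 < d"
    "\<And>x y. x \<in> cball 0 (\<epsilon> + 1) \<Longrightarrow> y \<in> cball 0 (\<epsilon> + 1) \<Longrightarrow> dist y x < d \<Longrightarrow> dist (F y) (F x) < e"
    using assms(3) unfolding uniformly_continuous_on_def by metis
  show thesis
  proof (rule that[of "min d 1"])
    fix x y :: 'a assume xy: "norm (x - y) < min d 1"
    show "\<bar>F x - F y\<bar> < e"
    proof (cases "norm x \<le> \<epsilon> + 1 \<and> norm y \<le> \<epsilon> + 1")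
      case True
      then show ?thesis using d(2)[of y x] xy by (simp add: dist_norm)
    next
      case False
      then have "\<epsilon> < norm x" "\<epsilon> < norm y"
        using xy norm_triangle_ineq2[of x y] norm_triangle_ineq2[of y x]
        by (auto simp: norm_minus_commute)
      then show ?thesis using assms by simp
    qed
  qed (use d in auto)
qed

section \<open>Second differences and the Hessian of a kernel\<close>

definition hess_form :: "(real^'n \<Rightarrow> real) \<Rightarrow> real^'n \<Rightarrow> real^'n \<Rightarrow> real" where
  "hess_form F v x = (\<Sum>i\<in>UNIV. \<Sum>j\<in>UNIV. v $ i * v $ j * partial_deriv j (partial_deriv i F) x)"

definition second_diff :: "('a::real_vector \<Rightarrow> real) \<Rightarrow> 'a \<Rightarrow> 'a \<Rightarrow> real" where
  "second_diff F v x = F (x + v) + F (x - v) - 2 * F x"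

lemma DERIV_along_line:
  assumes "smooth (F :: real^'n \<Rightarrow> real)"
  shows "((\<lambda>t. F (z + t *\<^sub>R v)) has_real_derivative
     (\<Sum>j\<in>UNIV. v $ j * partial_deriv j F (z + t *\<^sub>R v))) (at t)"
proof -
  have "((\<lambda>t. z + t *\<^sub>R v) has_derivative (\<lambda>s. s *\<^sub>R v)) (at t)"
    by (auto intro!: derivative_eq_intros)
  from has_derivative_compose[OF this, OF smooth_has_derivative[OF assms]]
  show ?thesis
    unfolding has_field_derivative_def
    by (rule has_derivative_eq_rhs) (auto simp: sum_distrib_left sum_distrib_right mult_ac)
qed

lemma hess_form_uminus: "hess_form F (- v) = hess_form F v"
  by (simp add: hess_form_def fun_eq_iff)

lemma taylor2_along_line:
  assumes "smooth (F :: real^'n \<Rightarrow> real)" "0 < t"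
  obtains s where "0 < s" "s \<le> t"
    "F (z + t *\<^sub>R v) = F z + t * (\<Sum>j\<in>UNIV. v $ j * partial_deriv j F z) + t\<^sup>2 / 2 * hess_form F v (z + s *\<^sub>R v)"
proof -
  define diff where "diff m t = (if m = (0::nat) then F (z + t *\<^sub>R v) else
     if m = 1 then (\<Sum>j\<in>UNIV. v $ j * partial_deriv j F (z + t *\<^sub>R v))
     else hess_form F v (z + t *\<^sub>R v))" for m t
  have "(diff m has_real_derivative diff (Suc m) t) (at t)" if "m < 2" for m t
  proof (cases "m = 0")
    case True
    have "diff 0 = (\<lambda>t. F (z + t *\<^sub>R v))" by (auto simp: diff_def)
    then show ?thesis
      using DERIV_along_line[OF assms(1), of z v t] True by (simp add: diff_def)
  next
    case False
    then have m: "m = 1" using that by simp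
    have "((\<lambda>t. \<Sum>i\<in>UNIV. v $ i * partial_deriv i F (z + t *\<^sub>R v)) has_real_derivative
       (\<Sum>i\<in>UNIV. v $ i * (\<Sum>j\<in>UNIV. v $ j * partial_deriv j (partial_deriv i F) (z + t *\<^sub>R v)))) (at t)"
      by (intro DERIV_sum DERIV_cmult DERIV_along_line smooth_partial_deriv assms)
    moreover have "diff 1 = (\<lambda>t. \<Sum>i\<in>UNIV. v $ i * partial_deriv i F (z + t *\<^sub>R v))"
      by (auto simp: diff_def)
    ultimately show ?thesis
      using m by (simp add: diff_def hess_form_def sum_distrib_left mult_ac)
  qed
  then obtain s where "0 < s" "s \<le> t"
    "diff 0 t = (\<Sum>m<2. diff m 0 / fact m * t ^ m) + diff 2 s / fact 2 * t ^ 2"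
    using Maclaurin2[of t diff "diff 0" 2] assms(2) by auto
  then show thesis
    by (intro that[of s]) (auto simp: diff_def numeral_2_eq_2 power2_eq_square)
qed

lemma smooth_kernel_hess_form:
  assumes "smooth_kernel \<epsilon> F"
  shows "continuous_on UNIV (hess_form F v)" "\<And>x. \<epsilon> < norm x \<Longrightarrow> hess_form F v x = 0"
proof -
  have k: "smooth_kernel \<epsilon> (partial_deriv j (partial_deriv i F))" for i j
    by (intro smooth_kernel_partial_deriv assms)
  show "continuous_on UNIV (hess_form F v)"
    unfolding hess_form_def[abs_def]
    by (intro continuous_intros smooth_continuous) (use k in \<open>auto simp: smooth_kernel_def\<close>)
  show "\<And>x. \<epsilon> < norm x \<Longrightarrow> hess_form F v x = 0"
    using k by (simp add: hess_form_def smooth_kernel_def)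
qed

text \<open>Expanding in the directions \<open>v\<close> and \<open>- v\<close> cancels the
  first-order terms; what remains is the mean of two values of \<open>hess_form\<close> near
  \<open>x\<close>. Uniform continuity of the Hessian makes \<open>d\<close> independent of
  \<open>x\<close>, as is needed under an integral.\<close>

lemma second_diff_approx:
  assumes "smooth_kernel \<epsilon> (F :: real^'n \<Rightarrow> real)" "0 < e"
  obtains d where "0 < d"
    "\<And>t x. 0 < t \<Longrightarrow> t < d \<Longrightarrow> \<bar>second_diff F (t *\<^sub>R v) x / t\<^sup>2 - hess_form F v x\<bar> \<le> e"
proof -
  have sF: "smooth F" using assms by (simp add: smooth_kernel_def)
  obtain d where d: "0 < d" "\<And>x y. norm (x - y) < d \<Longrightarrow> \<bar>hess_form F v x - hess_form F v y\<bar> < e"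
    using uniformly_continuous_kernel[OF smooth_kernel_hess_form[OF assms(1)] assms(2)] by metis
  show thesis
  proof (rule that[of "d / (norm v + 1)"])
    show "0 < d / (norm v + 1)" using d by (simp add: add_nonneg_pos)
    fix t :: real and x assume t: "0 < t" "t < d / (norm v + 1)"
    have n: "0 < norm v + 1" by (simp add: add_nonneg_pos)
    have small: "norm (s *\<^sub>R v) < d" if "0 < s" "s \<le> t" for s
    proof -
      have "norm (s *\<^sub>R v) \<le> t * (norm v + 1)" using that t by (auto intro!: mult_mono)
      also have "\<dots> < d" using t n by (simp add: field_simps)
      finally show ?thesis .
    qed
    obtain s where s: "0 < s" "s \<le> t" "F (x + t *\<^sub>R v) = F x + t * (\<Sum>j\<in>UNIV. v $ j * partial_deriv j F x)
        + t\<^sup>2 / 2 * hess_form F v (x + s *\<^sub>R v)"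
      using taylor2_along_line[OF sF t(1)] by blast
    obtain r where r: "0 < r" "r \<le> t" "F (x + t *\<^sub>R (- v)) = F x + t * (\<Sum>j\<in>UNIV. (- v) $ j * partial_deriv j F x)
        + t\<^sup>2 / 2 * hess_form F (- v) (x + r *\<^sub>R (- v))"
      using taylor2_along_line[OF sF t(1)] by blast
    have "second_diff F (t *\<^sub>R v) x
       = t\<^sup>2 * ((hess_form F v (x + s *\<^sub>R v) + hess_form F v (x - r *\<^sub>R v)) / 2)"
      using s(3) r(3) by (simp add: second_diff_def hess_form_uminus sum_negf algebra_simps)
    then have "second_diff F (t *\<^sub>R v) x / t\<^sup>2 = (hess_form F v (x + s *\<^sub>R v) + hess_form F v (x - r *\<^sub>R v)) / 2"
      using t by simp
    moreover have "\<bar>hess_form F v (x + s *\<^sub>R v) - hess_form F v x\<bar> < e"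
      using d(2)[of "x + s *\<^sub>R v" x] small[OF s(1,2)] by simp
    moreover have "\<bar>hess_form F v (x - r *\<^sub>R v) - hess_form F v x\<bar> < e"
      using d(2)[of "x - r *\<^sub>R v" x] small[OF r(1,2)] by simp
    ultimately show "\<bar>second_diff F (t *\<^sub>R v) x / t\<^sup>2 - hess_form F v x\<bar> \<le> e"
      by (simp add: abs_le_iff abs_less_iff field_simps)
  qed
qed

section \<open>Convolution with smooth kernels\<close>

definition locally_bounded :: "('a::euclidean_space \<Rightarrow> real) \<Rightarrow> bool" where
  "locally_bounded u \<longleftrightarrow> u \<in> borel_measurable borel \<and> (\<forall>r. \<exists>B. \<forall>y\<in>cball 0 r. \<bar>u y\<bar> \<le> B)"

definition convol :: "('a::euclidean_space \<Rightarrow> real) \<Rightarrow> ('a \<Rightarrow> real) \<Rightarrow> 'a \<Rightarrow> real" where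
  "convol u F x = (LINT y|lborel. u y * F (x - y))"

lemma locally_bounded_continuous:
  assumes "continuous_on UNIV u" shows "locally_bounded u"
  unfolding locally_bounded_def
proof (intro conjI allI)
  show "u \<in> borel_measurable borel" using assms by (rule borel_measurable_continuous_onI)
  fix r
  have "compact (u ` cball 0 r)"
    by (intro compact_continuous_image continuous_on_subset[OF assms]) auto
  then obtain B where "\<And>z. z \<in> u ` cball 0 r \<Longrightarrow> norm z \<le> B"
    using compact_imp_bounded bounded_iff by metis
  then show "\<exists>B. \<forall>y\<in>cball 0 r. \<bar>u y\<bar> \<le> B" by auto
qed

lemma integrable_convol:
  fixes u :: "'a::euclidean_space \<Rightarrow> real"
  assumes "locally_bounded u" "continuous_on UNIV F" "\<And>x. r < norm x \<Longrightarrow> F x = 0"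
  shows "integrable lborel (\<lambda>y. u y * F (x - y))"
proof -
  obtain B where B: "\<And>y. y \<in> cball 0 (norm x + r) \<Longrightarrow> \<bar>u y\<bar> \<le> B"
    using assms(1) unfolding locally_bounded_def by metis
  have [measurable]: "F \<in> borel_measurable borel" "u \<in> borel_measurable borel"
    using assms by (auto simp: locally_bounded_def intro: borel_measurable_continuous_onI)
  have c: "continuous_on UNIV (\<lambda>y. F (x - y))"
    by (rule continuous_on_compose2[OF assms(2)]) (auto intro!: continuous_intros)
  show ?thesis
  proof (rule Bochner_Integration.integrable_bound)
    show "integrable lborel (\<lambda>y. B * F (x - y))"
      by (intro integrable_mult_right integrable_continuous_support[of _ x r] c)
         (auto simp: dist_norm intro: assms(3))
    show "AE y in lborel. norm (u y * F (x - y)) \<le> norm (B * F (x - y))"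
    proof (rule AE_I2)
      fix y
      show "norm (u y * F (x - y)) \<le> norm (B * F (x - y))"
      proof (cases "norm (x - y) \<le> r")
        case True
        then have "norm y \<le> norm x + r" using norm_triangle_ineq2[of y x] by (simp add: norm_minus_commute)
        then have "\<bar>u y\<bar> \<le> \<bar>B\<bar>" using B[of y] by simp
        then show ?thesis by (auto simp: abs_mult intro!: mult_right_mono)
      qed (use assms(3) in simp)
    qed
  qed measurable
qed

lemma lborel_integral_translate:
  fixes f :: "'a::euclidean_space \<Rightarrow> real"
  assumes [measurable]: "f \<in> borel_measurable borel"
  shows "(LINT y|lborel. f (a + y)) = (LINT y|lborel. f y)"
proof -
  have "(LINT y|lborel. f y) = (LINT y|distr lborel borel ((+) a). f y)"
    by (simp only: lborel_distr_plus)
  also have "\<dots> = (LINT y|lborel. f (a + y))"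
    by (subst integral_distr) auto
  finally show ?thesis ..
qed

lemma lborel_integral_reflect:
  fixes f :: "'a::euclidean_space \<Rightarrow> real"
  assumes [measurable]: "f \<in> borel_measurable borel"
  shows "(LINT y|lborel. f (x - y)) = (LINT y|lborel. f y)"
proof -
  have "(lborel :: 'a measure) = distr lborel borel (\<lambda>y. x + (-1) *\<^sub>R y)"
    using lborel_affine[of "-1" x] by (simp add: density_1)
  then have "(LINT y|lborel. f y) = (LINT y|distr lborel borel (\<lambda>y. x + (-1) *\<^sub>R y). f y)"
    by simp
  also have "\<dots> = (LINT y|lborel. f (x - y))"
    by (subst integral_distr) auto
  finally show ?thesis ..
qed

lemma abs_convol_le:
  assumes "\<And>x. r < norm x \<Longrightarrow> F x = 0" "\<And>z. \<bar>F z\<bar> \<le> b" "\<And>y. y \<in> cball x r \<Longrightarrow> \<bar>u y\<bar> \<le> U"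
    "0 \<le> b" "0 \<le> U"
  shows "\<bar>convol u F x\<bar> \<le> U * b * measure lborel (cball x r)"
  unfolding convol_def
proof (rule abs_integral_le_cball)
  show "u y * F (x - y) = 0" if "y \<notin> cball x r" for y
    using that assms(1)[of "x - y"] by (simp add: dist_norm)
  show "\<bar>u y * F (x - y)\<bar> \<le> U * b" if "y \<in> cball x r" for y
    using assms that by (auto simp: abs_mult intro!: mult_mono)
qed (use assms in auto)

text \<open>The mean value theorem reduces the remainder to the oscillation of the partial
  derivatives. A threshold \<open>d\<close> valid for all \<open>z\<close> at once is what permits
  differentiating a convolution under the integral.\<close>

lemma smooth_kernel_uniformly_differentiable:
  assumes F: "smooth_kernel \<epsilon> (F :: real^'n \<Rightarrow> real)" and e: "0 < e"
  obtains d where "0 < d"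
    "\<And>z v. norm v < d \<Longrightarrow> \<bar>F (z + v) - F z - (\<Sum>j\<in>UNIV. v $ j * partial_deriv j F z)\<bar> \<le> e * norm v"
proof -
  have sF: "smooth F" using F by (simp add: smooth_kernel_def)
  define e' where "e' = e / CARD('n)"
  have e': "0 < e'" using e by (simp add: e'_def)
  have "\<exists>d>0. \<forall>x y. norm (x - y) < d \<longrightarrow> \<bar>partial_deriv j F x - partial_deriv j F y\<bar> < e'" for j
  proof -
    have "smooth_kernel \<epsilon> (partial_deriv j F)" by (rule smooth_kernel_partial_deriv[OF F])
    then have "continuous_on UNIV (partial_deriv j F)" "\<And>x. \<epsilon> < norm x \<Longrightarrow> partial_deriv j F x = 0"
      by (auto simp: smooth_kernel_def smooth_continuous)
    from uniformly_continuous_kernel[OF this e'] show ?thesis by blast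
  qed
  then obtain D where D: "\<And>j. 0 < D j"
    "\<And>j x y. norm (x - y) < D j \<Longrightarrow> \<bar>partial_deriv j F x - partial_deriv j F y\<bar> < e'" by metis
  define d where "d = Min (range D)"
  show thesis
  proof (rule that[of d])
    show "0 < d" using D(1) by (simp add: d_def)
    fix z v :: "real^'n" assume v: "norm v < d"
    have "\<exists>s>0. s < 1 \<and> F (z + 1 *\<^sub>R v) - F (z + 0 *\<^sub>R v)
        = (1 - 0) * (\<Sum>j\<in>UNIV. v $ j * partial_deriv j F (z + s *\<^sub>R v))"
      by (rule MVT2) (auto intro: DERIV_along_line[OF sF])
    then obtain s where s: "0 < s" "s < 1"
      "F (z + v) - F z = (\<Sum>j\<in>UNIV. v $ j * partial_deriv j F (z + s *\<^sub>R v))" by auto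
    have "\<bar>F (z + v) - F z - (\<Sum>j\<in>UNIV. v $ j * partial_deriv j F z)\<bar>
       = \<bar>\<Sum>j\<in>UNIV. v $ j * (partial_deriv j F (z + s *\<^sub>R v) - partial_deriv j F z)\<bar>"
      by (simp add: s(3) right_diff_distrib sum_subtractf)
    also have "\<dots> \<le> (\<Sum>j\<in>UNIV. \<bar>v $ j * (partial_deriv j F (z + s *\<^sub>R v) - partial_deriv j F z)\<bar>)"
      by (rule sum_abs)
    also have "\<dots> \<le> (\<Sum>j\<in>(UNIV::'n set). norm v * e')"
    proof (rule sum_mono)
      fix j
      have "norm (s *\<^sub>R v) \<le> norm v" using s by (simp add: mult_left_le_one_le)
      also have "\<dots> < D j" using v by (simp add: d_def)
      finally have "\<bar>partial_deriv j F (z + s *\<^sub>R v) - partial_deriv j F z\<bar> < e'"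
        by (intro D(2)) simp
      then show "\<bar>v $ j * (partial_deriv j F (z + s *\<^sub>R v) - partial_deriv j F z)\<bar> \<le> norm v * e'"
        unfolding abs_mult by (intro mult_mono component_le_norm_cart) auto
    qed
    also have "\<dots> = e * norm v" by (simp add: e'_def)
    finally show "\<bar>F (z + v) - F z - (\<Sum>j\<in>UNIV. v $ j * partial_deriv j F z)\<bar> \<le> e * norm v" .
  qed
qed

lemma integrable_convol_kernel:
  "locally_bounded u \<Longrightarrow> smooth_kernel \<epsilon> F \<Longrightarrow> integrable lborel (\<lambda>y. u y * F (x - y))"
  by (rule integrable_convol[of u F \<epsilon>]) (auto simp: smooth_kernel_def smooth_continuous)

lemma convol_has_derivative:
  assumes u: "locally_bounded u" and F: "smooth_kernel \<epsilon> (F :: real^'n \<Rightarrow> real)"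
  shows "(convol u F has_derivative (\<lambda>v. \<Sum>j\<in>UNIV. v $ j * convol u (partial_deriv j F) x)) (at x)"
  unfolding has_derivative_at_alt
proof (intro conjI allI impI)
  show "bounded_linear (\<lambda>v. \<Sum>j\<in>UNIV. v $ j * convol u (partial_deriv j F) x)"
    by (intro bounded_linear_sum bounded_linear_mult_const bounded_linear_vec_nth)
  fix e :: real assume e: "0 < e"
  \<comment> \<open>The unit margin keeps the supports of the kernel centred at \<open>x\<close> and
    at any \<open>x'\<close> within distance 1 inside one ball.\<close>
  define V where "V = measure lborel (cball x (\<epsilon> + 1))"
  have V: "0 \<le> V" by (simp add: V_def)
  obtain U where U: "\<And>y. y \<in> cball 0 (norm x + \<epsilon> + 1) \<Longrightarrow> \<bar>u y\<bar> \<le> U"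
    using u unfolding locally_bounded_def by metis
  have U': "\<bar>u y\<bar> \<le> \<bar>U\<bar>" if "y \<in> cball x (\<epsilon> + 1)" for y
  proof -
    have "norm y \<le> norm x + \<epsilon> + 1"
      using that norm_triangle_ineq2[of y x] by (simp add: dist_norm norm_minus_commute)
    then show ?thesis using U[of y] by auto
  qed
  \<comment> \<open>The \<open>+ 1\<close> keeps \<open>C\<close> positive, so that
    \<open>e / C\<close> is admissible even if \<open>u\<close> is bounded by 0.\<close>
  define C where "C = \<bar>U\<bar> * V + 1"
  have C: "0 < C" using V by (simp add: C_def add_nonneg_pos)
  obtain d where d: "0 < d"
    "\<And>z v. norm v < d \<Longrightarrow> \<bar>F (z + v) - F z - (\<Sum>j\<in>UNIV. v $ j * partial_deriv j F z)\<bar> \<le> e / C * norm v"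
    using smooth_kernel_uniformly_differentiable[OF F divide_pos_pos[OF e C]] by blast
  show "\<exists>d>0. \<forall>y. norm (y - x) < d \<longrightarrow> norm (convol u F y - convol u F x -
      (\<Sum>j\<in>UNIV. (y - x) $ j * convol u (partial_deriv j F) x)) \<le> e * norm (y - x)"
  proof (intro exI[of _ "min d 1"] conjI allI impI)
    fix x' assume x': "norm (x' - x) < min d 1"
    define v where "v = x' - x"
    have Fj: "smooth_kernel \<epsilon> (partial_deriv j F)" for j by (rule smooth_kernel_partial_deriv[OF F])
    have i1: "integrable lborel (\<lambda>y. u y * F (z - y))" for z by (rule integrable_convol_kernel[OF u F])
    have i2: "integrable lborel (\<lambda>y. u y * partial_deriv j F (z - y))" for z j
      by (rule integrable_convol_kernel[OF u Fj])
    define f where "f y = u y * F (x' - y) - u y * F (x - y) - (\<Sum>j\<in>UNIV. v $ j * (u y * partial_deriv j F (x - y)))" for y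
    have "convol u F x' - convol u F x - (\<Sum>j\<in>UNIV. v $ j * convol u (partial_deriv j F) x)
      = (LINT y|lborel. f y)"
      unfolding f_def convol_def using i1 i2 by simp
    also have "\<bar>\<dots>\<bar> \<le> (\<bar>U\<bar> * (e / C * norm v)) * measure lborel (cball x (\<epsilon> + 1))"
    proof (rule abs_integral_le_cball)
      fix y assume "y \<notin> cball x (\<epsilon> + 1)"
      then have n: "\<epsilon> + 1 < norm (x - y)" by (simp add: dist_norm)
      then have "\<epsilon> < norm (x' - y)"
        using x' norm_triangle_ineq2[of "x - y" "x - x'"] by (simp add: norm_minus_commute)
      then show "f y = 0" using n F Fj by (simp add: f_def smooth_kernel_def)
    next
      fix y assume y: "y \<in> cball x (\<epsilon> + 1)"
      have "f y = u y * (F ((x - y) + v) - F (x - y) - (\<Sum>j\<in>UNIV. v $ j * partial_deriv j F (x - y)))"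
        by (simp add: f_def v_def right_diff_distrib sum_distrib_left algebra_simps)
      then have "\<bar>f y\<bar> = \<bar>u y\<bar> * \<bar>F ((x - y) + v) - F (x - y) - (\<Sum>j\<in>UNIV. v $ j * partial_deriv j F (x - y))\<bar>"
        by (simp only: abs_mult)
      also have "\<dots> \<le> \<bar>U\<bar> * (e / C * norm v)"
        using x' by (intro mult_mono U'[OF y] d(2)) (auto simp: v_def)
      finally show "\<bar>f y\<bar> \<le> \<bar>U\<bar> * (e / C * norm v)" .
    next
      show "0 \<le> \<bar>U\<bar> * (e / C * norm v)" using e C by simp
    qed
    also have "\<dots> = (\<bar>U\<bar> * V) / C * (e * norm v)" by (simp add: V_def)
    also have "\<dots> \<le> 1 * (e * norm v)"
      using e C by (intro mult_right_mono) (auto simp: C_def)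
    finally show "norm (convol u F x' - convol u F x -
      (\<Sum>j\<in>UNIV. (x' - x) $ j * convol u (partial_deriv j F) x)) \<le> e * norm (x' - x)"
      by (simp add: v_def)
  qed (use d in auto)
qed

lemma partial_deriv_convol:
  assumes "locally_bounded u" "smooth_kernel \<epsilon> (F :: real^'n \<Rightarrow> real)"
  shows "partial_deriv j (convol u F) = convol u (partial_deriv j F)"
proof
  fix x
  have "partial_deriv j (convol u F) x = (\<Sum>i\<in>UNIV. axis j 1 $ i * convol u (partial_deriv i F) x)"
    by (rule partial_deriv_eq[OF convol_has_derivative[OF assms]])
  also have "\<dots> = (\<Sum>i\<in>UNIV. if i = j then convol u (partial_deriv i F) x else 0)"
    by (rule sum.cong) (auto simp: axis_def)
  finally show "partial_deriv j (convol u F) x = convol u (partial_deriv j F) x" by simp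
qed

lemma smooth_convol:
  assumes u: "locally_bounded u" and "smooth_kernel \<epsilon> (F :: real^'n \<Rightarrow> real)"
  shows "smooth (convol u F)"
proof -
  have D: "convol u F differentiable (at x)" if "smooth_kernel \<epsilon> F" for F x
    using convol_has_derivative[OF u that] by (rule differentiableI)
  have C: "continuous_on UNIV (convol u F)" if "smooth_kernel \<epsilon> F" for F
    using D[OF that] by (auto simp: continuous_on_eq_continuous_at intro!: differentiable_imp_continuous_within)
  have "Ck k (convol u F)" for k
    using assms(2)
  proof (induction k arbitrary: F)
    case (Suc k)
    then show ?case
      using D C smooth_kernel_partial_deriv[OF Suc.prems]
      by (auto simp: differentiable_on_def partial_deriv_convol[OF u Suc.prems])
  qed (use C in auto)
  then show ?thesis by (simp add: smooth_def)
qed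

lemma hess_form_convol:
  assumes u: "locally_bounded u" and F: "smooth_kernel \<epsilon> (F :: real^'n \<Rightarrow> real)"
  shows "hess_form (convol u F) v x = convol u (hess_form F v) x"
proof -
  have k: "smooth_kernel \<epsilon> (partial_deriv j (partial_deriv i F))" for i j
    by (intro smooth_kernel_partial_deriv F)
  have i: "integrable lborel (\<lambda>y. u y * partial_deriv j (partial_deriv i F) (x - y))" for i j
    by (rule integrable_convol_kernel[OF u k])
  have "partial_deriv j (partial_deriv i (convol u F)) = convol u (partial_deriv j (partial_deriv i F))" for i j
    by (simp add: partial_deriv_convol[OF u F] partial_deriv_convol[OF u smooth_kernel_partial_deriv[OF F]])
  then have "hess_form (convol u F) v x = (\<Sum>i\<in>UNIV. \<Sum>j\<in>UNIV.
       (LINT y|lborel. v $ i * v $ j * (u y * partial_deriv j (partial_deriv i F) (x - y))))"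
    using i by (simp add: hess_form_def convol_def)
  also have "\<dots> = (LINT y|lborel. (\<Sum>i\<in>UNIV. \<Sum>j\<in>UNIV. v $ i * v $ j * (u y * partial_deriv j (partial_deriv i F) (x - y))))"
    using i by simp
  also have "\<dots> = convol u (hess_form F v) x"
    by (simp add: convol_def hess_form_def sum_distrib_left mult_ac)
  finally show ?thesis .
qed

lemma locally_bounded_translate:
  assumes "locally_bounded (u :: 'a::euclidean_space \<Rightarrow> real)" shows "locally_bounded (\<lambda>y. u (y + v))"
  unfolding locally_bounded_def
proof (intro conjI allI)
  have [measurable]: "u \<in> borel_measurable borel" using assms by (simp add: locally_bounded_def)
  show "(\<lambda>y. u (y + v)) \<in> borel_measurable borel" by measurable
  fix r
  obtain B where B: "\<And>y. y \<in> cball 0 (r + norm v) \<Longrightarrow> \<bar>u y\<bar> \<le> B"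
    using assms unfolding locally_bounded_def by metis
  have "\<bar>u (y + v)\<bar> \<le> B" if "y \<in> cball 0 r" for y
    using that norm_triangle_ineq[of y v] by (intro B) auto
  then show "\<exists>B. \<forall>y\<in>cball 0 r. \<bar>u (y + v)\<bar> \<le> B" by blast
qed

text \<open>Translation invariance of Lebesgue measure moves the shifts from the kernel to
  \<open>u\<close>: a discrete integration by parts that asks for no regularity of
  \<open>u\<close>.\<close>

lemma convol_second_diff:
  fixes u :: "'a::euclidean_space \<Rightarrow> real"
  assumes u: "locally_bounded u" and F: "continuous_on UNIV F" "\<And>x. \<epsilon> < norm x \<Longrightarrow> F x = 0"
  shows "convol u (second_diff F v) x = convol (second_diff u v) F x"
proof -
  have [measurable]: "u \<in> borel_measurable borel" "F \<in> borel_measurable borel"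
    using assms by (auto simp: locally_bounded_def intro: borel_measurable_continuous_onI)
  have i1: "integrable lborel (\<lambda>y. u y * F (z - y))" for z by (rule integrable_convol[OF u F])
  have i2: "integrable lborel (\<lambda>y. u (y + w) * F (z - y))" for w z
    by (rule integrable_convol[OF locally_bounded_translate[OF u] F])
  have t: "(LINT y|lborel. u y * F (x + w - y)) = (LINT y|lborel. u (y + w) * F (x - y))" for w
  proof -
    have "(LINT y|lborel. u (w + y) * F (x + w - (w + y))) = (LINT y|lborel. u y * F (x + w - y))"
      using lborel_integral_translate[of "\<lambda>y. u y * F (x + w - y)" w] by simp
    moreover have "(LINT y|lborel. u (w + y) * F (x + w - (w + y))) = (LINT y|lborel. u (y + w) * F (x - y))"
      by (rule Bochner_Integration.integral_cong) (simp_all add: add.commute[of w])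
    ultimately show ?thesis by simp
  qed
  have "convol u (second_diff F v) x
     = (LINT y|lborel. u y * F (x + v - y) + u y * F (x + (-v) - y) - 2 * (u y * F (x - y)))"
    unfolding convol_def second_diff_def
    by (rule Bochner_Integration.integral_cong) (auto simp: algebra_simps)
  also have "\<dots> = (LINT y|lborel. u y * F (x + v - y)) + (LINT y|lborel. u y * F (x + (-v) - y))
      - 2 * (LINT y|lborel. u y * F (x - y))"
    using i1 by simp
  also have "\<dots> = (LINT y|lborel. u (y + v) * F (x - y) + u (y + (-v)) * F (x - y) - 2 * (u y * F (x - y)))"
    unfolding t using i1 i2[of v x] i2[of "- v" x] by simp
  also have "\<dots> = convol (second_diff u v) F x"
    unfolding convol_def second_diff_def
    by (rule Bochner_Integration.integral_cong) (auto simp: algebra_simps)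
  finally show ?thesis .
qed

section \<open>Convexity and slope bounds under mollification\<close>

lemma convex_second_diff_nonneg:
  fixes u :: "'a::real_vector \<Rightarrow> real"
  assumes "convex_on UNIV u" shows "0 \<le> second_diff u v x"
proof -
  have "u ((1 - 1/2) *\<^sub>R (x + v) + (1/2) *\<^sub>R (x - v)) \<le> (1 - 1/2) * u (x + v) + (1/2) * u (x - v)"
    by (rule convex_onD[OF assms]) auto
  moreover have "(1 - 1/2) *\<^sub>R (x + v) + (1/2) *\<^sub>R (x - v) = ((1/2 + 1/2) *\<^sub>R x :: 'a)"
    by (simp only: scaleR_add_left) (simp add: scaleR_add_right scaleR_diff_right)
  ultimately show ?thesis by (simp add: second_diff_def)
qed

lemma convol_nonneg:
  assumes "\<And>y. 0 \<le> u y" "\<And>y. 0 \<le> F y" shows "0 \<le> convol u F x"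
  unfolding convol_def using assms by (intro Bochner_Integration.integral_nonneg) simp

text \<open>\<open>u\<close> need not be twice differentiable. The Hessian falls on the kernel, is
  approximated there by second differences uniformly, and these are moved to \<open>u\<close>, where
  convexity makes them nonnegative.\<close>

lemma hess_form_convol_nonneg:
  assumes u: "convex_on UNIV u" "continuous_on UNIV u"
    and F: "smooth_kernel \<epsilon> (F :: real^'n \<Rightarrow> real)" "\<And>x. 0 \<le> F x"
  shows "0 \<le> hess_form (convol u F) v x"
proof (rule field_le_epsilon)
  fix e :: real assume e: "0 < e"
  have lb: "locally_bounded u" by (rule locally_bounded_continuous[OF u(2)])
  have cF: "continuous_on UNIV F" and F0: "\<And>x. \<epsilon> < norm x \<Longrightarrow> F x = 0"
    using F by (auto simp: smooth_kernel_def smooth_continuous)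
  define r where "r = \<bar>\<epsilon>\<bar> + 1"
  obtain U where U: "\<And>y. y \<in> cball 0 (norm x + r) \<Longrightarrow> \<bar>u y\<bar> \<le> U"
    using lb unfolding locally_bounded_def by metis
  have U': "\<bar>u y\<bar> \<le> \<bar>U\<bar>" if "y \<in> cball x r" for y
  proof -
    have "norm y \<le> norm x + r"
      using that norm_triangle_ineq2[of y x] by (simp add: dist_norm norm_minus_commute)
    then show ?thesis using U[of y] by auto
  qed
  define C where "C = \<bar>U\<bar> * measure lborel (cball x r) + 1"
  have C: "0 < C" by (simp add: C_def add_nonneg_pos)
  obtain d where d: "0 < d"
    "\<And>t x. 0 < t \<Longrightarrow> t < d \<Longrightarrow> \<bar>second_diff F (t *\<^sub>R v) x / t\<^sup>2 - hess_form F v x\<bar> \<le> e / C"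
    using second_diff_approx[OF F(1) divide_pos_pos[OF e C]] by blast
  \<comment> \<open>The first bound makes the approximation valid; the second gives
    \<open>norm (t *\<^sub>R v) \<le> 1\<close>, so the second difference of the kernel still
    vanishes beyond radius \<open>r\<close>.\<close>
  define t where "t = min (d / 2) (1 / (norm v + 1))"
  have n: "0 < norm v + 1" by (simp add: add_nonneg_pos)
  have t: "0 < t" "t < d" using d n by (auto simp: t_def)
  have "t * norm v \<le> 1 / (norm v + 1) * norm v" unfolding t_def by (intro mult_right_mono) auto
  also have "\<dots> \<le> 1" using n by (simp add: field_simps)
  finally have tv: "norm (t *\<^sub>R v) \<le> 1" using t by simp
  have sd0: "second_diff F (t *\<^sub>R v) z = 0" if "r < norm z" for z
  proof -
    have "\<epsilon> < norm (z + t *\<^sub>R v)"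
      using that tv norm_diff_ineq[of z "t *\<^sub>R v"] unfolding r_def by linarith
    moreover have "\<epsilon> < norm (z - t *\<^sub>R v)"
      using that tv norm_triangle_ineq2[of z "t *\<^sub>R v"] unfolding r_def by linarith
    moreover have "\<epsilon> < norm z" using that unfolding r_def by linarith
    ultimately show ?thesis using F0 by (simp add: second_diff_def)
  qed
  have csd: "continuous_on UNIV (second_diff F (t *\<^sub>R v))"
    unfolding second_diff_def[abs_def]
    by (intro continuous_intros continuous_on_compose2[OF cF]) auto
  have "convol u (hess_form F v) x - convol u (second_diff F (t *\<^sub>R v)) x / t\<^sup>2
    = convol u (\<lambda>z. hess_form F v z - second_diff F (t *\<^sub>R v) z / t\<^sup>2) x"
  proof -
    have "integrable lborel (\<lambda>y. u y * hess_form F v (x - y))"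
      by (rule integrable_convol[OF lb smooth_kernel_hess_form[OF F(1)]])
    moreover have "integrable lborel (\<lambda>y. u y * second_diff F (t *\<^sub>R v) (x - y))"
      by (rule integrable_convol[OF lb csd sd0])
    ultimately show ?thesis
      unfolding convol_def by (simp add: right_diff_distrib)
  qed
  also have "\<bar>\<dots>\<bar> \<le> \<bar>U\<bar> * (e / C) * measure lborel (cball x r)"
  proof (rule abs_convol_le)
    show "hess_form F v z - second_diff F (t *\<^sub>R v) z / t\<^sup>2 = 0" if "r < norm z" for z
      using sd0[OF that] smooth_kernel_hess_form(2)[OF F(1), of z] that by (simp add: r_def)
    show "\<bar>hess_form F v z - second_diff F (t *\<^sub>R v) z / t\<^sup>2\<bar> \<le> e / C" for z
      using d(2)[OF t, of z] by (simp add: abs_minus_commute)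
  qed (use U' e C in auto)
  also have "\<dots> = (\<bar>U\<bar> * measure lborel (cball x r)) / C * e" by simp
  also have "\<dots> \<le> 1 * e" using e C by (intro mult_right_mono) (auto simp: C_def)
  finally have "\<bar>convol u (hess_form F v) x - convol u (second_diff F (t *\<^sub>R v)) x / t\<^sup>2\<bar> \<le> e" by simp
  moreover have sd_eq: "convol u (second_diff F (t *\<^sub>R v)) x = convol (second_diff u (t *\<^sub>R v)) F x"
    by (rule convol_second_diff[OF lb cF]) (rule F0)
  have "0 \<le> convol u (second_diff F (t *\<^sub>R v)) x / t\<^sup>2"
    unfolding sd_eq
    using convol_nonneg[of "second_diff u (t *\<^sub>R v)" F x, OF convex_second_diff_nonneg[OF u(1)] F(2)] by simp
  ultimately show "0 \<le> hess_form (convol u F) v x + e"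
    by (simp add: hess_form_convol[OF lb F(1)] abs_le_iff)
qed

lemma convol_lipschitz:
  fixes u :: "'a::euclidean_space \<Rightarrow> real"
  assumes u: "\<And>x y. \<bar>u x - u y\<bar> \<le> R * norm (x - y)" "continuous_on UNIV u"
    and F: "continuous_on UNIV F" "\<And>x. \<epsilon> < norm x \<Longrightarrow> F x = 0" "\<And>x. 0 \<le> F x" "(LINT x|lborel. F x) = 1"
  shows "\<bar>convol u F x - convol u F y\<bar> \<le> R * norm (x - y)"
proof -
  have lb: "locally_bounded u" by (rule locally_bounded_continuous[OF u(2)])
  have [measurable]: "u \<in> borel_measurable borel" "F \<in> borel_measurable borel"
    using assms by (auto intro: borel_measurable_continuous_onI)
  have iF: "integrable lborel F"
    by (rule integrable_continuous_support[OF F(1), of 0 \<epsilon>]) (use F in auto)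
  \<comment> \<open>In reflected form \<open>x\<close> enters only through \<open>u\<close>, so the
    Lipschitz bound applies under the integral, weighted by a kernel of mass 1.\<close>
  have r: "convol u F x = (LINT z|lborel. u (x - z) * F z)" for x
    unfolding convol_def using lborel_integral_reflect[of "\<lambda>y. u y * F (x - y)" x] by simp
  have i: "integrable lborel (\<lambda>z. u (x - z) * F z)" for x
  proof (rule integrable_continuous_support[of _ 0 \<epsilon>])
    show "continuous_on UNIV (\<lambda>z. u (x - z) * F z)"
      by (intro continuous_intros continuous_on_compose2[OF u(2)] F) auto
  qed (use F in auto)
  have "convol u F x - convol u F y = (LINT z|lborel. u (x - z) * F z - u (y - z) * F z)"
    unfolding r using i by simp
  also have "\<bar>\<dots>\<bar> \<le> (LINT z|lborel. \<bar>u (x - z) * F z - u (y - z) * F z\<bar>)"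
    by (rule integral_abs_bound)
  also have "\<dots> \<le> (LINT z|lborel. (R * norm (x - y)) * F z)"
  proof (rule integral_mono)
    fix z
    have "\<bar>u (x - z) * F z - u (y - z) * F z\<bar> = \<bar>u (x - z) - u (y - z)\<bar> * F z"
      using F(3)[of z] by (simp add: left_diff_distrib[symmetric] abs_mult)
    also have "\<dots> \<le> (R * norm (x - y)) * F z"
      using u(1)[of "x - z" "y - z"] F(3)[of z] by (intro mult_right_mono) auto
    finally show "\<bar>u (x - z) * F z - u (y - z) * F z\<bar> \<le> (R * norm (x - y)) * F z" .
  qed (use i iF in auto)
  also have "\<dots> = R * norm (x - y)" using iF F by simp
  finally show ?thesis .
qed

text \<open>Differentiating along the gradient itself bounds its squared norm by \<open>R\<close>
  times its norm.\<close>

lemma norm_grad_le: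
  assumes W: "smooth (W :: real^'n \<Rightarrow> real)" and L: "\<And>x y. \<bar>W x - W y\<bar> \<le> R * norm (x - y)" and R: "0 \<le> R"
  shows "norm (grad W x) \<le> R"
proof -
  define v where "v = grad W x"
  have "((\<lambda>t. W (x + t *\<^sub>R v)) has_real_derivative
     (\<Sum>j\<in>UNIV. v $ j * partial_deriv j W (x + 0 *\<^sub>R v))) (at 0)"
    by (rule DERIV_along_line[OF W])
  moreover have "(\<Sum>j\<in>UNIV. v $ j * partial_deriv j W (x + 0 *\<^sub>R v)) = v \<bullet> v"
    by (simp add: v_def grad_def inner_vec_def)
  ultimately have "((\<lambda>h. (W (x + h *\<^sub>R v) - W x) / h) \<longlongrightarrow> v \<bullet> v) (at 0)"
    by (simp add: DERIV_def)
  moreover have "\<forall>\<^sub>F h in at (0::real). (W (x + h *\<^sub>R v) - W x) / h \<le> R * norm v"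
  proof (rule eventually_at_topological[THEN iffD2], intro exI[of _ UNIV] conjI ballI impI)
    fix h :: real assume "h \<noteq> 0"
    have "(W (x + h *\<^sub>R v) - W x) / h \<le> \<bar>(W (x + h *\<^sub>R v) - W x) / h\<bar>" by (rule abs_ge_self)
    also have "\<dots> \<le> R * (\<bar>h\<bar> * norm v) / \<bar>h\<bar>"
      using divide_right_mono[OF L[of "x + h *\<^sub>R v" x] abs_ge_zero[of h]] by (simp add: abs_divide)
    also have "\<dots> = R * norm v" using \<open>h \<noteq> 0\<close> by simp
    finally show "(W (x + h *\<^sub>R v) - W x) / h \<le> R * norm v" .
  qed auto
  ultimately have "v \<bullet> v \<le> R * norm v"
    by (rule tendsto_upperbound) simp
  then have "norm v * norm v \<le> R * norm v" by (simp add: dot_square_norm power2_eq_square)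
  then show ?thesis using R by (cases "norm v = 0") (auto simp: v_def)
qed

section \<open>Lattice discretisation of the Hessian\<close>

lemma kernel_bounded:
  fixes F :: "'a::euclidean_space \<Rightarrow> real"
  assumes "continuous_on UNIV F" "\<And>x. \<epsilon> < norm x \<Longrightarrow> F x = 0"
  obtains M where "0 \<le> M" "\<And>x. \<bar>F x\<bar> \<le> M"
proof -
  have "compact (F ` cball 0 \<epsilon>)"
    by (intro compact_continuous_image continuous_on_subset[OF assms(1)]) auto
  then obtain B where B: "\<And>z. z \<in> F ` cball 0 \<epsilon> \<Longrightarrow> norm z \<le> B"
    using compact_imp_bounded bounded_iff by metis
  show thesis
  proof (rule that[of "\<bar>B\<bar>"])
    show "\<bar>F x\<bar> \<le> \<bar>B\<bar>" for x
    proof (cases "norm x \<le> \<epsilon>")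
      case True
      then have "norm (F x) \<le> B" by (intro B imageI) simp
      then show ?thesis by simp
    qed (use assms(2) in simp)
  qed simp
qed

lemma second_diff_kernel:
  fixes F :: "'a::euclidean_space \<Rightarrow> real"
  assumes "continuous_on UNIV F" "\<And>x. \<epsilon> < norm x \<Longrightarrow> F x = 0" and "norm v \<le> 1"
  shows "continuous_on UNIV (second_diff F v)" "\<And>z. \<epsilon> + 1 < norm z \<Longrightarrow> second_diff F v z = 0"
proof -
  show "continuous_on UNIV (second_diff F v)"
    unfolding second_diff_def[abs_def]
    by (intro continuous_intros continuous_on_compose2[OF assms(1)]) auto
  fix z :: 'a assume z: "\<epsilon> + 1 < norm z"
  have "\<epsilon> < norm (z + v)" using z assms(3) norm_diff_ineq[of z v] by linarith
  moreover have "\<epsilon> < norm (z - v)" using z assms(3) norm_triangle_ineq2[of z v] by linarith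
  moreover have "\<epsilon> < norm z" using z by linarith
  ultimately show "second_diff F v z = 0" using assms(2) by (simp add: second_diff_def)
qed

lemma lipschitz_continuous:
  fixes u :: "'a::real_normed_vector \<Rightarrow> real"
  assumes "\<And>x y. \<bar>u x - u y\<bar> \<le> R * norm (x - y)" shows "continuous_on S u"
proof (rule continuous_onI)
  fix x e assume "0 < (e::real)"
  have R: "0 < \<bar>R\<bar> + 1" by simp
  show "\<exists>d>0. \<forall>x'\<in>S. dist x' x < d \<longrightarrow> dist (u x') (u x) \<le> e"
  proof (intro exI[of _ "e / (\<bar>R\<bar> + 1)"] conjI ballI impI)
    show "0 < e / (\<bar>R\<bar> + 1)" using \<open>0 < e\<close> R by simp
    fix x' assume "dist x' x < e / (\<bar>R\<bar> + 1)"
    then have "(\<bar>R\<bar> + 1) * norm (x' - x) \<le> e" using R by (simp add: field_simps dist_norm)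
    moreover have "R * norm (x' - x) \<le> (\<bar>R\<bar> + 1) * norm (x' - x)" by (intro mult_right_mono) auto
    ultimately show "dist (u x') (u x) \<le> e" using assms[of x' x] by (simp add: dist_real_def)
  qed
qed

text \<open>Two errors are controlled: exchanging the Hessian of the kernel for its second
  difference, and rounding the argument of \<open>u\<close> by \<open>\<tau>\<close>. The rounding
  moves \<open>u\<close> by at most \<open>R * C * h\<close> and is harmless because the second
  difference of the kernel divided by \<open>h\<^sup>2\<close> stays bounded. The threshold
  \<open>h0\<close> depends on neither \<open>u\<close> nor \<open>\<tau>\<close>: the potential
  will be constructed for a mesh size that is already fixed.\<close>

lemma hess_convol_discretise:
  fixes \<rho> :: "real^'n \<Rightarrow> real"
  assumes \<rho>: "smooth_kernel \<epsilon> \<rho>" and R: "0 \<le> R" and C: "0 \<le> C" and \<eta>: "0 < \<eta>"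
  obtains h0 where "0 < h0"
    "\<And>h u x \<tau>. 0 < h \<Longrightarrow> h < h0 \<Longrightarrow> (\<And>x y. \<bar>u x - u y\<bar> \<le> R * norm (x - y)) \<Longrightarrow> u 0 = 0 \<Longrightarrow>
      \<tau> \<in> borel_measurable borel \<Longrightarrow> (\<And>y. norm (\<tau> y - y) \<le> C * h) \<Longrightarrow> norm x \<le> B \<Longrightarrow>
      \<bar>convol u (hess_form \<rho> v) x - convol (\<lambda>y. u (\<tau> y)) (second_diff \<rho> (h *\<^sub>R v)) x / h\<^sup>2\<bar> \<le> \<eta>"
proof -
  have c\<rho>: "continuous_on UNIV \<rho>" and \<rho>0: "\<And>x. \<epsilon> < norm x \<Longrightarrow> \<rho> x = 0"
    using \<rho> by (auto simp: smooth_kernel_def smooth_continuous)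
  note hf = smooth_kernel_hess_form[OF \<rho>]
  obtain M where M: "0 \<le> M" "\<And>x. \<bar>hess_form \<rho> v x\<bar> \<le> M"
    using kernel_bounded[OF hf] by blast
  define r where "r = \<bar>\<epsilon>\<bar> + 1"
  define V where "V = measure lborel (cball (0::real^'n) r)"
  have Vx: "measure lborel (cball x r) = V" for x :: "real^'n"
    by (simp add: V_def content_cball r_def)
  have V0: "0 \<le> V" by (simp add: V_def)
  define U where "U = R * (\<bar>B\<bar> + r)"
  have U0: "0 \<le> U" using R by (simp add: U_def r_def)
  define K where "K = U * V + 1"
  have K: "0 < K" using U0 V0 by (simp add: K_def add_nonneg_pos)
  \<comment> \<open>Half of \<open>\<eta>\<close> pays for the second difference; the other half,
    through \<open>h0\<close>, pays for the rounding.\<close>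
  define e where "e = \<eta> / (2 * K)"
  have e: "0 < e" using \<eta> K by (simp add: e_def)
  obtain d where d: "0 < d"
    "\<And>t x. 0 < t \<Longrightarrow> t < d \<Longrightarrow> \<bar>second_diff \<rho> (t *\<^sub>R v) x / t\<^sup>2 - hess_form \<rho> v x\<bar> \<le> e"
    using second_diff_approx[OF \<rho> e] by blast
  define K' where "K' = R * C * (M + e) * V + 1"
  have K': "0 < K'" using R C M e V0 by (simp add: K'_def add_nonneg_pos)
  define h0 where "h0 = min d (min (1 / (norm v + 1)) (\<eta> / (2 * K')))"
  have n: "0 < norm v + 1" by (simp add: add_nonneg_pos)
  show thesis
  proof (rule that[of h0])
    show "0 < h0" using d n K' \<eta> by (simp add: h0_def)
    fix h :: real and u :: "real^'n \<Rightarrow> real" and x :: "real^'n" and \<tau> :: "real^'n \<Rightarrow> real^'n"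
    assume h: "0 < h" "h < h0" and u: "\<And>x y. \<bar>u x - u y\<bar> \<le> R * norm (x - y)" and u0: "u 0 = 0"
      and \<tau>: "\<tau> \<in> borel_measurable borel" "\<And>y. norm (\<tau> y - y) \<le> C * h" and x: "norm x \<le> B"
    have cu: "continuous_on UNIV u" by (rule lipschitz_continuous[OF u])
    have lu: "locally_bounded u" by (rule locally_bounded_continuous[OF cu])
    have [measurable]: "u \<in> borel_measurable borel" "\<tau> \<in> borel_measurable borel"
      using cu \<tau> by (auto intro: borel_measurable_continuous_onI)
    have l\<tau>: "locally_bounded (\<lambda>y. u (\<tau> y))"
      unfolding locally_bounded_def
    proof (intro conjI allI)
      fix s
      have "\<bar>u (\<tau> y)\<bar> \<le> R * (s + C * h)" if "y \<in> cball 0 s" for y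
      proof -
        have "\<bar>u (\<tau> y)\<bar> \<le> R * norm (\<tau> y)" using u[of "\<tau> y" 0] u0 by simp
        also have "norm (\<tau> y) \<le> s + C * h"
          using norm_triangle_ineq[of y "\<tau> y - y"] \<tau>(2)[of y] that by simp
        finally show ?thesis using R by (simp add: mult_left_mono)
      qed
      then show "\<exists>B. \<forall>y\<in>cball 0 s. \<bar>u (\<tau> y)\<bar> \<le> B" by blast
    qed measurable
    have hv: "norm (h *\<^sub>R v) \<le> 1"
    proof -
      have "h * norm v \<le> 1 / (norm v + 1) * norm v"
        using h by (intro mult_right_mono) (auto simp: h0_def)
      also have "\<dots> \<le> 1" using n by (simp add: field_simps)
      finally show ?thesis using h by simp
    qed
    define G where "G z = second_diff \<rho> (h *\<^sub>R v) z / h\<^sup>2" for z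
    have sk: "continuous_on UNIV (second_diff \<rho> (h *\<^sub>R v))"
      "\<epsilon> + 1 < norm z \<Longrightarrow> second_diff \<rho> (h *\<^sub>R v) z = 0" for z
      using second_diff_kernel[OF c\<rho> _ hv, of \<epsilon>] \<rho>0 by blast+
    have cG: "continuous_on UNIV G" unfolding G_def[abs_def]
      using h by (intro continuous_intros sk) auto
    have G0: "G z = 0" if "r < norm z" for z
      using sk(2)[of z] that by (auto simp: G_def r_def)
    have GH: "\<bar>hess_form \<rho> v z - G z\<bar> \<le> e" for z
      using d(2)[of h z] h by (simp add: G_def h0_def abs_minus_commute)
    have Gb: "\<bar>G z\<bar> \<le> M + e" for z using GH[of z] M(2)[of z] by linarith
    have hf0: "hess_form \<rho> v z = 0" if "r < norm z" for z
      using hf(2)[of z] that by (auto simp: r_def)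
    have i1: "integrable lborel (\<lambda>y. u y * hess_form \<rho> v (x - y))"
      by (rule integrable_convol[OF lu hf(1) hf0])
    have i2: "integrable lborel (\<lambda>y. u y * G (x - y))"
      by (rule integrable_convol[OF lu cG G0])
    have i3: "integrable lborel (\<lambda>y. u (\<tau> y) * G (x - y))"
      by (rule integrable_convol[OF l\<tau> cG G0])
    have "convol u (hess_form \<rho> v) x - convol (\<lambda>y. u (\<tau> y)) (second_diff \<rho> (h *\<^sub>R v)) x / h\<^sup>2
       = convol u (hess_form \<rho> v) x - convol (\<lambda>y. u (\<tau> y)) G x"
      by (simp add: convol_def G_def)
    also have "\<dots> = convol u (\<lambda>z. hess_form \<rho> v z - G z) x + convol (\<lambda>y. u y - u (\<tau> y)) G x"
      unfolding convol_def using i1 i2 i3 by (simp add: right_diff_distrib left_diff_distrib)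
    also have "\<bar>\<dots>\<bar> \<le> U * e * V + (R * C * h) * (M + e) * V"
    proof (rule order_trans[OF abs_triangle_ineq add_mono])
      show "\<bar>convol u (\<lambda>z. hess_form \<rho> v z - G z) x\<bar> \<le> U * e * V"
        unfolding Vx[of x, symmetric]
      proof (rule abs_convol_le)
        fix y assume "y \<in> cball x r"
        then have "norm y \<le> \<bar>B\<bar> + r"
          using x norm_triangle_ineq2[of y x] by (simp add: dist_norm norm_minus_commute)
        then have "R * norm y \<le> U" using R unfolding U_def by (intro mult_left_mono)
        then show "\<bar>u y\<bar> \<le> U" using u[of y 0] u0 by simp
      qed (use GH G0 hf0 e U0 in auto)
      show "\<bar>convol (\<lambda>y. u y - u (\<tau> y)) G x\<bar> \<le> (R * C * h) * (M + e) * V"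
        unfolding Vx[of x, symmetric]
      proof (rule abs_convol_le)
        fix y
        have "\<bar>u y - u (\<tau> y)\<bar> \<le> R * norm (y - \<tau> y)" by (rule u)
        also have "\<dots> \<le> R * (C * h)"
          using \<tau>(2)[of y] R by (intro mult_left_mono) (auto simp: norm_minus_commute)
        finally show "\<bar>u y - u (\<tau> y)\<bar> \<le> R * C * h" by (simp add: mult_ac)
      qed (use Gb G0 M e R C h in auto)
    qed
    also have "U * e * V = (U * V) * e" by simp
    also have "(U * V) * e \<le> K * e" using e by (intro mult_right_mono) (auto simp: K_def)
    also have "K * e = \<eta> / 2" using K by (simp add: e_def)
    also have "(R * C * h) * (M + e) * V = (R * C * (M + e) * V) * h" by simp
    also have "(R * C * (M + e) * V) * h \<le> K' * h" using h by (intro mult_right_mono) (auto simp: K'_def)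
    also have "K' * h \<le> \<eta> / 2"
    proof -
      have "h \<le> \<eta> / (2 * K')" using h by (simp add: h0_def)
      then have "K' * h \<le> K' * (\<eta> / (2 * K'))" using K' by (intro mult_left_mono) auto
      then show ?thesis using K' by simp
    qed
    finally show "\<bar>convol u (hess_form \<rho> v) x - convol (\<lambda>y. u (\<tau> y)) (second_diff \<rho> (h *\<^sub>R v)) x / h\<^sup>2\<bar> \<le> \<eta>"
      by simp
  qed
qed

text \<open>Rounds \<open>y\<close> to the lattice generated by \<open>h\<close> times the columns
  of \<open>L\<close>; \<open>L'\<close> stands for the inverse of \<open>L\<close>.\<close>

definition lattice_floor :: "real^'n^'n \<Rightarrow> real^'n^'n \<Rightarrow> real \<Rightarrow> real^'n \<Rightarrow> real^'n" where
  "lattice_floor L L' h y = h *\<^sub>R (L *v (\<chi> i. of_int \<lfloor>(L' *v y) $ i / h\<rfloor>))"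

lemma lattice_floor_measurable [measurable]: "lattice_floor L L' h \<in> borel_measurable borel"
proof -
  have "(\<lambda>y. \<chi> i. of_int \<lfloor>(L' *v y) $ i / h\<rfloor> :: real^'n) \<in> borel_measurable borel" for L' :: "real^'n^'n"
  proof (rule borel_measurable_euclidean_space[THEN iffD2], intro ballI)
    fix b :: "real^'n" assume "b \<in> Basis"
    then obtain i where b: "b = axis i 1" by (auto simp: Basis_vec_def)
    have "(\<lambda>y. (L' *v y) $ i) \<in> borel_measurable borel"
      by (intro borel_measurable_continuous_onI continuous_intros)
    then show "(\<lambda>y. (\<chi> i. of_int \<lfloor>(L' *v y) $ i / h\<rfloor> :: real^'n) \<bullet> b) \<in> borel_measurable borel"
      unfolding b by (simp add: inner_axis)
  qed
  then show ?thesis unfolding lattice_floor_def[abs_def] by measurable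
qed

lemma lattice_floor_dist:
  fixes L :: "real^'n^'n"
  obtains C where "0 \<le> C" "\<And>L' h y. 0 < h \<Longrightarrow> L ** L' = mat 1 \<Longrightarrow> norm (lattice_floor L L' h y - y) \<le> C * h"
proof -
  obtain K where K: "0 < K" "\<And>w. norm (L *v w) \<le> norm w * K"
    using bounded_linear.pos_bounded[OF matrix_vector_mul_bounded_linear[of L]] by blast
  show thesis
  proof (rule that[of "K * CARD('n)"])
    fix L' :: "real^'n^'n" and h :: real and y :: "real^'n" assume h: "0 < h" and inv: "L ** L' = mat 1"
    define w :: "real^'n" where "w = (\<chi> i. of_int \<lfloor>(L' *v y) $ i / h\<rfloor> - (L' *v y) $ i / h)"
    have "h *\<^sub>R w = h *\<^sub>R (\<chi> i. of_int \<lfloor>(L' *v y) $ i / h\<rfloor>) - L' *v y"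
      using h by (simp add: w_def vec_eq_iff right_diff_distrib)
    then have "L *v (h *\<^sub>R w) = lattice_floor L L' h y - y"
      using inv by (simp add: matrix_vector_mult_diff_distrib lattice_floor_def matrix_vector_mult_scaleR
        matrix_vector_mul_assoc)
    then have "norm (lattice_floor L L' h y - y) \<le> norm (h *\<^sub>R w) * K" using K(2) by metis
    also have "norm (h *\<^sub>R w) \<le> h * CARD('n)"
    proof -
      have "norm w \<le> (\<Sum>i\<in>UNIV. \<bar>w $ i\<bar>)" by (rule norm_le_l1_cart)
      also have "\<dots> \<le> (\<Sum>i\<in>(UNIV::'n set). 1)"
      proof (rule sum_mono)
        fix i
        show "\<bar>w $ i\<bar> \<le> 1"
          using floor_correct[of "(L' *v y) $ i / h"] by (simp add: w_def abs_le_iff) linarith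
      qed
      finally show ?thesis using h by simp
    qed
    finally show "norm (lattice_floor L L' h y - y) \<le> K * CARD('n) * h"
      using K by (simp add: mult_ac)
  qed (use K in simp)
qed

text \<open>\<open>L'\<close> sends column \<open>k\<close> of \<open>L\<close> to a unit vector, so
  the shift adds exactly 1 under one floor. Rounding therefore commutes with these lattice
  translations, and second differences along the columns survive it.\<close>

lemma lattice_floor_shift:
  fixes L :: "real^'n^'n"
  assumes h: "0 < h" and inv: "L' ** L = mat 1"
  shows "lattice_floor L L' h (y + h *\<^sub>R column k L) = lattice_floor L L' h y + h *\<^sub>R column k L"
    "lattice_floor L L' h (y - h *\<^sub>R column k L) = lattice_floor L L' h y - h *\<^sub>R column k L"
proof -
  have L'c: "L' *v column k L = axis k 1"
    using inv by (metis matrix_vector_mul_assoc matrix_vector_mul_lid matrix_vector_mult_basis)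
  have shift: "lattice_floor L L' h (y + h *\<^sub>R column k L) = lattice_floor L L' h y + h *\<^sub>R column k L" for y
  proof -
    have "(\<chi> i. of_int \<lfloor>(L' *v (y + h *\<^sub>R column k L)) $ i / h\<rfloor>)
       = (\<chi> i. of_int \<lfloor>(L' *v y) $ i / h\<rfloor>) + (axis k 1 :: real^'n)"
      using h by (auto simp: vec_eq_iff matrix_vector_right_distrib matrix_vector_mult_scaleR L'c
          add_divide_distrib axis_def)
    then show ?thesis
      by (simp add: lattice_floor_def matrix_vector_right_distrib matrix_vector_mult_basis scaleR_add_right)
  qed
  then show "lattice_floor L L' h (y + h *\<^sub>R column k L) = lattice_floor L L' h y + h *\<^sub>R column k L" .
  show "lattice_floor L L' h (y - h *\<^sub>R column k L) = lattice_floor L L' h y - h *\<^sub>R column k L"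
    using shift[of "y - h *\<^sub>R column k L"] by simp
qed

text \<open>Replacing \<open>u\<close> by its values at the lattice points turns second differences into those of
  \<open>u\<close> at lattice points, so a lower bound there passes to the mollified Hessian.\<close>

lemma lattice_mollification:
  fixes \<rho> :: "real^'n \<Rightarrow> real" and L L' :: "real^'n^'n"
  assumes \<rho>: "smooth_kernel \<epsilon> \<rho>" "\<And>x. 0 \<le> \<rho> x" "(LINT x|lborel. \<rho> x) = 1"
    and inv: "L ** L' = mat 1" "L' ** L = mat 1" and R: "0 \<le> R" and \<eta>: "0 < \<eta>"
  obtains h0 where "0 < h0"
    "\<And>h u x c. 0 < h \<Longrightarrow> h < h0 \<Longrightarrow> (\<And>x y. \<bar>u x - u y\<bar> \<le> R * norm (x - y)) \<Longrightarrow> u 0 = 0 \<Longrightarrow> norm x \<le> B \<Longrightarrow>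
      (\<And>y. y \<in> cball x \<epsilon> \<Longrightarrow>
         c \<le> (\<Sum>k\<in>UNIV. second_diff u (h *\<^sub>R column k L) (lattice_floor L L' h y)) / h\<^sup>2) \<Longrightarrow>
      c - \<eta> \<le> (\<Sum>k\<in>UNIV. hess_form (convol u \<rho>) (column k L) x)"
proof -
  obtain C where C: "0 \<le> C" "\<And>h y. 0 < h \<Longrightarrow> norm (lattice_floor L L' h y - y) \<le> C * h"
    using lattice_floor_dist[of L] inv by metis
  define \<eta>' where "\<eta>' = \<eta> / CARD('n)"
  have \<eta>': "0 < \<eta>'" using \<eta> by (simp add: \<eta>'_def)
  have "\<exists>h0>0. \<forall>h u x. 0 < h \<longrightarrow> h < h0 \<longrightarrow> (\<forall>x y. \<bar>u x - u y\<bar> \<le> R * norm (x - y)) \<longrightarrow> u 0 = 0 \<longrightarrow> norm x \<le> B \<longrightarrow>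
      \<bar>convol u (hess_form \<rho> (column k L)) x
       - convol (\<lambda>y. u (lattice_floor L L' h y)) (second_diff \<rho> (h *\<^sub>R column k L)) x / h\<^sup>2\<bar> \<le> \<eta>'" for k
  proof -
    obtain h0 where h0: "0 < h0"
      "\<And>h u x \<tau>. 0 < h \<Longrightarrow> h < h0 \<Longrightarrow> (\<And>x y. \<bar>u x - u y\<bar> \<le> R * norm (x - y)) \<Longrightarrow> u 0 = 0 \<Longrightarrow>
        \<tau> \<in> borel_measurable borel \<Longrightarrow> (\<And>y. norm (\<tau> y - y) \<le> C * h) \<Longrightarrow> norm x \<le> B \<Longrightarrow>
        \<bar>convol u (hess_form \<rho> (column k L)) x - convol (\<lambda>y. u (\<tau> y)) (second_diff \<rho> (h *\<^sub>R column k L)) x / h\<^sup>2\<bar> \<le> \<eta>'"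
      using hess_convol_discretise[OF \<rho>(1) R C(1) \<eta>', of B "column k L"] by blast
    show ?thesis
      by (intro exI[of _ h0] conjI allI impI h0) (auto simp: C)
  qed
  then obtain H where H: "\<And>k. 0 < H k" "\<And>k h u x. 0 < h \<Longrightarrow> h < H k \<Longrightarrow>
      (\<And>x y. \<bar>u x - u y\<bar> \<le> R * norm (x - y)) \<Longrightarrow> u 0 = 0 \<Longrightarrow> norm x \<le> B \<Longrightarrow>
      \<bar>convol u (hess_form \<rho> (column k L)) x
       - convol (\<lambda>y. u (lattice_floor L L' h y)) (second_diff \<rho> (h *\<^sub>R column k L)) x / h\<^sup>2\<bar> \<le> \<eta>'"
    by metis
  show thesis
  proof (rule that[of "Min (range H)"])
    show "0 < Min (range H)" using H(1) by simp
    fix h c :: real and u :: "real^'n \<Rightarrow> real" and x :: "real^'n"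
    assume h: "0 < h" "h < Min (range H)" and u: "\<And>x y. \<bar>u x - u y\<bar> \<le> R * norm (x - y)" "u 0 = 0"
      and x: "norm x \<le> B"
      and c: "\<And>y. y \<in> cball x \<epsilon> \<Longrightarrow>
         c \<le> (\<Sum>k\<in>UNIV. second_diff u (h *\<^sub>R column k L) (lattice_floor L L' h y)) / h\<^sup>2"
    define w where "w y = u (lattice_floor L L' h y)" for y
    have cu: "continuous_on UNIV u" by (rule lipschitz_continuous[OF u(1)])
    have [measurable]: "u \<in> borel_measurable borel" using cu by (rule borel_measurable_continuous_onI)
    \<comment> \<open>\<open>w\<close> is a step function, so the bound cannot come from continuity
      as it does for \<open>u\<close>; it comes from \<open>u 0 = 0\<close> and the rounding
      distance.\<close>
    have lw: "locally_bounded w"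
      unfolding locally_bounded_def
    proof (intro conjI allI)
      show "w \<in> borel_measurable borel" unfolding w_def[abs_def] by measurable
      fix s
      have "\<bar>w y\<bar> \<le> R * (s + C * h)" if "y \<in> cball 0 s" for y
      proof -
        have "\<bar>w y\<bar> \<le> R * norm (lattice_floor L L' h y)"
          using u(1)[of "lattice_floor L L' h y" 0] u by (simp add: w_def)
        also have "norm (lattice_floor L L' h y) \<le> s + C * h"
          using norm_triangle_ineq[of y "lattice_floor L L' h y - y"] C(2)[OF h(1), of y] that by simp
        finally show ?thesis using R by (simp add: mult_left_mono)
      qed
      then show "\<exists>B. \<forall>y\<in>cball 0 s. \<bar>w y\<bar> \<le> B" by blast
    qed
    have c\<rho>: "continuous_on UNIV \<rho>" and \<rho>0: "\<epsilon> < norm x \<Longrightarrow> \<rho> x = 0" for x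
      using \<rho> by (auto simp: smooth_kernel_def smooth_continuous)
    have lu: "locally_bounded u" by (rule locally_bounded_continuous[OF cu])
    have sd: "second_diff w (h *\<^sub>R column k L) y = second_diff u (h *\<^sub>R column k L) (lattice_floor L L' h y)" for k y
      by (simp add: second_diff_def w_def lattice_floor_shift[OF h(1) inv(2)])
    have i1: "integrable lborel (\<lambda>y. w y * \<rho> (x - y))"
      by (rule integrable_convol_kernel[OF lw \<rho>(1)])
    have i2: "integrable lborel (\<lambda>y. w (y + v) * \<rho> (x - y))" for v
      by (rule integrable_convol_kernel[OF locally_bounded_translate[OF lw] \<rho>(1)])
    have i3: "integrable lborel (\<lambda>y. second_diff w v y * \<rho> (x - y))" for v
    proof -
      have "integrable lborel (\<lambda>y. w (y + v) * \<rho> (x - y) + w (y + (-v)) * \<rho> (x - y) - 2 * (w y * \<rho> (x - y)))"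
        using i1 i2[of v] i2[of "-v"]
        by (intro Bochner_Integration.integrable_diff Bochner_Integration.integrable_add integrable_mult_right)
      then show ?thesis by (simp add: second_diff_def algebra_simps)
    qed
    have i\<rho>: "integrable lborel (\<lambda>y. \<rho> (x - y))"
    proof -
      have "integrable lborel (\<lambda>y. (\<lambda>_. 1) y * \<rho> (x - y))"
        by (rule integrable_convol_kernel[OF locally_bounded_continuous \<rho>(1)]) simp
      then show ?thesis by simp
    qed
    have [measurable]: "\<rho> \<in> borel_measurable borel" using c\<rho> by (rule borel_measurable_continuous_onI)
    \<comment> \<open>The kernel has mass 1, so the lower bound that holds on its support around
      \<open>x\<close> averages to \<open>c\<close>.\<close>
    have "c = (LINT y|lborel. c * \<rho> (x - y))"
      using lborel_integral_reflect[of \<rho> x] \<rho>(3) by simp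
    also have "\<dots> \<le> (LINT y|lborel. (\<Sum>k\<in>UNIV. second_diff w (h *\<^sub>R column k L) y * \<rho> (x - y)) / h\<^sup>2)"
    proof (rule integral_mono)
      show "integrable lborel (\<lambda>y. c * \<rho> (x - y))" using i\<rho> by simp
      show "integrable lborel (\<lambda>y. (\<Sum>k\<in>UNIV. second_diff w (h *\<^sub>R column k L) y * \<rho> (x - y)) / h\<^sup>2)"
        using i3 by (intro integrable_divide Bochner_Integration.integrable_sum)
      fix y
      show "c * \<rho> (x - y) \<le> (\<Sum>k\<in>UNIV. second_diff w (h *\<^sub>R column k L) y * \<rho> (x - y)) / h\<^sup>2"
      proof (cases "y \<in> cball x \<epsilon>")
        case True
        have "c * \<rho> (x - y) \<le> ((\<Sum>k\<in>UNIV. second_diff w (h *\<^sub>R column k L) y) / h\<^sup>2) * \<rho> (x - y)"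
          using c[OF True] \<rho>(2) by (intro mult_right_mono) (simp_all add: sd)
        then show ?thesis by (simp add: sum_distrib_right)
      next
        case False
        then show ?thesis using \<rho>0[of "x - y"] by (simp add: dist_norm)
      qed
    qed
    also have "\<dots> = (\<Sum>k\<in>UNIV. convol w (second_diff \<rho> (h *\<^sub>R column k L)) x / h\<^sup>2)"
    proof -
      have "convol w (second_diff \<rho> (h *\<^sub>R column k L)) x = convol (second_diff w (h *\<^sub>R column k L)) \<rho> x" for k
        by (rule convol_second_diff[OF lw c\<rho>]) (rule \<rho>0)
      then show ?thesis
        using i3 by (simp add: convol_def sum_divide_distrib)
    qed
    also have "\<dots> \<le> (\<Sum>k\<in>UNIV. convol u (hess_form \<rho> (column k L)) x + \<eta>')"
    proof (rule sum_mono)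
      fix k
      have "h < H k" using h by simp
      from H(2)[OF h(1) this u x]
      show "convol w (second_diff \<rho> (h *\<^sub>R column k L)) x / h\<^sup>2 \<le> convol u (hess_form \<rho> (column k L)) x + \<eta>'"
        unfolding w_def by linarith
    qed
    also have "\<dots> = (\<Sum>k\<in>UNIV. hess_form (convol u \<rho>) (column k L) x) + \<eta>"
      by (simp add: sum.distrib \<eta>'_def hess_form_convol[OF lu \<rho>(1)])
    finally show "c - \<eta> \<le> (\<Sum>k\<in>UNIV. hess_form (convol u \<rho>) (column k L) x)" by simp
  qed
qed

section \<open>Volumes of lattice cells and of subgradient sets\<close>

lemma measure_halfopen_box:
  fixes z :: "real^'n"
  assumes h: "0 < h"
  defines "P \<equiv> {w :: real^'n. \<forall>i. h * z $ i \<le> w $ i \<and> w $ i < h * (z $ i + 1)}"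
  shows "P \<in> sets borel" "emeasure lborel P = ennreal (h ^ CARD('n))"
proof -
  show P: "P \<in> sets borel"
  proof -
    have m: "(\<lambda>w::real^'n. w $ i) \<in> borel_measurable borel" for i
      by (intro borel_measurable_continuous_onI continuous_intros)
    have "P = (\<Inter>i. {w. h * z $ i \<le> w $ i \<and> w $ i < h * (z $ i + 1)})" by (auto simp: P_def)
    moreover have "{w :: real^'n. h * z $ i \<le> w $ i \<and> w $ i < h * (z $ i + 1)} \<in> sets borel" for i
      using m[of i] by measurable
    ultimately show ?thesis by (metis (no_types, lifting) UNIV_not_empty countable_finite finite sets.countable_INT'' sets.countable_INT' image_subset_iff)
  qed
  define a b where "a = h *\<^sub>R z" and "b = h *\<^sub>R (z + 1)"
  have ab: "a $ i \<le> b $ i" "b $ i - a $ i = h" for i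
    using h by (auto simp: a_def b_def algebra_simps)
  have le: "a \<bullet> i \<le> b \<bullet> i" if "i \<in> Basis" for i
    using that ab by (auto simp: Basis_vec_def inner_axis)
  have pr: "(\<Prod>i\<in>Basis. (b - a) \<bullet> i) = h ^ CARD('n)"
    by (simp add: prod_Basis_vec inner_axis ab)
  \<comment> \<open>The half-open box lies between an open and a closed box of equal volume.\<close>
  have "emeasure lborel (box a b) \<le> emeasure lborel P"
    by (intro emeasure_mono) (auto simp: P_def a_def b_def mem_box_cart less_imp_le P)
  moreover have "emeasure lborel P \<le> emeasure lborel (cbox a b)"
    by (intro emeasure_mono) (auto simp: P_def a_def b_def mem_box_cart less_imp_le)
  ultimately show "emeasure lborel P = ennreal (h ^ CARD('n))"
    using le by (simp add: emeasure_lborel_box_eq emeasure_lborel_cbox_eq pr)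
qed

lemma det_inverse_matrix:
  fixes L :: "real^'n^'n"
  assumes "L ** L' = mat 1" shows "det L * det L' = 1"
  by (metis assms det_I det_mul)

text \<open>The cell is the preimage under \<open>L'\<close> of a half-open cube of side
  \<open>h\<close>, and \<open>\<bar>det L'\<bar>\<close> is the reciprocal of
  \<open>\<bar>det L\<bar>\<close>.\<close>

lemma measure_lattice_cell:
  fixes L :: "real^'n^'n" and x :: "real^'n"
  assumes h: "0 < h" and inv: "L ** L' = mat 1" "L' ** L = mat 1"
  defines "P \<equiv> {y. lattice_floor L L' h y = lattice_floor L L' h x}"
  shows "P \<in> sets borel" "emeasure lborel P = ennreal (h ^ CARD('n) * \<bar>det L\<bar>)"
proof -
  have "lattice_floor L L' h -` {lattice_floor L L' h x} \<inter> space borel \<in> sets borel"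
    by (rule measurable_sets[OF lattice_floor_measurable]) simp
  then show "P \<in> sets borel" by (simp add: P_def vimage_def)
  define z :: "real^'n" where "z = (\<chi> i. of_int \<lfloor>(L' *v x) $ i / h\<rfloor>)"
  define Q where "Q = {w :: real^'n. \<forall>i. h * z $ i \<le> w $ i \<and> w $ i < h * (z $ i + 1)}"
  have Q: "Q \<in> sets borel" "emeasure lborel Q = ennreal (h ^ CARD('n))"
    using measure_halfopen_box[OF h, of z] by (simp_all add: Q_def)
  have "y \<in> P \<longleftrightarrow> L' *v y \<in> Q" for y
  proof -
    have "y \<in> P \<longleftrightarrow> (\<chi> i. of_int \<lfloor>(L' *v y) $ i / h\<rfloor>) = z"
    proof
      assume "y \<in> P"
      then have "L *v (\<chi> i. of_int \<lfloor>(L' *v y) $ i / h\<rfloor>) = L *v z"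
        using h by (simp add: P_def lattice_floor_def z_def)
      then have "L' *v (L *v (\<chi> i. of_int \<lfloor>(L' *v y) $ i / h\<rfloor>)) = L' *v (L *v z)" by simp
      then show "(\<chi> i. of_int \<lfloor>(L' *v y) $ i / h\<rfloor>) = z"
        by (simp add: matrix_vector_mul_assoc inv)
    qed (simp add: P_def lattice_floor_def z_def)
    also have "\<dots> \<longleftrightarrow> (\<forall>i. \<lfloor>(L' *v y) $ i / h\<rfloor> = \<lfloor>(L' *v x) $ i / h\<rfloor>)"
      by (simp add: vec_eq_iff z_def)
    also have "\<dots> \<longleftrightarrow> L' *v y \<in> Q"
      using h by (auto simp: Q_def z_def floor_eq_iff field_simps)
    finally show ?thesis .
  qed
  then have PQ: "indicator P y = (indicator Q (L' *v y) :: ennreal)" for y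
    by (simp add: indicator_def)
  have "emeasure lborel P = (\<integral>\<^sup>+y. indicator P y \<partial>lborel)"
    by (rule nn_integral_indicator[symmetric]) (simp add: \<open>P \<in> sets borel\<close>)
  also have "\<dots> = (\<integral>\<^sup>+y. indicator Q (L' *v y) \<partial>lborel)" by (simp only: PQ)
  also have "\<dots> = ennreal (1 / \<bar>det L'\<bar>) * ennreal (h ^ CARD('n))"
    using det_inverse_matrix[OF inv(1)] Q by (subst nn_integral_linear_vec) auto
  also have "1 / \<bar>det L'\<bar> = \<bar>det L\<bar>"
  proof -
    have d: "\<bar>det L\<bar> * \<bar>det L'\<bar> = 1" using det_inverse_matrix[OF inv(1)] by (metis abs_mult abs_one)
    then have "\<bar>det L'\<bar> \<noteq> 0" by auto
    with d show ?thesis by (simp add: divide_eq_eq)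
  qed
  finally show "emeasure lborel P = ennreal (h ^ CARD('n) * \<bar>det L\<bar>)"
    using h by (simp add: ennreal_mult[symmetric] mult.commute)
qed

text \<open>The slabs say that \<open>transpose L\<close> maps \<open>W\<close> into a box with side
  lengths \<open>\<delta> k\<close>.\<close>

lemma measure_slab_le:
  fixes L :: "real^'n^'n"
  assumes det: "det L \<noteq> 0" and W: "W \<in> sets borel" and \<delta>: "\<And>k. 0 \<le> \<delta> k"
    and slab: "\<And>p k. p \<in> W \<Longrightarrow> a k \<le> p \<bullet> column k L \<and> p \<bullet> column k L \<le> a k + \<delta> k"
  shows "measure lborel W \<le> (\<Prod>k\<in>UNIV. \<delta> k) / \<bar>det L\<bar>"
proof -
  let ?a = "(\<chi> k. a k) :: real^'n" and ?b = "(\<chi> k. a k + \<delta> k) :: real^'n"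
  have T: "(transpose L *v p) $ k = p \<bullet> column k L" for p k
    by (simp add: matrix_vector_mult_def transpose_def column_def inner_vec_def mult.commute)
  have "emeasure lborel W = (\<integral>\<^sup>+p. indicator W p \<partial>lborel)"
    by (rule nn_integral_indicator[symmetric]) (simp add: W)
  also have "\<dots> \<le> (\<integral>\<^sup>+p. indicator (cbox ?a ?b) (transpose L *v p) \<partial>lborel)"
    using slab by (intro nn_integral_mono) (auto simp: indicator_def mem_box_cart T[simplified])
  also have "\<dots> = ennreal (1 / \<bar>det L\<bar>) * emeasure lborel (cbox ?a ?b)"
    using det by (subst nn_integral_linear_vec) (auto simp: det_transpose)
  also have "emeasure lborel (cbox ?a ?b) = ennreal (\<Prod>k\<in>UNIV. \<delta> k)"
  proof -
    have "?a \<bullet> i \<le> ?b \<bullet> i" if "i \<in> Basis" for i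
      using that \<delta> by (auto simp: Basis_vec_def inner_axis)
    then show ?thesis by (simp add: emeasure_lborel_cbox_eq prod_Basis_vec inner_axis)
  qed
  also have "ennreal (1 / \<bar>det L\<bar>) * ennreal (\<Prod>k\<in>UNIV. \<delta> k) = ennreal ((\<Prod>k\<in>UNIV. \<delta> k) / \<bar>det L\<bar>)"
    using \<delta> by (simp add: ennreal_mult[symmetric] prod_nonneg)
  finally show ?thesis
    using \<delta> unfolding measure_def by (simp add: enn2real_leI prod_nonneg)
qed

text \<open>The subgradient inequality at the two neighbours of \<open>x\<close> along a column
  confines \<open>p \<bullet> column k L\<close> to an interval whose length is the second
  difference over \<open>h\<close>. One factor \<open>\<bar>det L\<bar>\<close> comes from the
  volume of the lattice cell and one from the slabs; together they form the determinant of
  \<open>L ** transpose L\<close>. The powers of \<open>h\<close> combine to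
  \<open>h\<^sup>2\<close> per direction, as in a discrete Hessian.\<close>

lemma subgradient_mass_am_gm:
  fixes L :: "real^'n^'n" and u :: "real^'n \<Rightarrow> real"
  assumes det: "det L \<noteq> 0" and h: "0 < h" and c: "0 < c"
    and W: "W \<in> sets borel" "c * (h ^ CARD('n) * \<bar>det L\<bar>) \<le> measure lborel W"
    and sub: "\<And>p y. p \<in> W \<Longrightarrow> u x + p \<bullet> (y - x) \<le> u y"
  shows "real CARD('n) * (c * (det L)\<^sup>2) powr (1 / real CARD('n))
     \<le> (\<Sum>k\<in>UNIV. second_diff u (h *\<^sub>R column k L) x) / h\<^sup>2"
proof -
  let ?N = "CARD('n)"
  have "0 < c * (h ^ ?N * \<bar>det L\<bar>)" using det h c by simp
  \<comment> \<open>A point of \<open>W\<close> is what makes the second differences nonnegative, as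
    AM-GM requires.\<close>
  then have "W \<noteq> {}" using W(2) by auto
  define s where "s k = second_diff u (h *\<^sub>R column k L) x" for k
  have bd: "u x - u (x - h *\<^sub>R column k L) \<le> h * (p \<bullet> column k L)"
    "h * (p \<bullet> column k L) \<le> u (x + h *\<^sub>R column k L) - u x" if "p \<in> W" for p k
    using sub[OF that, of "x - h *\<^sub>R column k L"] sub[OF that, of "x + h *\<^sub>R column k L"] by simp_all
  have s0: "0 \<le> s k" for k
    using bd[of _ k] \<open>W \<noteq> {}\<close> unfolding s_def second_diff_def by fastforce
  have "measure lborel W \<le> (\<Prod>k\<in>UNIV. s k / h) / \<bar>det L\<bar>"
  proof (rule measure_slab_le[OF det W(1), where a = "\<lambda>k. (u x - u (x - h *\<^sub>R column k L)) / h"])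
    fix p k assume "p \<in> W"
    from bd[OF this, of k] show "(u x - u (x - h *\<^sub>R column k L)) / h \<le> p \<bullet> column k L \<and>
         p \<bullet> column k L \<le> (u x - u (x - h *\<^sub>R column k L)) / h + s k / h"
      using h by (simp add: s_def second_diff_def add_divide_distrib[symmetric] pos_divide_le_eq
          pos_le_divide_eq mult.commute)
  qed (use s0 h in simp)
  then have "c * (h ^ ?N * \<bar>det L\<bar>) * \<bar>det L\<bar> \<le> (\<Prod>k\<in>UNIV. s k / h)"
    using order_trans[OF W(2)] det by (simp add: pos_le_divide_eq[symmetric])
  then have "c * (det L)\<^sup>2 * h ^ ?N \<le> (\<Prod>k\<in>UNIV. s k / h)"
    by (simp add: power2_eq_square[of "det L"] abs_mult_self_eq mult_ac)
  then have "c * (det L)\<^sup>2 \<le> (\<Prod>k\<in>UNIV. s k / h) / h ^ ?N" using h by (simp add: pos_le_divide_eq)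
  also have "\<dots> = (\<Prod>k\<in>UNIV. s k / h\<^sup>2)"
    by (simp add: prod_dividef power2_eq_square power_mult_distrib)
  finally have "(c * (det L)\<^sup>2) powr (1 / ?N) \<le> (\<Prod>k\<in>UNIV. s k / h\<^sup>2) powr (1 / ?N)"
    using c by (intro powr_mono2) auto
  also have "\<dots> \<le> (\<Sum>k\<in>UNIV. s k / h\<^sup>2 / ?N)"
    using arith_geom_mean[of "UNIV :: 'n set" "\<lambda>k. s k / h\<^sup>2"] s0 by simp
  also have "\<dots> = (\<Sum>k\<in>UNIV. s k) / h\<^sup>2 / ?N" by (simp add: sum_divide_distrib)
  finally have "(c * (det L)\<^sup>2) powr (1 / ?N) * ?N \<le> (\<Sum>k\<in>UNIV. s k) / h\<^sup>2"
    by (subst (asm) pos_le_divide_eq) auto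
  then show ?thesis by (simp add: s_def mult.commute)
qed

text \<open>The cells are disjoint and have one common volume, so their number is limited by the
  volume of \<open>U\<close>. Counting only cells inside \<open>U\<close> keeps the mass placed on
  the lattice below density times volume of \<open>U\<close>.\<close>

lemma card_lattice_cells:
  fixes L :: "real^'n^'n" and U :: "(real^'n) set"
  assumes h: "0 < h" and inv: "L ** L' = mat 1" "L' ** L = mat 1"
    and U: "open U" "bounded U"
  defines "X \<equiv> {p \<in> range (lattice_floor L L' h). {y. lattice_floor L L' h y = p} \<subseteq> U}"
  shows "finite X" "real (card X) * (h ^ CARD('n) * \<bar>det L\<bar>) \<le> measure lborel U"
proof -
  define V where "V = h ^ CARD('n) * \<bar>det L\<bar>"
  have "det L \<noteq> 0" using det_inverse_matrix[OF inv(1)] by (metis mult_zero_left zero_neq_one)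
  then have V: "0 < V" using h by (simp add: V_def)
  define cell where "cell p = {y. lattice_floor L L' h y = p}" for p
  have fU: "emeasure lborel U < \<infinity>" using emeasure_bounded_finite[OF U(2)] .
  have cell: "cell p \<in> sets borel" "emeasure lborel (cell p) = ennreal V" if "p \<in> X" for p
    using that measure_lattice_cell[OF h inv] by (auto simp: X_def cell_def V_def)
  have bound: "real (card F) * V \<le> measure lborel U" if F: "F \<subseteq> X" "finite F" for F
  proof -
    have "ennreal (real (card F) * V) = (\<Sum>p\<in>F. emeasure lborel (cell p))"
      using F cell V by (simp add: subset_iff ennreal_mult ennreal_of_nat_eq_real_of_nat)
    also have "\<dots> = emeasure lborel (\<Union>p\<in>F. cell p)"
      by (rule sum_emeasure) (use F cell in \<open>auto simp: disjoint_family_on_def cell_def\<close>)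
    also have "\<dots> \<le> emeasure lborel U"
      using F U by (intro emeasure_mono) (auto simp: X_def cell_def)
    also have "\<dots> = ennreal (measure lborel U)" using fU by (simp add: emeasure_eq_ennreal_measure)
    finally show ?thesis using V by (simp add: ennreal_le_iff)
  qed
  define B where "B = nat \<lceil>measure lborel U / V\<rceil>"
  have "card F \<le> B" if "F \<subseteq> X" "finite F" for F
  proof -
    have "real (card F) \<le> measure lborel U / V" using bound[OF that] V by (simp add: pos_le_divide_eq)
    then show ?thesis unfolding B_def by linarith
  qed
  then show "finite X" using finite_if_finite_subsets_card_bdd by blast
  then show "real (card X) * (h ^ CARD('n) * \<bar>det L\<bar>) \<le> measure lborel U"
    using bound[of X] by (simp add: V_def)
qed

section \<open>Construction of the smooth convex potential\<close>

lemma uniform_ball_in_open: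
  fixes K :: "'a::euclidean_space set"
  assumes "compact K" "open U" "K \<subseteq> U"
  shows "\<exists>e>0. \<forall>x\<in>K. cball x e \<subseteq> U"
proof -
  obtain e where "e > 0" "(\<Union>x\<in>K. cball x e) \<subseteq> U"
    using compact_subset_open_imp_cball_epsilon_subset[OF assms] by blast
  then show ?thesis by blast
qed

text \<open>The lattice adapted to \<open>L j\<close> contributes the mass \<open>c j\<close> times
  the cell volume at each point whose cell lies in \<open>U j\<close>, and one transport problem is
  solved for all lattices together. Every point obtained by rounding near \<open>K j\<close> then
  carries enough mass for the AM-GM bound, which mollification turns into a bound for a smooth
  Hessian.\<close>

lemma smooth_convex_potential:
  fixes L :: "'i \<Rightarrow> real^'n^'n"
  assumes J: "finite J" and det: "\<And>j. j \<in> J \<Longrightarrow> det (L j) \<noteq> 0" and c: "\<And>j. j \<in> J \<Longrightarrow> 0 < c j"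
    and K: "\<And>j. j \<in> J \<Longrightarrow> compact (K j)" and U: "\<And>j. j \<in> J \<Longrightarrow> open (U j)" "\<And>j. j \<in> J \<Longrightarrow> bounded (U j)"
    and KU: "\<And>j. j \<in> J \<Longrightarrow> K j \<subseteq> U j" and R: "0 \<le> R" and \<eta>: "0 < \<eta>"
    and mass: "(\<Sum>j\<in>J. c j * measure lborel (U j)) \<le> measure lborel (cball (0::real^'n) R)"
  obtains W :: "real^'n \<Rightarrow> real" where "smooth W" "\<And>x. norm (grad W x) \<le> R" "\<And>v x. 0 \<le> hess_form W v x"
    "\<And>j x. j \<in> J \<Longrightarrow> x \<in> K j \<Longrightarrow>
      real CARD('n) * (c j * (det (L j))\<^sup>2) powr (1 / real CARD('n)) - \<eta>
        \<le> (\<Sum>k\<in>UNIV. hess_form W (column k (L j)) x)"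
proof -
  let ?N = "CARD('n)"
  have "\<exists>e>0. \<forall>x\<in>K j. cball x e \<subseteq> U j" if "j \<in> J" for j
    using uniform_ball_in_open[OF K U(1) KU] that by blast
  then obtain e where e: "\<And>j. j \<in> J \<Longrightarrow> 0 < e j" "\<And>j x. j \<in> J \<Longrightarrow> x \<in> K j \<Longrightarrow> cball x (e j) \<subseteq> U j"
    by metis
  \<comment> \<open>Half of the available distance: one \<open>\<epsilon>\<close> is spent on the
    support of the kernel, the other on the extent of a lattice cell.\<close>
  define \<epsilon> where "\<epsilon> = Min (insert 1 (e ` J)) / 2"
  have \<epsilon>: "0 < \<epsilon>" using e(1) J by (simp add: \<epsilon>_def)
  have \<epsilon>2: "cball x (2 * \<epsilon>) \<subseteq> U j" if "j \<in> J" "x \<in> K j" for j x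
  proof -
    have "2 * \<epsilon> \<le> e j" unfolding \<epsilon>_def using J that by simp
    then have "cball x (2 * \<epsilon>) \<subseteq> cball x (e j)" by (rule subset_cball)
    with e(2)[OF that] show ?thesis by blast
  qed
  obtain \<rho> :: "real^'n \<Rightarrow> real" where \<rho>: "smooth_kernel \<epsilon> \<rho>" "\<And>x. 0 \<le> \<rho> x" "(LINT x|lborel. \<rho> x) = 1"
    using smooth_kernel_exists[OF \<epsilon>] by blast
  have "bounded (\<Union>j\<in>J. K j)" using J K by (intro bounded_UN ballI) (simp_all add: compact_imp_bounded)
  then obtain B where B: "\<And>j x. j \<in> J \<Longrightarrow> x \<in> K j \<Longrightarrow> norm x \<le> B"
    unfolding bounded_iff by blast
  have "\<exists>L'. L j ** L' = mat 1 \<and> L' ** L j = mat 1" if "j \<in> J" for j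
    using det[OF that] by (metis invertible_det_nz invertible_def)
  then obtain L' where L': "\<And>j. j \<in> J \<Longrightarrow> L j ** L' j = mat 1" "\<And>j. j \<in> J \<Longrightarrow> L' j ** L j = mat 1"
    by metis
  define P where "P j h0 \<longleftrightarrow> 0 < h0 \<and> (\<forall>h u x c. 0 < h \<longrightarrow> h < h0 \<longrightarrow>
      (\<forall>x y. \<bar>u x - u y\<bar> \<le> R * norm (x - y)) \<longrightarrow> u 0 = 0 \<longrightarrow> norm x \<le> B \<longrightarrow>
      (\<forall>y\<in>cball x \<epsilon>. c \<le> (\<Sum>k\<in>UNIV. second_diff u (h *\<^sub>R column k (L j)) (lattice_floor (L j) (L' j) h y)) / h\<^sup>2) \<longrightarrow>
      c - \<eta> \<le> (\<Sum>k\<in>UNIV. hess_form (convol u \<rho>) (column k (L j)) x))" for j h0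
  have "\<exists>h0. P j h0" if j: "j \<in> J" for j
  proof (rule lattice_mollification[OF \<rho> L'(1)[OF j] L'(2)[OF j] R \<eta>, of B], goal_cases)
    case (1 h0)
    show ?case unfolding P_def by (intro exI[of _ h0] conjI allI impI 1) auto
  qed
  then obtain H where HP: "\<And>j. j \<in> J \<Longrightarrow> P j (H j)" by metis
  have H: "0 < H j" if "j \<in> J" for j using HP[OF that] by (simp add: P_def)
  have H2: "c - \<eta> \<le> (\<Sum>k\<in>UNIV. hess_form (convol u \<rho>) (column k (L j)) x)"
    if "j \<in> J" "0 < h" "h < H j" "\<And>x y. \<bar>u x - u y\<bar> \<le> R * norm (x - y)" "u 0 = 0" "norm x \<le> B"
      "\<And>y. y \<in> cball x \<epsilon> \<Longrightarrow>
         c \<le> (\<Sum>k\<in>UNIV. second_diff u (h *\<^sub>R column k (L j)) (lattice_floor (L j) (L' j) h y)) / h\<^sup>2"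
    for j h u x c
    by (rule HP[OF that(1), unfolded P_def, THEN conjunct2, rule_format, of h u x c]) (fact that)+
  have "\<exists>C\<ge>0. \<forall>h y. 0 < h \<longrightarrow> norm (lattice_floor (L j) (L' j) h y - y) \<le> C * h" if "j \<in> J" for j
    using lattice_floor_dist[of "L j"] L'(1)[OF that] by metis
  then obtain C where C: "\<And>j. j \<in> J \<Longrightarrow> 0 \<le> C j"
    "\<And>j h y. j \<in> J \<Longrightarrow> 0 < h \<Longrightarrow> norm (lattice_floor (L j) (L' j) h y - y) \<le> C j * h"
    by metis
  \<comment> \<open>Below every threshold at once, and with
    \<open>2 * (C j * h) \<le> \<epsilon>\<close>, so that two points rounded to the same lattice
    point are within \<open>\<epsilon>\<close> of each other.\<close>
  define h where "h = Min (insert 1 ((\<lambda>j. min (H j / 2) (\<epsilon> / (2 * (C j + 1)))) ` J))"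
  have h: "0 < h" using H C(1) \<epsilon> J by (auto simp: h_def add_nonneg_pos)
  have hH: "h < H j" "2 * (C j * h) \<le> \<epsilon>" if "j \<in> J" for j
  proof -
    have le: "h \<le> min (H j / 2) (\<epsilon> / (2 * (C j + 1)))"
      unfolding h_def by (rule Min_le) (use J in simp, rule insertI2, rule imageI, rule that)
    then show "h < H j" using H[OF that] by simp
    have "2 * (C j * h) \<le> 2 * (C j + 1) * h" using h by (simp add: algebra_simps)
    also have "\<dots> \<le> 2 * (C j + 1) * (\<epsilon> / (2 * (C j + 1)))"
      using le C(1)[OF that] by (intro mult_left_mono) auto
    also have "\<dots> = \<epsilon>" using C(1)[OF that] by simp
    finally show "2 * (C j * h) \<le> \<epsilon>" .
  qed
  define \<tau> where "\<tau> j = lattice_floor (L j) (L' j) h" for j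
  define V where "V j = h ^ ?N * \<bar>det (L j)\<bar>" for j
  have V: "0 < V j" if "j \<in> J" for j using h det[OF that] by (simp add: V_def)
  define X where "X j = {p \<in> range (\<tau> j). {y. \<tau> j y = p} \<subseteq> U j}" for j
  have X: "finite (X j)" "real (card (X j)) * V j \<le> measure lborel (U j)" if "j \<in> J" for j
    using card_lattice_cells[OF h L'(1)[OF that] L'(2)[OF that] U(1)[OF that] U(2)[OF that]]
    by (simp_all add: X_def V_def \<tau>_def)
  \<comment> \<open>Different lattices may share points and the sets \<open>U j\<close> may overlap,
    so masses add. Only the lower bound \<open>m_ge\<close> at each point and an upper bound on the
    total are used afterwards.\<close>
  define m where "m p = (\<Sum>j\<in>J. c j * V j * indicator (X j) p)" for p
  have m_ge: "c j * V j \<le> m p" if "j \<in> J" "p \<in> X j" for j p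
  proof -
    have "c j * V j * indicator (X j) p \<le> m p"
      unfolding m_def using that(1) J c V by (intro member_le_sum) (auto simp: less_imp_le)
    then show ?thesis using that by simp
  qed
  define XX where "XX = (\<Union>j\<in>J. X j)"
  have XX: "finite XX" using J X by (simp add: XX_def)
  have mpos: "0 < m p" if p: "p \<in> XX" for p
  proof -
    obtain j where j: "j \<in> J" "p \<in> X j" using p by (auto simp: XX_def)
    have "0 < c j * V j" using c[OF j(1)] V[OF j(1)] by simp
    with m_ge[OF j] show ?thesis by linarith
  qed
  define M where "M = (\<Sum>p\<in>XX. m p)"
  have M0: "0 \<le> M" unfolding M_def using mpos by (intro sum_nonneg) (simp add: less_imp_le)
  have "M = (\<Sum>j\<in>J. \<Sum>p\<in>XX. c j * V j * indicator (X j) p)"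
    unfolding M_def m_def by (rule sum.swap)
  also have "\<dots> = (\<Sum>j\<in>J. c j * (real (card (X j)) * V j))"
  proof (rule sum.cong[OF refl])
    fix j assume j: "j \<in> J"
    have "XX \<inter> X j = X j" using j by (auto simp: XX_def)
    then have "(\<Sum>p\<in>XX. indicator (X j) p) = real (card (X j))"
      using XX by (simp add: indicator_def sum_of_bool_eq)
    then show "(\<Sum>p\<in>XX. c j * V j * indicator (X j) p) = c j * (real (card (X j)) * V j)"
      by (simp add: sum_distrib_left[symmetric])
  qed
  also have "\<dots> \<le> (\<Sum>j\<in>J. c j * measure lborel (U j))"
    using X c by (intro sum_mono mult_left_mono) (auto simp: less_imp_le)
  also note mass
  finally have MR: "M \<le> measure lborel (cball (0::real^'n) R)" .
  define \<omega> where "\<omega> = unit_ball_vol (real ?N)"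
  have \<omega>: "0 < \<omega>" by (simp add: \<omega>_def)
  \<comment> \<open>The transport problem demands equal total masses, whereas the lattice points
    carry at most the volume of the ball of radius \<open>R\<close>. The target is shrunk to the
    ball of volume exactly \<open>M\<close>; slopes bounded by \<open>R'\<close> are also bounded by
    \<open>R\<close>.\<close>
  define R' where "R' = root ?N (M / \<omega>)"
  have R'0: "0 \<le> R'" using M0 \<omega> by (simp add: R'_def)
  have R'N: "R' ^ ?N = M / \<omega>" unfolding R'_def using M0 \<omega> by (intro real_root_pow_pos2) auto
  have M_eq: "M = measure lborel (cball (0::real^'n) R')"
  proof -
    have "measure lborel (cball (0::real^'n) R') = \<omega> * R' ^ ?N"
      using R'0 by (simp add: content_cball \<omega>_def)
    then show ?thesis using \<omega> by (simp add: R'N)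
  qed
  have "R' ^ ?N \<le> R ^ ?N"
    using MR R \<omega> unfolding R'N by (simp add: content_cball \<omega>_def pos_divide_le_eq mult.commute)
  then have R'R: "R' \<le> R" using R by (simp add: power_mono_iff[OF R'0])
  obtain u where u: "convex_on UNIV u" "\<And>x y. \<bar>u x - u y\<bar> \<le> R' * norm (x - y)" "u 0 = 0"
    "\<And>x. x \<in> XX \<Longrightarrow> \<exists>W\<in>sets borel. W \<subseteq> cball 0 R' \<and> m x \<le> measure lborel W \<and>
       (\<forall>p\<in>W. \<forall>y. u x + p \<bullet> (y - x) \<le> u y)"
    using semidiscrete_potential[OF XX mpos R'0 M_eq[unfolded M_def]] by blast
  have uR: "\<bar>u x - u y\<bar> \<le> R * norm (x - y)" for x y
    using order_trans[OF u(2) mult_right_mono[OF R'R norm_ge_zero]] .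
  have cu: "continuous_on UNIV u" by (rule lipschitz_continuous[OF uR])
  have lu: "locally_bounded u" by (rule locally_bounded_continuous[OF cu])
  have sW: "smooth (convol u \<rho>)" by (rule smooth_convol[OF lu \<rho>(1)])
  show thesis
  proof (rule that[OF sW])
    show "norm (grad (convol u \<rho>) x) \<le> R" for x
    proof (rule norm_grad_le[OF sW _ R])
      show "\<bar>convol u \<rho> x - convol u \<rho> y\<bar> \<le> R * norm (x - y)" for x y
        using \<rho> by (intro convol_lipschitz[OF uR cu, of \<rho> \<epsilon>]) (auto simp: smooth_kernel_def smooth_continuous)
    qed
    show "0 \<le> hess_form (convol u \<rho>) v x" for v x
      by (rule hess_form_convol_nonneg[OF u(1) cu \<rho>(1,2)])
    fix j x assume j: "j \<in> J" and x: "x \<in> K j"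
    show "real ?N * (c j * (det (L j))\<^sup>2) powr (1 / real ?N) - \<eta>
        \<le> (\<Sum>k\<in>UNIV. hess_form (convol u \<rho>) (column k (L j)) x)"
    proof (rule H2[OF j h hH(1)[OF j] uR u(3) B[OF j x]])
      fix y assume y: "y \<in> cball x \<epsilon>"
      \<comment> \<open>The whole cell of \<open>y\<close> lies within \<open>\<epsilon>\<close> of
        \<open>y\<close>, hence within \<open>2 * \<epsilon>\<close> of \<open>x\<close> and inside
        \<open>U j\<close>.\<close>
      have "\<tau> j y \<in> X j"
        unfolding X_def
      proof (intro CollectI conjI subsetI)
        fix y' assume "y' \<in> {y'. \<tau> j y' = \<tau> j y}"
        then have "\<tau> j y' = \<tau> j y" by simp
        then have "norm (y' - y) \<le> norm (\<tau> j y - y) + norm (\<tau> j y' - y')"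
          using norm_triangle_ineq4[of "\<tau> j y - y" "\<tau> j y' - y'"] by simp
        also have "\<dots> \<le> C j * h + C j * h"
          unfolding \<tau>_def by (intro add_mono C(2)[OF j h])
        also have "\<dots> \<le> \<epsilon>" using hH(2)[OF j] by linarith
        finally have "dist y y' \<le> \<epsilon>" by (simp add: dist_norm norm_minus_commute)
        then have "y' \<in> cball x (2 * \<epsilon>)" using y dist_triangle[of x y' y] by simp
        then show "y' \<in> U j" using \<epsilon>2[OF j x] by blast
      qed simp
      then have "\<tau> j y \<in> XX" using j by (auto simp: XX_def)
      from u(4)[OF this] obtain W where W: "W \<in> sets borel" "m (\<tau> j y) \<le> measure lborel W"
        "\<And>p z. p \<in> W \<Longrightarrow> u (\<tau> j y) + p \<bullet> (z - \<tau> j y) \<le> u z"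
        by blast
      have "c j * V j \<le> measure lborel W" using m_ge[OF j \<open>\<tau> j y \<in> X j\<close>] W(2) by linarith
      then show "real ?N * (c j * (det (L j))\<^sup>2) powr (1 / real ?N)
         \<le> (\<Sum>k\<in>UNIV. second_diff u (h *\<^sub>R column k (L j)) (lattice_floor (L j) (L' j) h y)) / h\<^sup>2"
        unfolding \<tau>_def[symmetric]
        by (intro subgradient_mass_am_gm[OF det[OF j] h c[OF j] W(1)] W(3)) (auto simp: V_def)
    qed
  qed
qed

section \<open>Factorisation and approximation of positive matrices\<close>

text \<open>If the form vanishes at \<open>v\<close>, a small move from \<open>v\<close> along
  \<open>w\<close>, against the sign of a nonzero \<open>w \<bullet> (A *v v)\<close>, would make it
  negative. Hence \<open>A *v v = 0\<close>, contrary to invertibility.\<close>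

lemma psd_mat_definite:
  fixes A :: "real^'n^'n"
  assumes A: "psd_mat A" and det: "det A \<noteq> 0" and v: "v \<noteq> 0"
  shows "0 < v \<bullet> (A *v v)"
proof (rule ccontr)
  assume "\<not> 0 < v \<bullet> (A *v v)"
  then have z: "v \<bullet> (A *v v) = 0" using A by (simp add: psd_mat_def order_antisym not_less)
  have sym: "w \<bullet> (A *v v) = v \<bullet> (A *v w)" for w
    using A by (simp add: psd_mat_def sym_mat_def) (metis dot_lmul_matrix inner_commute transpose_matrix_vector)
  have "w \<bullet> (A *v v) = 0" for w
  proof (rule ccontr)
    assume nz: "w \<bullet> (A *v v) \<noteq> 0"
    define b c where "b = w \<bullet> (A *v v)" and "c = w \<bullet> (A *v w)"
    have c0: "0 \<le> c" using A by (simp add: c_def psd_mat_def)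
    have q: "0 \<le> 2 * t * b + t\<^sup>2 * c" for t
    proof -
      have "0 \<le> (v + t *\<^sub>R w) \<bullet> (A *v (v + t *\<^sub>R w))" using A by (simp add: psd_mat_def)
      also have "\<dots> = 2 * t * b + t\<^sup>2 * c"
        by (simp add: matrix_vector_right_distrib matrix_vector_mult_scaleR inner_add_left inner_add_right
            z sym[of w, symmetric] b_def c_def power2_eq_square algebra_simps)
      finally show ?thesis .
    qed
    \<comment> \<open>Minimising the quadratic would suggest \<open>- b / c\<close>;
      \<open>c + 1\<close> in the denominator also covers \<open>c = 0\<close> and still gives a
      value of at most \<open>- b\<^sup>2 / (c + 1)\<close>.\<close>
    define t where "t = - b / (c + 1)"
    have tc: "t * (c + 1) = - b" using c0 by (simp add: t_def)
    have "2 * t * b + t\<^sup>2 * c \<le> 2 * t * b + t * (t * (c + 1))"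
      by (simp add: power2_eq_square algebra_simps)
    also have "\<dots> = t * b" unfolding tc by simp
    also have "\<dots> = - (b\<^sup>2 / (c + 1))" by (simp add: t_def power2_eq_square)
    also have "\<dots> < 0"
    proof -
      have "0 < b\<^sup>2" using nz by (simp add: b_def)
      then show ?thesis using c0 by simp
    qed
    finally show False using q[of t] by simp
  qed
  then have "A *v v = 0" by (metis inner_eq_zero_iff)
  then show False using det v by (metis invertible_det_nz matrix_left_invertible_ker invertible_def)
qed

text \<open>Gram-Schmidt for the inner product defined by \<open>A\<close>: the next vector is taken
  orthogonal to all \<open>A *v v i\<close>, which is possible by a dimension count, and is then
  normalised.\<close>

lemma matrix_orthonormal_family:
  fixes A :: "real^'n^'n"
  assumes sym: "sym_mat A" and pos: "\<And>v. v \<noteq> 0 \<Longrightarrow> 0 < v \<bullet> (A *v v)"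
  shows "\<exists>v :: 'n \<Rightarrow> real^'n. \<forall>i\<in>S. \<forall>j\<in>S. v i \<bullet> (A *v v j) = of_bool (i = j)"
proof (induction S rule: finite_induct[OF finite])
  case (2 k S)
  then obtain v where v: "\<And>i j. i \<in> S \<Longrightarrow> j \<in> S \<Longrightarrow> v i \<bullet> (A *v v j) = of_bool (i = j)" by blast
  have symm: "x \<bullet> (A *v y) = (A *v x) \<bullet> y" for x y
    using sym by (simp add: sym_mat_def) (metis dot_lmul_matrix transpose_matrix_vector)
  define T where "T = (\<lambda>i. A *v v i) ` S"
  have "dim T \<le> card T" by (rule dim_le_card') (simp add: T_def)
  also have "card T \<le> card S" unfolding T_def by (rule card_image_le) simp
  also have "\<dots> < card (insert k S)" using 2 by simp
  also have "\<dots> \<le> CARD('n)" by (rule card_mono) auto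
  finally have "dim T < DIM(real^'n)" by simp
  then obtain z where z: "z \<noteq> 0" "\<And>y. y \<in> span T \<Longrightarrow> orthogonal z y"
    using orthogonal_to_subspace_exists by blast
  define q where "q = z \<bullet> (A *v z)"
  have q: "0 < q" using pos[OF z(1)] by (simp add: q_def)
  define w where "w = (1 / sqrt q) *\<^sub>R z"
  have ww: "w \<bullet> (A *v w) = 1"
    using q by (simp add: w_def matrix_vector_mult_scaleR q_def[symmetric])
  have wv: "w \<bullet> (A *v v i) = 0" if "i \<in> S" for i
    using z(2)[of "A *v v i"] that by (simp add: T_def span_base w_def orthogonal_def)
  have vw: "v i \<bullet> (A *v w) = 0" if "i \<in> S" for i
    using wv[OF that] symm[of "v i" w] by (simp only: inner_commute)
  show ?case
    by (intro exI[of _ "v(k := w)"]) (use 2 v ww wv vw in auto)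
qed simp

text \<open>With the \<open>A\<close>-orthonormal vectors as columns of \<open>M\<close>, the
  product \<open>transpose M ** A ** M\<close> is the identity, so the transposed inverse of
  \<open>M\<close> is a factor; no eigenvectors are involved.\<close>

lemma psd_mat_factorisation:
  fixes A :: "real^'n^'n"
  assumes sym: "sym_mat A" and pos: "\<And>v. v \<noteq> 0 \<Longrightarrow> 0 < v \<bullet> (A *v v)"
  obtains N :: "real^'n^'n" where "A = N ** transpose N"
proof -
  obtain v :: "'n \<Rightarrow> real^'n" where v: "\<And>i j. v i \<bullet> (A *v v j) = of_bool (i = j)"
    using matrix_orthonormal_family[OF assms, of UNIV] by blast
  define M where "M = (\<chi> a i. v i $ a)"
  have col: "M *v axis i 1 = v i" for i
    by (simp add: matrix_vector_mult_basis M_def column_def vec_eq_iff)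
  have MAM: "transpose M ** A ** M = mat 1"
  proof -
    have "(transpose M ** A ** M) $ i $ j = of_bool (i = j)" for i j
    proof -
      have "(transpose M ** A ** M) $ i $ j = ((transpose M ** A ** M) *v axis j 1) $ i"
        by (simp add: matrix_vector_mult_basis column_def)
      also have "\<dots> = (transpose M *v (A *v v j)) $ i"
        by (simp add: matrix_vector_mul_assoc[symmetric] col)
      also have "\<dots> = v i \<bullet> (A *v v j)"
        by (simp add: matrix_vector_mult_def transpose_def M_def inner_vec_def)
      finally show ?thesis by (simp add: v)
    qed
    then show ?thesis by (simp add: vec_eq_iff mat_def)
  qed
  then obtain M' where M': "M' ** M = mat 1" "M ** M' = mat 1"
    using matrix_left_right_inverse by metis
  have t: "transpose M' ** transpose M = mat 1"
    using M' by (metis matrix_transpose_mul transpose_mat)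
  have "A = (transpose M' ** transpose M) ** A ** (M ** M')" by (simp add: t M')
  also have "\<dots> = transpose M' ** (transpose M ** A ** M) ** M'" by (simp add: matrix_mul_assoc)
  also have "\<dots> = transpose M' ** transpose (transpose M')" by (simp add: MAM)
  finally show thesis by (rule that[of "transpose M'"])
qed

section \<open>The trace pairing and approximation from below by Gram matrices\<close>

definition mat_inner :: "real^'n^'n \<Rightarrow> real^'n^'n \<Rightarrow> real" where
  "mat_inner P Q = (\<Sum>i\<in>UNIV. \<Sum>j\<in>UNIV. P $ i $ j * Q $ i $ j)"

lemma mat_inner_gram:
  "mat_inner (L ** transpose L) Q = (\<Sum>k\<in>UNIV. column k L \<bullet> (Q *v column k L))"
proof -
  have "mat_inner (L ** transpose L) Q = (\<Sum>i\<in>UNIV. \<Sum>j\<in>UNIV. \<Sum>k\<in>UNIV. L $ i $ k * L $ j $ k * Q $ i $ j)"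
    by (simp add: mat_inner_def matrix_matrix_mult_def transpose_def sum_distrib_right)
  also have "\<dots> = (\<Sum>i\<in>UNIV. \<Sum>k\<in>UNIV. \<Sum>j\<in>UNIV. L $ i $ k * L $ j $ k * Q $ i $ j)"
    by (rule sum.cong[OF refl]) (rule sum.swap)
  also have "\<dots> = (\<Sum>k\<in>UNIV. \<Sum>i\<in>UNIV. \<Sum>j\<in>UNIV. L $ i $ k * L $ j $ k * Q $ i $ j)"
    by (rule sum.swap)
  also have "\<dots> = (\<Sum>k\<in>UNIV. column k L \<bullet> (Q *v column k L))"
    by (simp add: inner_vec_def matrix_vector_mult_def column_def sum_distrib_left mult_ac)
  finally show ?thesis .
qed

text \<open>For Gram matrices the claim is immediate, but the factorisation is proved for definite
  matrices only. Hence \<open>P\<close> is replaced by \<open>P + t *\<^sub>R mat 1\<close>, and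
  \<open>t\<close> tends to 0.\<close>

lemma mat_inner_psd_nonneg:
  fixes P Q :: "real^'n^'n"
  assumes P: "psd_mat P" and Q: "\<And>v. 0 \<le> v \<bullet> (Q *v v)"
  shows "0 \<le> mat_inner P Q"
proof -
  have "0 \<le> mat_inner P Q + t * mat_inner (mat 1) Q" if t: "0 < t" for t
  proof -
    let ?P = "P + t *\<^sub>R mat 1"
    have "sym_mat ?P"
      using P by (auto simp: psd_mat_def sym_mat_def vec_eq_iff transpose_def mat_def)
    moreover have "0 < v \<bullet> (?P *v v)" if "v \<noteq> 0" for v
    proof -
      have "v \<bullet> (?P *v v) = v \<bullet> (P *v v) + t * (v \<bullet> v)"
      proof -
        have tv: "(t *\<^sub>R mat 1) *v v = t *\<^sub>R v"
          using scaleR_matrix_vector_assoc[of t "mat 1" v] by (simp only: matrix_vector_mul_lid)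
        show ?thesis
          by (simp only: matrix_vector_mult_add_rdistrib inner_add_right tv inner_scaleR_right)
      qed
      moreover have "0 \<le> v \<bullet> (P *v v)" using P by (simp add: psd_mat_def)
      moreover have "0 < t * (v \<bullet> v)" using t that by simp
      ultimately show ?thesis by linarith
    qed
    ultimately obtain N :: "real^'n^'n" where N: "?P = N ** transpose N"
      by (rule psd_mat_factorisation)
    have "0 \<le> mat_inner ?P Q" unfolding N mat_inner_gram by (intro sum_nonneg Q)
    also have "\<dots> = mat_inner P Q + t * mat_inner (mat 1) Q"
      by (simp add: mat_inner_def sum.distrib sum_distrib_left algebra_simps)
    finally show ?thesis .
  qed
  then have *: "0 \<le> mat_inner P Q + t * mat_inner (mat 1) Q" if "0 < t" for t using that by blast
  show ?thesis
  proof (rule tendsto_lowerbound)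
    show "((\<lambda>t. mat_inner P Q + t * mat_inner (mat 1) Q) \<longlongrightarrow> mat_inner P Q) (at_right 0)"
      by (auto intro!: tendsto_eq_intros)
    show "\<forall>\<^sub>F t in at_right 0. 0 \<le> mat_inner P Q + t * mat_inner (mat 1) Q"
      using * by (auto simp: eventually_at_right_field intro: exI[of _ 1])
  qed simp
qed

lemma continuous_on_det: "continuous_on S (det :: real^'n^'n \<Rightarrow> real)"
proof -
  have "continuous_on S (\<lambda>A :: real^'n^'n. det A)"
    unfolding det_def by (intro continuous_intros)
  then show ?thesis .
qed

lemma norm_matrix_vector_mult_le:
  fixes M :: "real^'n^'m" shows "norm (M *v v) \<le> norm M * norm v"
proof -
  have "norm (M *v v) = L2_set (\<lambda>i. norm (M $ i \<bullet> v)) UNIV"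
    by (simp add: norm_vec_def matrix_vector_mult_def inner_vec_def)
  also have "\<dots> \<le> L2_set (\<lambda>i. norm (M $ i) * norm v) UNIV"
    by (rule L2_set_mono) (auto simp: Cauchy_Schwarz_ineq2)
  also have "\<dots> = norm M * norm v"
    by (simp add: norm_vec_def[of M] L2_set_left_distrib)
  finally show ?thesis .
qed

lemma norm_transpose: "norm (transpose M) = norm (M :: real^'n^'n)"
proof -
  have "(\<Sum>i\<in>UNIV. \<Sum>j\<in>UNIV. (M $ j $ i)\<^sup>2) = (\<Sum>i\<in>UNIV. \<Sum>j\<in>UNIV. (M $ i $ j)\<^sup>2)"
    by (rule sum.swap)
  then show ?thesis
    by (simp add: norm_vec_def L2_set_def transpose_def sum_nonneg)
qed

lemma gram_quadratic_form: "v \<bullet> ((N ** transpose N) *v v) = (norm (transpose N *v v))\<^sup>2"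
  for N :: "real^'n^'n"
proof -
  have "v \<bullet> ((N ** transpose N) *v v) = (v v* N) \<bullet> (transpose N *v v)"
    by (simp only: matrix_vector_mul_assoc[symmetric] dot_lmul_matrix)
  then show ?thesis by (simp add: power2_norm_eq_inner)
qed

lemma sym_mat_gram: "sym_mat (L ** transpose L)" for L :: "real^'n^'n"
  by (simp add: sym_mat_def matrix_transpose_mul)

text \<open>A factor \<open>N\<close> of \<open>A\<close> is first shrunk to
  \<open>s *\<^sub>R N\<close>. That leaves room: every \<open>L\<close> in a small ball around it
  keeps its Gram matrix below \<open>A\<close>, and the determinant conditions are open, so the
  dense set \<open>D\<close> contains a suitable \<open>L\<close>. A countable \<open>D\<close> will
  later cut the domain into countably many pieces.\<close>

lemma gram_approximation:
  fixes A :: "real^'n^'n"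
  assumes A: "psd_mat A" "det A \<noteq> 0" and \<theta>: "0 < \<theta>" "\<theta> < 1"
    and D: "\<And>X :: (real^'n^'n) set. open X \<Longrightarrow> X \<noteq> {} \<Longrightarrow> \<exists>d\<in>D. d \<in> X"
  obtains L where "L \<in> D" "det L \<noteq> 0" "psd_mat (A - L ** transpose L)"
    "(1 - \<theta>) * det A \<le> (det L)\<^sup>2" "(det L)\<^sup>2 \<le> det A"
proof -
  let ?n = "CARD('n)"
  have symA: "sym_mat A" using A by (simp add: psd_mat_def)
  obtain N :: "real^'n^'n" where N: "A = N ** transpose N"
    using psd_mat_factorisation[OF symA psd_mat_definite[OF A]] by blast
  have dA: "det A = (det N)\<^sup>2" by (simp add: N det_mul det_transpose power2_eq_square)
  then have dN: "det N \<noteq> 0" using A by auto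
  have dA0: "0 < det A" using dN by (simp add: dA)
  \<comment> \<open>Makes the squared determinant of the shrunken factor
    \<open>(1 - \<theta> / 2) * det A\<close>, strictly between the two bounds required of
    \<open>(det L)\<^sup>2\<close>.\<close>
  define s where "s = root (2 * ?n) (1 - \<theta> / 2)"
  have s0: "0 < s" "s < 1" using \<theta> by (auto simp: s_def)
  have sn: "(s ^ ?n)\<^sup>2 = 1 - \<theta> / 2"
  proof -
    have "s ^ (2 * ?n) = 1 - \<theta> / 2" unfolding s_def using \<theta> by (intro real_root_pow_pos2) auto
    then show ?thesis by (simp add: power_mult[symmetric] mult.commute)
  qed
  have dsN: "det (s *\<^sub>R N) = s ^ ?n * det N"
    by (simp add: det_def prod.distrib sum_distrib_left mult_ac)
  have sN2: "(det (s *\<^sub>R N))\<^sup>2 = (1 - \<theta> / 2) * det A"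
    by (simp only: dsN power_mult_distrib sn dA)
  obtain N' where N': "N' ** transpose N = mat 1"
    using dN by (metis det_transpose invertible_det_nz invertible_def)
  define \<kappa> where "\<kappa> = norm N'"
  have \<kappa>: "norm v \<le> \<kappa> * norm (transpose N *v v)" for v
    using norm_matrix_vector_mult_le[of N' "transpose N *v v"] N'
    by (simp only: matrix_vector_mul_assoc \<kappa>_def matrix_vector_mul_lid)
  have \<kappa>0: "0 \<le> \<kappa>" by (simp add: \<kappa>_def)
  \<comment> \<open>\<open>\<kappa>\<close> bounds \<open>norm v\<close> by
    \<open>norm (transpose N *v v)\<close>, so a perturbation of size \<open>r\<close> costs at most
    \<open>(1 - s) * norm (transpose N *v v)\<close>, the room gained by shrinking.\<close>
  define r where "r = (1 - s) / (\<kappa> + 1)"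
  have r: "0 < r" using s0 \<kappa>0 by (simp add: r_def)
  define X where "X = ball (s *\<^sub>R N) r \<inter> {L. (1 - \<theta>) * det A < (det L)\<^sup>2} \<inter> {L. (det L)\<^sup>2 < det A}"
  have "open X"
    unfolding X_def
    by (intro open_Int open_ball open_Collect_less continuous_intros continuous_on_det)
  moreover have "s *\<^sub>R N \<in> X"
    using r sN2 dA0 \<theta> by (simp add: X_def)
  ultimately obtain L where L: "L \<in> D" "L \<in> X" using D[of X] by blast
  have dL: "(1 - \<theta>) * det A < (det L)\<^sup>2" "(det L)\<^sup>2 < det A" using L(2) by (auto simp: X_def)
  have Ln: "norm (L - s *\<^sub>R N) \<le> r" using L(2) by (auto simp: X_def dist_norm norm_minus_commute)
  have le: "norm (transpose L *v v) \<le> norm (transpose N *v v)" for v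
  proof -
    have "transpose L *v v = transpose (L - s *\<^sub>R N) *v v + s *\<^sub>R (transpose N *v v)"
    proof -
      have "transpose L = transpose (L - s *\<^sub>R N) + s *\<^sub>R transpose N"
        by (simp add: vec_eq_iff transpose_def)
      then show ?thesis by (metis matrix_vector_mult_add_rdistrib scaleR_matrix_vector_assoc)
    qed
    then have "norm (transpose L *v v) \<le> norm (transpose (L - s *\<^sub>R N) *v v) + norm (s *\<^sub>R (transpose N *v v))"
      by (metis norm_triangle_ineq)
    also have "norm (transpose (L - s *\<^sub>R N) *v v) \<le> r * norm v"
      using norm_matrix_vector_mult_le[of "transpose (L - s *\<^sub>R N)" v] Ln
      by (simp only: norm_transpose) (meson mult_right_mono norm_ge_zero order_trans)
    also have "r * norm v \<le> r * (\<kappa> * norm (transpose N *v v))"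
      using r \<kappa> by (intro mult_left_mono) auto
    also have "\<dots> = (r * \<kappa>) * norm (transpose N *v v)" by simp
    also have "\<dots> \<le> (1 - s) * norm (transpose N *v v)"
    proof (intro mult_right_mono)
      have "r * \<kappa> \<le> r * (\<kappa> + 1)" using r by simp
      also have "\<dots> = 1 - s" using \<kappa>0 by (simp add: r_def)
      finally show "r * \<kappa> \<le> 1 - s" .
    qed simp
    also have "norm (s *\<^sub>R (transpose N *v v)) = s * norm (transpose N *v v)" using s0 by simp
    finally show ?thesis by (simp add: algebra_simps)
  qed
  have "psd_mat (A - L ** transpose L)"
    unfolding psd_mat_def
  proof (intro conjI allI)
    have "transpose (A - L ** transpose L) = transpose A - transpose (L ** transpose L)"
      by (simp add: vec_eq_iff transpose_def)
    then show "sym_mat (A - L ** transpose L)"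
      using symA sym_mat_gram[of L] by (simp add: sym_mat_def)
    fix v
    have "(norm (transpose L *v v))\<^sup>2 \<le> (norm (transpose N *v v))\<^sup>2"
      by (intro power_mono le) auto
    then show "0 \<le> v \<bullet> ((A - L ** transpose L) *v v)"
      by (simp only: N matrix_vector_mult_diff_rdistrib inner_diff_right gram_quadratic_form)
  qed
  moreover have "det L \<noteq> 0"
  proof -
    have "0 < (1 - \<theta>) * det A" using dA0 \<theta> by simp
    then have "0 < (det L)\<^sup>2" using dL by linarith
    then show ?thesis by auto
  qed
  ultimately show thesis using that L(1) dL by (meson less_imp_le)
qed

lemma closed_psd_mat: "closed {M :: real^'n^'n. psd_mat M}"
proof -
  have eq: "{M :: real^'n^'n. psd_mat M} = {M. transpose M = M} \<inter> (\<Inter>v. {M. 0 \<le> v \<bullet> (M *v v)})"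
    by (auto simp: psd_mat_def sym_mat_def)
  have c1: "closed {M :: real^'n^'n. transpose M = M}"
    unfolding transpose_def by (intro closed_Collect_eq continuous_intros)
  have c2: "closed {M :: real^'n^'n. 0 \<le> v \<bullet> (M *v v)}" for v
    unfolding matrix_vector_mult_def inner_vec_def by (intro closed_Collect_le continuous_intros)
  show ?thesis unfolding eq by (intro closed_Int closed_INT ballI c1 c2)
qed

section \<open>The determinant estimate\<close>

definition hess_mat :: "(real^'n \<Rightarrow> real) \<Rightarrow> real^'n \<Rightarrow> real^'n^'n" where
  "hess_mat W x = (\<chi> i j. partial_deriv j (partial_deriv i W) x)"

lemma hess_form_eq: "hess_form W v x = v \<bullet> (hess_mat W x *v v)"
  by (simp add: hess_form_def hess_mat_def inner_vec_def matrix_vector_mult_def sum_distrib_left mult_ac)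

text \<open>Lowering \<open>A\<close> to a Gram matrix below it lowers the trace against a
  nonnegative Hessian, and on a Gram matrix the trace is a sum of second derivatives along columns,
  which is what the lattice construction bounds.\<close>

lemma mat_inner_hess_ge:
  fixes A L :: "real^'n^'n"
  assumes "psd_mat (A - L ** transpose L)" "\<And>v. 0 \<le> hess_form W v x"
  shows "(\<Sum>k\<in>UNIV. hess_form W (column k L) x) \<le> mat_inner A (hess_mat W x)"
proof -
  have "0 \<le> mat_inner (A - L ** transpose L) (hess_mat W x)"
    using assms by (intro mat_inner_psd_nonneg) (simp_all add: hess_form_eq)
  also have "\<dots> = mat_inner A (hess_mat W x) - mat_inner (L ** transpose L) (hess_mat W x)"
    by (simp add: mat_inner_def left_diff_distrib sum_subtractf)
  finally show ?thesis by (simp add: mat_inner_gram hess_form_eq)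
qed

lemma set_integrable_mult_continuous:
  fixes f g :: "real^'n \<Rightarrow> real"
  assumes f: "set_integrable lebesgue S f" and S: "bounded S" "S \<in> sets lebesgue" and g: "continuous_on UNIV g"
  shows "set_integrable lebesgue S (\<lambda>x. f x * g x)"
proof -
  obtain a where a: "S \<subseteq> cball 0 a" using S(1) by (auto simp: bounded_iff subset_iff)
  have "locally_bounded g" by (rule locally_bounded_continuous[OF g])
  then obtain B where B: "\<And>y. y \<in> cball 0 a \<Longrightarrow> \<bar>g y\<bar> \<le> B"
    unfolding locally_bounded_def by metis
  have [measurable]: "g \<in> borel_measurable lebesgue"
    using borel_measurable_continuous_onI[OF g] by (intro measurable_completion) simp
  have [measurable]: "(\<lambda>x. indicat_real S x *\<^sub>R f x) \<in> borel_measurable lebesgue"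
    using f by (auto simp: set_integrable_def)
  have "integrable lebesgue (\<lambda>x. (indicat_real S x *\<^sub>R f x) * g x)"
  proof (rule Bochner_Integration.integrable_bound)
    show "integrable lebesgue (\<lambda>x. B * (indicat_real S x *\<^sub>R f x))"
      using f unfolding set_integrable_def by simp
    show "AE x in lebesgue. norm ((indicat_real S x *\<^sub>R f x) * g x) \<le> norm (B * (indicat_real S x *\<^sub>R f x))"
    proof (rule AE_I2)
      fix x
      show "norm ((indicat_real S x *\<^sub>R f x) * g x) \<le> norm (B * (indicat_real S x *\<^sub>R f x))"
      proof (cases "x \<in> S")
        case True
        then have "\<bar>g x\<bar> \<le> \<bar>B\<bar>" using B[of x] a by auto
        then have "\<bar>f x\<bar> * \<bar>g x\<bar> \<le> \<bar>f x\<bar> * \<bar>B\<bar>" by (rule mult_left_mono) simp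
        then show ?thesis using True by (simp add: abs_mult mult.commute)
      qed simp
    qed
  qed measurable
  then show ?thesis unfolding set_integrable_def by (simp add: mult_ac)
qed

lemma set_integrable_mat_inner:
  fixes A :: "real^'n \<Rightarrow> real^'n^'n"
  assumes A: "\<And>i j. set_integrable lebesgue S (\<lambda>x. A x $ i $ j)" and S: "bounded S" "S \<in> sets lebesgue"
    and W: "smooth W"
  shows "set_integrable lebesgue S (\<lambda>x. mat_inner (A x) (hess_mat W x))"
proof -
  have "set_integrable lebesgue S (\<lambda>x. A x $ i $ j * partial_deriv j (partial_deriv i W) x)" for i j
    by (intro set_integrable_mult_continuous A S smooth_continuous smooth_partial_deriv W)
  then show ?thesis
    unfolding mat_inner_def hess_mat_def set_integrable_def scaleR_sum_right
    by (intro Bochner_Integration.integrable_sum) simp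
qed

text \<open>\<open>K\<close> will be the set where the Hessian bound holds, \<open>U\<close> the set
  on which the mass to be transported is placed.\<close>

lemma lebesgue_approx:
  fixes E \<Omega> :: "'a::euclidean_space set"
  assumes E: "E \<in> sets lebesgue" "E \<subseteq> \<Omega>" and \<Omega>: "open \<Omega>" "bounded \<Omega>" and e: "0 < e"
  obtains K U where "compact K" "K \<subseteq> E" "measure lebesgue E - e \<le> measure lebesgue K"
    "open U" "E \<subseteq> U" "U \<subseteq> \<Omega>" "measure lebesgue U \<le> measure lebesgue E + e"
proof -
  have bE: "bounded E" using bounded_subset \<Omega>(2) E(2) by blast
  then have mE: "E \<in> lmeasurable" using E(1) by (simp add: bounded_set_imp_lmeasurable)
  obtain K where K: "closed K" "K \<subseteq> E" "E - K \<in> lmeasurable" "emeasure lebesgue (E - K) < ennreal e"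
    using sets_lebesgue_inner_closed[OF E(1) e] .
  obtain T where T: "open T" "E \<subseteq> T" "T - E \<in> lmeasurable" "emeasure lebesgue (T - E) < ennreal e"
    using sets_lebesgue_outer_open[OF E(1) e] .
  have cK: "compact K" using K bE bounded_subset compact_eq_bounded_closed by blast
  have "measure lebesgue E \<le> measure lebesgue (K \<union> (E - K))"
    using mE cK K(2) by (intro measure_mono_fmeasurable) (auto simp: lmeasurable_compact fmeasurable.Un K(3))
  also have "\<dots> \<le> measure lebesgue K + measure lebesgue (E - K)"
    by (rule measure_Un_le) (use cK K(3) in \<open>auto simp: lmeasurable_compact fmeasurableD\<close>)
  also have "measure lebesgue (E - K) \<le> e"
    using K(4) e unfolding measure_def by (intro enn2real_leI) (auto simp: less_imp_le)
  finally have 1: "measure lebesgue E - e \<le> measure lebesgue K" by simp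
  define U where "U = T \<inter> \<Omega>"
  have "measure lebesgue U \<le> measure lebesgue (E \<union> (T - E))"
    using \<Omega> T(1) by (intro measure_mono_fmeasurable fmeasurable.Un mE T(3)) (auto simp: U_def)
  also have "\<dots> \<le> measure lebesgue E + measure lebesgue (T - E)"
    by (rule measure_Un_le) (use E(1) T(3) in \<open>auto simp: fmeasurableD\<close>)
  also have "measure lebesgue (T - E) \<le> e"
    using T(4) e unfolding measure_def by (intro enn2real_leI) (auto simp: less_imp_le)
  finally have 2: "measure lebesgue U \<le> measure lebesgue E + e" by simp
  show thesis
    by (rule that[of K U]) (use K cK T 1 2 E \<Omega> in \<open>auto simp: U_def\<close>)
qed

text \<open>The fixed-point property behind the exponent: with
  \<open>c = D powr (1 / (n - 1))\<close> the AM-GM bound \<open>(c * D) powr (1 / n)\<close>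
  returns \<open>c\<close> itself.\<close>

lemma powr_conjugate:
  fixes D n :: real
  assumes "0 < D" "1 < n"
  shows "(D powr (1 / (n - 1)) * D) powr (1 / n) = D powr (1 / (n - 1))"
proof -
  have "D powr (1 / (n - 1)) * D = D powr (1 / (n - 1) + 1)"
    using assms by (simp add: powr_add)
  also have "1 / (n - 1) + 1 = n / (n - 1)" using assms by (simp add: field_simps)
  finally show ?thesis using assms by (simp add: powr_powr)
qed

text \<open>\<open>S\<close> plays two roles. Up to errors of order \<open>e\<close> it is the mass
  to be transported, which fixes the radius \<open>R\<close> by its volume, and \<open>n * S\<close>
  is a lower bound for the integral of the trace against the Hessian of the potential. Since
  \<open>key\<close> bounds that integral by \<open>R * G\<close>, the number \<open>S\<close>
  satisfies a closed inequality.\<close>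

lemma finite_family_estimate:
  fixes A :: "real^'n \<Rightarrow> real^'n^'n" and L :: "'i \<Rightarrow> real^'n^'n"
  defines "n \<equiv> real CARD('n)"
  assumes n2: "CARD('n) \<ge> 2" and \<Omega>: "open \<Omega>" "bounded \<Omega>"
    and A: "\<And>i j. set_integrable lebesgue \<Omega> (\<lambda>x. A x $ i $ j)"
    and psd: "AE x in lebesgue. x \<in> \<Omega> \<longrightarrow> psd_mat (A x)"
    and key: "\<And>W R. smooth W \<Longrightarrow> 0 \<le> R \<Longrightarrow> (\<And>x. norm (grad W x) \<le> R) \<Longrightarrow>
       (LINT x:\<Omega>|lebesgue. mat_inner (A x) (hess_mat W x)) \<le> R * G"
    and J: "finite J" and det: "\<And>j. j \<in> J \<Longrightarrow> det (L j) \<noteq> 0"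
    and E: "\<And>j. j \<in> J \<Longrightarrow> E j \<in> sets lebesgue" "\<And>j. j \<in> J \<Longrightarrow> E j \<subseteq> \<Omega>" "disjoint_family_on E J"
    and AL: "\<And>j x. j \<in> J \<Longrightarrow> x \<in> E j \<Longrightarrow> psd_mat (A x - L j ** transpose (L j))"
    and G: "0 \<le> G"
  defines "S \<equiv> (\<Sum>j\<in>J. ((det (L j))\<^sup>2) powr (1 / (n - 1)) * measure lebesgue (E j))"
  shows "n * S \<le> root (CARD('n)) (S / unit_ball_vol n) * G"
proof -
  define c where "c j = ((det (L j))\<^sup>2) powr (1 / (n - 1))" for j
  define C where "C = (\<Sum>j\<in>J. c j)"
  define T where "T = (\<Sum>j\<in>J. measure lebesgue (E j))"
  have c: "0 < c j" if "j \<in> J" for j using det[OF that] by (simp add: c_def)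
  have n: "1 < n" using n2 by (simp add: n_def)
  have cc: "(c j * (det (L j))\<^sup>2) powr (1 / n) = c j" if "j \<in> J" for j
    using powr_conjugate[of "(det (L j))\<^sup>2" n] det[OF that] n by (simp add: c_def)
  define \<omega> where "\<omega> = unit_ball_vol n"
  have \<omega>: "0 < \<omega>" using n by (simp add: \<omega>_def)
  have S: "S = (\<Sum>j\<in>J. c j * measure lebesgue (E j))" by (simp add: S_def c_def)
  have S0: "0 \<le> S" unfolding S using c by (intro sum_nonneg mult_nonneg_nonneg) (auto simp: less_imp_le)
  have C0: "0 \<le> C" unfolding C_def using c by (intro sum_nonneg) (auto simp: less_imp_le)
  have step: "n * S - e * (n * C + T) \<le> root CARD('n) ((S + e * C) / \<omega>) * G" if e: "0 < e" for e
  proof -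
    define Q where "Q j p \<longleftrightarrow> compact (fst p) \<and> fst p \<subseteq> E j \<and> measure lebesgue (E j) - e \<le> measure lebesgue (fst p) \<and>
      open (snd p) \<and> E j \<subseteq> snd p \<and> snd p \<subseteq> \<Omega> \<and> measure lebesgue (snd p) \<le> measure lebesgue (E j) + e" for j p
    have "\<exists>p. Q j p" if j: "j \<in> J" for j
    proof (rule lebesgue_approx[OF E(1)[OF j] E(2)[OF j] \<Omega> e], goal_cases)
      case (1 K U)
      then show ?case by (intro exI[of _ "(K, U)"]) (simp add: Q_def)
    qed
    then obtain p where p: "\<And>j. j \<in> J \<Longrightarrow> Q j (p j)" by metis
    define K U where "K j = fst (p j)" and "U j = snd (p j)" for j
    have KU: "compact (K j)" "K j \<subseteq> E j" "measure lebesgue (E j) - e \<le> measure lebesgue (K j)"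
      "open (U j)" "E j \<subseteq> U j" "U j \<subseteq> \<Omega>" "measure lebesgue (U j) \<le> measure lebesgue (E j) + e"
      if "j \<in> J" for j
      using p[OF that] unfolding Q_def K_def U_def by blast+
    \<comment> \<open>The ball of this radius has volume \<open>S + e * C\<close>, an upper bound
      for the mass on the sets \<open>U j\<close>, each of which exceeds \<open>E j\<close> by at
      most \<open>e\<close> in measure.\<close>
    define R where "R = root CARD('n) ((S + e * C) / \<omega>)"
    have m0: "0 \<le> (S + e * C) / \<omega>" using S0 C0 e \<omega> by simp
    have R0: "0 \<le> R" using m0 by (simp add: R_def)
    have RN: "R ^ CARD('n) = (S + e * C) / \<omega>" unfolding R_def using m0 by (intro real_root_pow_pos2) auto
    have vol: "measure lborel (cball (0::real^'n) R) = S + e * C"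
    proof -
      have "measure lborel (cball (0::real^'n) R) = \<omega> * R ^ CARD('n)"
        using R0 by (simp add: content_cball \<omega>_def n_def)
      then show ?thesis using \<omega> by (simp add: RN)
    qed
    have "(\<Sum>j\<in>J. c j * measure lborel (U j)) \<le> (\<Sum>j\<in>J. c j * (measure lebesgue (E j) + e))"
    proof (rule sum_mono, rule mult_left_mono)
      fix j assume j: "j \<in> J"
      have "measure lborel (U j) = measure lebesgue (U j)" using KU(4)[OF j] by simp
      then show "measure lborel (U j) \<le> measure lebesgue (E j) + e" using KU(7)[OF j] by simp
      show "0 \<le> c j" using c[OF j] by simp
    qed
    also have "\<dots> = S + e * C"
      by (simp add: S C_def distrib_left sum.distrib sum_distrib_left mult.commute)
    finally have mass: "(\<Sum>j\<in>J. c j * measure lborel (U j)) \<le> measure lborel (cball (0::real^'n) R)"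
      by (simp add: vol)
    have bU: "bounded (U j)" and KsU: "K j \<subseteq> U j" if "j \<in> J" for j
      using KU(2,5,6)[OF that] \<Omega>(2) bounded_subset by blast+
    have "\<exists>W. smooth W \<and> (\<forall>x. norm (grad W x) \<le> R) \<and> (\<forall>v x. 0 \<le> hess_form W v x) \<and>
      (\<forall>j\<in>J. \<forall>x\<in>K j. n * (c j * (det (L j))\<^sup>2) powr (1 / n) - e
          \<le> (\<Sum>k\<in>UNIV. hess_form W (column k (L j)) x))"
    proof (rule smooth_convex_potential[of J L c K U R e], goal_cases)
      case (11 W)
      then show ?case unfolding n_def by blast
    qed (rule J det c KU bU KsU R0 e mass; assumption)+
    then obtain W :: "real^'n \<Rightarrow> real" where W: "smooth W" "\<And>x. norm (grad W x) \<le> R" "\<And>v x. 0 \<le> hess_form W v x"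
      "\<And>j x. j \<in> J \<Longrightarrow> x \<in> K j \<Longrightarrow>
        n * (c j * (det (L j))\<^sup>2) powr (1 / n) - e \<le> (\<Sum>k\<in>UNIV. hess_form W (column k (L j)) x)"
      by blast
    define f where "f x = mat_inner (A x) (hess_mat W x)" for x
    have fi: "set_integrable lebesgue \<Omega> f"
      unfolding f_def using \<Omega> by (intro set_integrable_mat_inner A W) auto
    have fK: "n * c j - e \<le> f x" if j: "j \<in> J" "x \<in> K j" for j x
    proof -
      have "n * c j - e \<le> (\<Sum>k\<in>UNIV. hess_form W (column k (L j)) x)"
        using W(4)[OF j] cc[OF j(1)] by simp
      also have "\<dots> \<le> f x"
        unfolding f_def using AL[OF j(1)] KU(2)[OF j(1)] j(2) by (intro mat_inner_hess_ge W) blast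
      finally show ?thesis .
    qed
    have mK: "K j \<in> lmeasurable" if "j \<in> J" for j using KU(1)[OF that] by (rule lmeasurable_compact)
    have iK: "integrable lebesgue (\<lambda>x. (n * c j - e) * indicat_real (K j) x)" if "j \<in> J" for j
      using mK[OF that] by (intro integrable_mult_right integrable_real_indicator) (auto simp: fmeasurable_def)
    have "(\<Sum>j\<in>J. (n * c j - e) * measure lebesgue (K j)) = (LINT x|lebesgue. (\<Sum>j\<in>J. (n * c j - e) * indicator (K j) x))"
    proof -
      have "(LINT x|lebesgue. (\<Sum>j\<in>J. (n * c j - e) * indicator (K j) x))
         = (\<Sum>j\<in>J. LINT x|lebesgue. (n * c j - e) * indicator (K j) x)"
        by (rule Bochner_Integration.integral_sum) (rule iK)
      then show ?thesis by simp
    qed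
    also have "\<dots> \<le> (LINT x:\<Omega>|lebesgue. f x)"
      unfolding set_lebesgue_integral_def
    proof (rule integral_mono_AE)
      show "integrable lebesgue (\<lambda>x. \<Sum>j\<in>J. (n * c j - e) * indicat_real (K j) x)"
        by (rule Bochner_Integration.integrable_sum) (rule iK)
      show "integrable lebesgue (\<lambda>x. indicat_real \<Omega> x *\<^sub>R f x)" using fi by (simp add: set_integrable_def)
      show "AE x in lebesgue. (\<Sum>j\<in>J. (n * c j - e) * indicat_real (K j) x) \<le> indicat_real \<Omega> x *\<^sub>R f x"
        using psd
      proof eventually_elim
        case (elim x)
        show ?case
        \<comment> \<open>The sets \<open>K j\<close> are disjoint, so at most one summand survives;
          off them the integrand is nonnegative because both the matrix and the Hessian are.\<close>
        proof (cases "\<exists>j\<in>J. x \<in> K j")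
          case True
          then obtain j where j: "j \<in> J" "x \<in> K j" by blast
          have "x \<notin> K i" if "i \<in> J" "i \<noteq> j" for i
            using disjoint_family_onD[OF E(3) that(1) j(1) that(2)] KU(2)[OF that(1)] KU(2)[OF j(1)] j(2) by blast
          then have "(\<Sum>i\<in>J. (n * c i - e) * indicat_real (K i) x) = (\<Sum>i\<in>J. if i = j then n * c j - e else 0)"
            using j by (intro sum.cong) auto
          also have "\<dots> = n * c j - e" using J j by simp
          also have "\<dots> \<le> f x" by (rule fK[OF j])
          finally show ?thesis using j KU(2)[OF j(1)] E(2)[OF j(1)] by (auto simp: indicator_def)
        next
          case False
          then have "(\<Sum>j\<in>J. (n * c j - e) * indicat_real (K j) x) = 0" by (intro sum.neutral) auto
          moreover have "0 \<le> f x" if "x \<in> \<Omega>"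
            unfolding f_def using elim that W(3) by (intro mat_inner_psd_nonneg) (auto simp: hess_form_eq[symmetric])
          ultimately show ?thesis by (simp add: indicator_def)
        qed
      qed
    qed
    also have "\<dots> \<le> R * G" unfolding f_def by (rule key[OF W(1) R0 W(2)])
    finally have "(\<Sum>j\<in>J. (n * c j - e) * measure lebesgue (K j)) \<le> R * G" .
    moreover have "(\<Sum>j\<in>J. n * c j * (measure lebesgue (E j) - e) - e * measure lebesgue (E j))
       \<le> (\<Sum>j\<in>J. (n * c j - e) * measure lebesgue (K j))"
    proof (rule sum_mono)
      fix j assume j: "j \<in> J"
      have "n * c j * (measure lebesgue (E j) - e) \<le> n * c j * measure lebesgue (K j)"
        using KU(3)[OF j] c[OF j] n by (intro mult_left_mono) auto
      moreover have "measure lebesgue (K j) \<le> measure lebesgue (E j)"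
      proof (rule measure_mono_fmeasurable[OF KU(2)[OF j]])
        show "K j \<in> sets lebesgue" using mK[OF j] by (rule fmeasurableD)
        show "E j \<in> lmeasurable"
          using E(1,2)[OF j] \<Omega>(2) by (meson bounded_set_imp_lmeasurable bounded_subset)
      qed
      then have "e * measure lebesgue (K j) \<le> e * measure lebesgue (E j)" using e by (intro mult_left_mono) auto
      ultimately show "n * c j * (measure lebesgue (E j) - e) - e * measure lebesgue (E j)
          \<le> (n * c j - e) * measure lebesgue (K j)" by (simp add: left_diff_distrib)
    qed
    moreover have "(\<Sum>j\<in>J. n * c j * (measure lebesgue (E j) - e) - e * measure lebesgue (E j)) = n * S - e * (n * C + T)"
      by (simp add: S C_def T_def sum_subtractf sum_distrib_left sum.distrib algebra_simps)
    ultimately show ?thesis by (simp add: R_def)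
  qed
  \<comment> \<open>The error parameter runs through \<open>1 / (k + 1)\<close>; both sides of
    \<open>step\<close> depend continuously on it.\<close>
  have lim: "(\<lambda>k. 1 / real (Suc k)) \<longlonglongrightarrow> 0" by (rule LIMSEQ_Suc[OF lim_1_over_n])
  have "(\<lambda>k. n * S - (1 / real (Suc k)) * (n * C + T)) \<longlonglongrightarrow> n * S - 0 * (n * C + T)"
    by (intro tendsto_intros lim)
  moreover have "(\<lambda>k. root CARD('n) ((S + (1 / real (Suc k)) * C) / \<omega>) * G) \<longlonglongrightarrow> root CARD('n) ((S + 0 * C) / \<omega>) * G"
    using \<omega> by (intro tendsto_intros lim) auto
  ultimately have "n * S - 0 * (n * C + T) \<le> root CARD('n) ((S + 0 * C) / \<omega>) * G"
    by (rule LIMSEQ_le) (intro exI[of _ 0] allI impI step, simp)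
  then show ?thesis by (simp add: \<omega>_def)
qed

text \<open>Cancelling \<open>S powr (1 / n)\<close> leaves a bound on
  \<open>S powr ((n - 1) / n)\<close>, and the power \<open>n / (n - 1)\<close> returns to
  \<open>S\<close>. Cancellation presupposes a finite \<open>S\<close>, which is why it is applied
  to finite sums and not to the integral. The constant decreases in \<open>\<sigma>\<close>, so an
  upper bound for \<open>\<sigma>\<close> is enough.\<close>

lemma isoperimetric_solve:
  fixes S G n \<omega> \<sigma> :: real
  assumes N: "n = real N" "1 < n" and S: "0 \<le> S" and G: "0 \<le> G" and \<omega>: "0 < \<omega>" and \<sigma>: "0 < \<sigma>" "\<sigma> \<le> n * \<omega>"
    and le: "n * S \<le> root N (S / \<omega>) * G"
  shows "S \<le> 1 / (n * \<sigma> powr (1 / (n - 1))) * G powr (n / (n - 1))"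
proof (cases "S = 0")
  case True
  then show ?thesis using N by simp
next
  case False
  then have S: "0 < S" using S by simp
  define p where "p = n / (n - 1)"
  have p: "0 < p" using N by (simp add: p_def)
  define a where "a = S powr ((n - 1) / n)"
  define b where "b = S powr (1 / n)"
  have b: "0 < b" using S by (simp add: b_def)
  have Sba: "S = b * a"
  proof -
    have "b * a = S powr (1 / n + (n - 1) / n)" by (simp add: a_def b_def powr_add)
    also have "1 / n + (n - 1) / n = 1" using N by (simp add: field_simps)
    finally show ?thesis using S by simp
  qed
  have "root N (S / \<omega>) = (S / \<omega>) powr (1 / n)"
    using N S \<omega> by (subst root_powr_inverse) auto
  also have "\<dots> = b / \<omega> powr (1 / n)" using S \<omega> by (simp add: b_def powr_divide)
  finally have "n * (b * a) \<le> b / \<omega> powr (1 / n) * G" using le Sba by simp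
  then have "b * (n * a) \<le> b * (G / \<omega> powr (1 / n))" by (simp add: mult_ac)
  then have "n * a \<le> G / \<omega> powr (1 / n)" using b by (rule mult_left_le_imp_le)
  then have le1: "n * \<omega> powr (1 / n) * a \<le> G" using \<omega> by (simp add: pos_le_divide_eq mult_ac)
  have "(n * \<omega> powr (1 / n) * a) powr p \<le> G powr p"
    using le1 p N by (intro powr_mono2) (auto simp: a_def)
  also have "(n * \<omega> powr (1 / n) * a) powr p = n powr p * \<omega> powr (1 / n * p) * a powr p"
    using N by (simp add: powr_mult powr_powr a_def)
  also have "a powr p = S"
    using N S by (simp add: a_def p_def powr_powr)
  also have "1 / n * p = 1 / (n - 1)" using N by (simp add: p_def)
  \<comment> \<open>Splitting off one factor \<open>n\<close> leaves
    \<open>n powr (1 / (n - 1))\<close>, which joins the power of \<open>\<omega>\<close> to form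
    \<open>n * \<omega>\<close>, the quantity to be compared with \<open>\<sigma>\<close>.\<close>
  also have "n powr p = n * n powr (1 / (n - 1))"
  proof -
    have "p = 1 + 1 / (n - 1)" using N by (simp add: p_def field_simps)
    then show ?thesis using N by (simp add: powr_add)
  qed
  finally have "n * (n powr (1 / (n - 1)) * \<omega> powr (1 / (n - 1))) * S \<le> G powr p" by (simp add: mult_ac)
  then have le2: "n * (n * \<omega>) powr (1 / (n - 1)) * S \<le> G powr p"
    using N \<omega> by (simp add: powr_mult)
  have "\<sigma> powr (1 / (n - 1)) \<le> (n * \<omega>) powr (1 / (n - 1))"
    using \<sigma> N by (intro powr_mono2) auto
  then have "n * \<sigma> powr (1 / (n - 1)) * S \<le> n * (n * \<omega>) powr (1 / (n - 1)) * S"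
    using N S by (intro mult_right_mono mult_left_mono) auto
  then have "n * \<sigma> powr (1 / (n - 1)) * S \<le> G powr p" using le2 by linarith
  moreover have "0 < n * \<sigma> powr (1 / (n - 1))" using N \<sigma> by simp
  ultimately show ?thesis by (simp add: p_def pos_le_divide_eq mult_ac)
qed

text \<open>A countable dense set of factors yields measurable disjoint pieces \<open>E k\<close>,
  on each of which a single Gram matrix lies below \<open>A\<close> and has at least
  \<open>(1 - \<theta>)\<close> times its determinant. Finite unions of pieces all obey the same
  bound \<open>B\<close>, so it passes to the infinite sum; \<open>\<theta>\<close> costs the factor
  \<open>\<kappa>\<close>.\<close>

lemma det_integral_estimate_aux:
  fixes A :: "real^'n \<Rightarrow> real^'n^'n"
  defines "n \<equiv> real CARD('n)"
  assumes n2: "CARD('n) \<ge> 2" and \<Omega>: "open \<Omega>" "bounded \<Omega>"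
    and mA: "A \<in> borel_measurable lebesgue"
    and A: "\<And>i j. set_integrable lebesgue \<Omega> (\<lambda>x. A x $ i $ j)"
    and psd: "AE x in lebesgue. x \<in> \<Omega> \<longrightarrow> psd_mat (A x)"
    and key: "\<And>W R. smooth W \<Longrightarrow> 0 \<le> R \<Longrightarrow> (\<And>x. norm (grad W x) \<le> R) \<Longrightarrow>
       (LINT x:\<Omega>|lebesgue. mat_inner (A x) (hess_mat W x)) \<le> R * G"
    and G: "0 \<le> G" and \<sigma>: "0 < \<sigma>" "\<sigma> \<le> n * unit_ball_vol n" and \<theta>: "0 < \<theta>" "\<theta> < 1"
  defines "B \<equiv> 1 / (n * \<sigma> powr (1 / (n - 1))) * G powr (n / (n - 1))"
  shows "(\<integral>\<^sup>+ x. ennreal (indicator \<Omega> x * det (A x) powr (1 / (n - 1))) \<partial>lebesgue)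
     \<le> ennreal ((1 / (1 - \<theta>)) powr (1 / (n - 1)) * B)"
proof -
  have n: "1 < n" using n2 by (simp add: n_def)
  define q where "q = 1 / (n - 1)"
  have q: "0 < q" using n by (simp add: q_def)
  define \<kappa> where "\<kappa> = (1 / (1 - \<theta>)) powr q"
  have \<kappa>: "0 \<le> \<kappa>" by (simp add: \<kappa>_def)
  obtain D :: "(real^'n^'n) set" where D: "countable D" "\<And>X. open X \<Longrightarrow> X \<noteq> {} \<Longrightarrow> \<exists>d\<in>D. d \<in> X"
    using countable_dense_exists by blast
  have "D \<noteq> {}" using D(2)[of UNIV] by auto
  define L where "L k = from_nat_into D k" for k
  define H where "H k = {x \<in> \<Omega>. det (L k) \<noteq> 0 \<and> psd_mat (A x - L k ** transpose (L k)) \<and>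
     (1 - \<theta>) * det (A x) \<le> (det (L k))\<^sup>2 \<and> (det (L k))\<^sup>2 \<le> det (A x)}" for k
  have [measurable]: "A \<in> borel_measurable lebesgue" by (rule mA)
  have mdet: "(\<lambda>x. det (A x)) \<in> borel_measurable lebesgue"
    by (rule borel_measurable_continuous_on[OF continuous_on_det mA])
  have mH: "H k \<in> sets lebesgue" for k
  proof -
    have "{M :: real^'n^'n. psd_mat M} \<in> sets borel" by (rule borel_closed[OF closed_psd_mat])
    moreover have "(\<lambda>x. A x - L k ** transpose (L k)) \<in> borel_measurable lebesgue"
      by (intro borel_measurable_diff mA borel_measurable_const)
    ultimately have p: "(\<lambda>x. A x - L k ** transpose (L k)) -` {M. psd_mat M} \<inter> space lebesgue \<in> sets lebesgue"
      by (rule measurable_sets[rotated])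
    have 1: "{x \<in> space lebesgue. (1 - \<theta>) * det (A x) \<le> (det (L k))\<^sup>2} \<in> sets lebesgue"
      using mdet by measurable
    have 2: "{x \<in> space lebesgue. (det (L k))\<^sup>2 \<le> det (A x)} \<in> sets lebesgue"
      using mdet by measurable
    have "H k = (if det (L k) = 0 then {} else \<Omega> \<inter> ((\<lambda>x. A x - L k ** transpose (L k)) -` {M. psd_mat M} \<inter> space lebesgue)
       \<inter> {x \<in> space lebesgue. (1 - \<theta>) * det (A x) \<le> (det (L k))\<^sup>2} \<inter> {x \<in> space lebesgue. (det (L k))\<^sup>2 \<le> det (A x)})"
      by (auto simp: H_def)
    then show ?thesis using p 1 2 \<Omega>(1) by (simp add: sets.Int)
  qed
  define E where "E = disjointed H"
  have mE: "E k \<in> sets lebesgue" for k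
    using sets.range_disjointed_sets[of H lebesgue] mH by (auto simp: E_def)
  have EH: "E k \<subseteq> H k" for k by (simp add: E_def disjointed_subset)
  have E\<Omega>: "E k \<subseteq> \<Omega>" for k using EH[of k] by (auto simp: H_def)
  have fE: "E k \<in> lmeasurable" for k
    using mE E\<Omega> \<Omega>(2) by (meson bounded_set_imp_lmeasurable bounded_subset)
  define c where "c k = ((det (L k))\<^sup>2) powr q" for k
  have c0: "0 \<le> c k" for k by (simp add: c_def)
  have partial: "(\<Sum>k<m. c k * measure lebesgue (E k)) \<le> B" for m
  proof -
    \<comment> \<open>Singular \<open>L k\<close> are dropped; their weight \<open>0 powr q\<close>
      is 0, so the sum does not change.\<close>
    define J where "J = {k. k < m \<and> det (L k) \<noteq> 0}"
    have J: "finite J" by (simp add: J_def)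
    define S where "S = (\<Sum>k\<in>J. ((det (L k))\<^sup>2) powr (1 / (n - 1)) * measure lebesgue (E k))"
    have "n * S \<le> root CARD('n) (S / unit_ball_vol n) * G"
      unfolding S_def n_def
    proof (rule finite_family_estimate[OF n2 \<Omega> A psd key J])
      show "disjoint_family_on E J"
        using disjoint_family_disjointed[of H] by (auto simp: E_def disjoint_family_on_def)
      show "psd_mat (A x - L j ** transpose (L j))" if "x \<in> E j" for j x
        using that EH[of j] by (auto simp: H_def)
    qed (use mE E\<Omega> G in \<open>auto simp: J_def\<close>)
    moreover have "0 \<le> S" unfolding S_def by (intro sum_nonneg) simp
    ultimately have "S \<le> B"
      unfolding B_def using n \<sigma> G by (intro isoperimetric_solve[where N = "CARD('n)" and \<omega> = "unit_ball_vol n"]) (auto simp: n_def)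
    moreover have "(\<Sum>k<m. c k * measure lebesgue (E k)) = S"
      unfolding S_def by (intro sum.mono_neutral_cong_right) (auto simp: J_def c_def q_def)
    ultimately show ?thesis by simp
  qed
  have pointwise: "AE x in lebesgue. ennreal (indicator \<Omega> x * det (A x) powr (1 / (n - 1)))
     \<le> (\<Sum>k. ennreal (\<kappa> * c k) * indicator (E k) x)"
    using psd
  proof eventually_elim
    case (elim x)
    show ?case
    \<comment> \<open>Where the determinant vanishes the integrand is a power of 0, which is 0, and
      no approximating factor has to exist.\<close>
    proof (cases "x \<in> \<Omega> \<and> det (A x) \<noteq> 0")
      case False
      then have "indicator \<Omega> x * det (A x) powr (1 / (n - 1)) = 0" by (auto simp: indicator_def)
      then show ?thesis by (simp only: ennreal_0) simp
    next
      case True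
      then have "psd_mat (A x)" using elim by simp
      then obtain M where M: "M \<in> D" "det M \<noteq> 0" "psd_mat (A x - M ** transpose M)"
        "(1 - \<theta>) * det (A x) \<le> (det M)\<^sup>2" "(det M)\<^sup>2 \<le> det (A x)"
        using gram_approximation[OF _ conjunct2[OF True] \<theta> D(2)] by blast
      obtain k where "M = L k" using from_nat_into_surj[OF D(1) M(1)] by (auto simp: L_def)
      then have "x \<in> H k" using M True by (simp add: H_def)
      then have "x \<in> (\<Union>k. E k)" unfolding E_def UN_disjointed_eq by blast
      then obtain i where i: "x \<in> E i" by blast
      then have Hi: "x \<in> H i" using EH by blast
      have "0 < (det (L i))\<^sup>2" using Hi by (simp add: H_def)
      moreover have "(det (L i))\<^sup>2 \<le> det (A x)" using Hi by (simp add: H_def)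
      ultimately have d0: "0 < det (A x)" by linarith
      have "det (A x) \<le> (1 / (1 - \<theta>)) * (det (L i))\<^sup>2"
        using Hi \<theta> by (simp add: H_def pos_le_divide_eq mult.commute)
      then have "det (A x) powr q \<le> ((1 / (1 - \<theta>)) * (det (L i))\<^sup>2) powr q"
        using d0 q by (intro powr_mono2) auto
      also have "\<dots> = \<kappa> * c i" using \<theta> by (simp only: \<kappa>_def c_def powr_mult)
      finally have "ennreal (indicator \<Omega> x * det (A x) powr (1 / (n - 1))) \<le> ennreal (\<kappa> * c i) * indicator (E i) x"
        using True i by (simp add: q_def ennreal_leI)
      also have "\<dots> \<le> (\<Sum>k. ennreal (\<kappa> * c k) * indicator (E k) x)"
      proof -
        have "t i \<le> suminf t" for t :: "nat \<Rightarrow> ennreal"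
          using sum_le_suminf[OF summableI, of "{i}" t] by simp
        then show ?thesis .
      qed
      finally show ?thesis .
    qed
  qed
  have "(\<integral>\<^sup>+ x. ennreal (indicator \<Omega> x * det (A x) powr (1 / (n - 1))) \<partial>lebesgue)
     \<le> (\<integral>\<^sup>+ x. (\<Sum>k. ennreal (\<kappa> * c k) * indicator (E k) x) \<partial>lebesgue)"
    by (rule nn_integral_mono_AE[OF pointwise])
  also have "\<dots> = (\<Sum>k. \<integral>\<^sup>+ x. ennreal (\<kappa> * c k) * indicator (E k) x \<partial>lebesgue)"
    using mE by (intro nn_integral_suminf) auto
  also have "\<dots> = (\<Sum>k. ennreal (\<kappa> * (c k * measure lebesgue (E k))))"
  proof (rule suminf_cong)
    fix k
    have "(\<integral>\<^sup>+ x. ennreal (\<kappa> * c k) * indicator (E k) x \<partial>lebesgue) = ennreal (\<kappa> * c k) * emeasure lebesgue (E k)"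
      using mE by (rule nn_integral_cmult_indicator)
    also have "emeasure lebesgue (E k) = ennreal (measure lebesgue (E k))"
      using fE by (simp add: emeasure_eq_measure2)
    finally show "(\<integral>\<^sup>+ x. ennreal (\<kappa> * c k) * indicator (E k) x \<partial>lebesgue)
        = ennreal (\<kappa> * (c k * measure lebesgue (E k)))"
      using \<kappa> c0 by (simp add: ennreal_mult[symmetric] mult.assoc)
  qed
  also have "\<dots> \<le> ennreal (\<kappa> * B)"
  proof (rule suminf_le_const[OF summableI])
    fix m
    have "(\<Sum>k<m. ennreal (\<kappa> * (c k * measure lebesgue (E k)))) = ennreal (\<Sum>k<m. \<kappa> * (c k * measure lebesgue (E k)))"
      using \<kappa> c0 by (intro sum_ennreal) simp
    also have "\<dots> \<le> ennreal (\<kappa> * B)"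
      unfolding sum_distrib_left[symmetric] using partial[of m] \<kappa> by (intro ennreal_leI mult_left_mono)
    finally show "(\<Sum>k<m. ennreal (\<kappa> * (c k * measure lebesgue (E k)))) \<le> ennreal (\<kappa> * B)" .
  qed
  finally show ?thesis by (simp add: \<kappa>_def q_def)
qed

lemma det_integral_estimate:
  fixes A :: "real^'n \<Rightarrow> real^'n^'n"
  defines "n \<equiv> real CARD('n)"
  assumes n2: "CARD('n) \<ge> 2" and \<Omega>: "open \<Omega>" "bounded \<Omega>"
    and mA: "A \<in> borel_measurable lebesgue"
    and A: "\<And>i j. set_integrable lebesgue \<Omega> (\<lambda>x. A x $ i $ j)"
    and psd: "AE x in lebesgue. x \<in> \<Omega> \<longrightarrow> psd_mat (A x)"
    and key: "\<And>W R. smooth W \<Longrightarrow> 0 \<le> R \<Longrightarrow> (\<And>x. norm (grad W x) \<le> R) \<Longrightarrow>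
       (LINT x:\<Omega>|lebesgue. mat_inner (A x) (hess_mat W x)) \<le> R * G"
    and G: "0 \<le> G" and \<sigma>: "0 < \<sigma>" "\<sigma> \<le> n * unit_ball_vol n"
  shows "(\<integral>\<^sup>+ x. ennreal (indicator \<Omega> x * det (A x) powr (1 / (n - 1))) \<partial>lebesgue)
     \<le> ennreal (1 / (n * \<sigma> powr (1 / (n - 1))) * G powr (n / (n - 1)))"
proof (rule LIMSEQ_le_const)
  let ?B = "1 / (n * \<sigma> powr (1 / (n - 1))) * G powr (n / (n - 1))"
  define \<theta> where "\<theta> k = 1 / real (Suc (Suc k))" for k
  have \<theta>: "0 < \<theta> k" "\<theta> k < 1" for k by (auto simp: \<theta>_def)
  have "\<theta> \<longlonglongrightarrow> 0" unfolding \<theta>_def[abs_def] by (rule LIMSEQ_Suc[OF LIMSEQ_Suc[OF lim_1_over_n]])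
  then have "(\<lambda>k. (1 / (1 - \<theta> k)) powr (1 / (n - 1)) * ?B) \<longlonglongrightarrow> (1 / (1 - 0)) powr (1 / (n - 1)) * ?B"
    by (intro tendsto_intros) auto
  then show "(\<lambda>k. ennreal ((1 / (1 - \<theta> k)) powr (1 / (n - 1)) * ?B)) \<longlonglongrightarrow> ennreal ?B"
    by (intro tendsto_ennrealI) simp
  show "\<exists>N. \<forall>k\<ge>N. (\<integral>\<^sup>+ x. ennreal (indicator \<Omega> x * det (A x) powr (1 / (n - 1))) \<partial>lebesgue)
      \<le> ennreal ((1 / (1 - \<theta> k)) powr (1 / (n - 1)) * ?B)"
    unfolding n_def using \<sigma>
    by (intro exI[of _ 0] allI impI det_integral_estimate_aux[OF n2 \<Omega> mA A psd key G] \<theta>) (auto simp: n_def)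
qed

section \<open>Hausdorff measure\<close>

text \<open>The value \<open>\<infinity>\<close> for unbounded or too large sets absorbs the side
  conditions of \<open>hausdorff_pre\<close>, which thereby becomes the outer measure generated by a
  set function on all subsets.\<close>

definition hausdorff_cost :: "real \<Rightarrow> real \<Rightarrow> 'a::metric_space set \<Rightarrow> ennreal" where
  "hausdorff_cost s \<delta> C = (if bounded C \<and> diameter C \<le> \<delta>
     then ennreal (unit_ball_vol s * (diameter C / 2) powr s) else \<infinity>)"

lemma hausdorff_cost_mono:
  assumes "0 < s" "C \<subseteq> D" shows "hausdorff_cost s \<delta> C \<le> hausdorff_cost s \<delta> D"
proof (cases "bounded D \<and> diameter D \<le> \<delta>")
  case True
  have le: "diameter C \<le> diameter D" by (rule diameter_subset) (use True assms in auto)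
  have b: "bounded C" using True assms bounded_subset by blast
  have "unit_ball_vol s * (diameter C / 2) powr s \<le> unit_ball_vol s * (diameter D / 2) powr s"
    using le assms diameter_ge_0[OF b] by (intro mult_left_mono powr_mono2) auto
  then show ?thesis using True le b by (simp add: hausdorff_cost_def ennreal_leI)
next
  case False
  then have "hausdorff_cost s \<delta> D = \<infinity>" unfolding hausdorff_cost_def by (rule if_not_P)
  then show ?thesis by simp
qed

lemma hausdorff_pre_le:
  assumes "E \<subseteq> (\<Union>i::nat. C i)" shows "hausdorff_pre s \<delta> E \<le> (\<Sum>i. hausdorff_cost s \<delta> (C i))"
proof (cases "\<forall>i. bounded (C i) \<and> diameter (C i) \<le> \<delta>")
  case True
  then have "hausdorff_pre s \<delta> E \<le> (\<Sum>i. ennreal (unit_ball_vol s * (diameter (C i) / 2) powr s))"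
    unfolding hausdorff_pre_def using assms by (intro INF_lower) auto
  then show ?thesis using True by (simp add: hausdorff_cost_def)
next
  case False
  then obtain i where "\<not> (bounded (C i) \<and> diameter (C i) \<le> \<delta>)" by blast
  then have i: "hausdorff_cost s \<delta> (C i) = \<infinity>" unfolding hausdorff_cost_def by (rule if_not_P)
  have "hausdorff_cost s \<delta> (C i) \<le> (\<Sum>i. hausdorff_cost s \<delta> (C i))"
    using sum_le_suminf[OF summableI, of "{i}" "\<lambda>i. hausdorff_cost s \<delta> (C i)"] by simp
  then show ?thesis using i by (simp add: top_unique)
qed

text \<open>\<open>outer_measure\<close> uses covers by disjoint sets. Making a cover disjoint only
  shrinks its members, and the cost is monotone, so the infimum is the same.\<close>

lemma hausdorff_pre_eq_outer_measure:
  assumes "0 < s"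
  shows "hausdorff_pre s \<delta> = outer_measure (Pow (UNIV :: 'a::metric_space set)) (hausdorff_cost s \<delta>)"
proof
  fix E :: "'a set"
  show "hausdorff_pre s \<delta> E = outer_measure (Pow UNIV) (hausdorff_cost s \<delta>) E"
  proof (rule antisym)
    show "hausdorff_pre s \<delta> E \<le> outer_measure (Pow UNIV) (hausdorff_cost s \<delta>) E"
      unfolding outer_measure_def by (rule INF_greatest) (auto intro: hausdorff_pre_le)
    show "outer_measure (Pow UNIV) (hausdorff_cost s \<delta>) E \<le> hausdorff_pre s \<delta> E"
      unfolding hausdorff_pre_def
    proof (rule INF_greatest)
      fix C :: "nat \<Rightarrow> 'a set" assume C: "C \<in> {C. E \<subseteq> (\<Union>i. C i) \<and> (\<forall>i. bounded (C i) \<and> diameter (C i) \<le> \<delta>)}"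
      have "outer_measure (Pow UNIV) (hausdorff_cost s \<delta>) E \<le> (\<Sum>i. hausdorff_cost s \<delta> (disjointed C i))"
        unfolding outer_measure_def using C
        by (intro INF_lower) (auto simp: disjoint_family_disjointed UN_disjointed_eq)
      also have "\<dots> \<le> (\<Sum>i. hausdorff_cost s \<delta> (C i))"
        by (intro suminf_le summableI hausdorff_cost_mono assms disjointed_subset)
      also have "\<dots> = (\<Sum>i. ennreal (unit_ball_vol s * (diameter (C i) / 2) powr s))"
        using C by (simp add: hausdorff_cost_def)
      finally show "outer_measure (Pow UNIV) (hausdorff_cost s \<delta>) E \<le> \<dots>" .
    qed
  qed
qed

lemma hausdorff_pre_outer_measure_space:
  assumes "0 < s" "0 \<le> \<delta>"
  shows "outer_measure_space (Pow (UNIV :: 'a::metric_space set)) (hausdorff_pre s \<delta>)"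
proof -
  interpret ring_of_sets "UNIV :: 'a set" "Pow UNIV" by (rule ring_of_sets_Pow)
  have "positive (Pow (UNIV :: 'a set)) (hausdorff_cost s \<delta>)"
    using assms by (simp add: positive_def hausdorff_cost_def)
  moreover have "increasing (Pow (UNIV :: 'a set)) (hausdorff_cost s \<delta>)"
    using hausdorff_cost_mono[OF assms(1)] by (auto simp: increasing_def)
  ultimately show ?thesis
    unfolding hausdorff_pre_eq_outer_measure[OF assms(1)] by (rule outer_measure_space_outer_measure)
qed

lemma hausdorff_pre_antimono:
  assumes "\<delta> \<le> \<delta>'" shows "hausdorff_pre s \<delta>' E \<le> hausdorff_pre s \<delta> E"
  unfolding hausdorff_pre_def using assms by (intro INF_superset_mono) (auto intro: order_trans)

lemma hausdorff_pre_le_outer: "0 < \<delta> \<Longrightarrow> hausdorff_pre s \<delta> E \<le> hausdorff_outer s E"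
  unfolding hausdorff_outer_def by (rule SUP_upper) simp

lemma hausdorff_outer_measure_space:
  assumes s: "0 < s"
  shows "outer_measure_space (Pow (UNIV :: 'a::metric_space set)) (hausdorff_outer s)"
  unfolding outer_measure_space_def
proof (intro conjI)
  note pre = hausdorff_pre_outer_measure_space[OF s, unfolded outer_measure_space_def, where 'a = 'a]
  have "hausdorff_pre s \<delta> ({} :: 'a set) = 0" if "0 < \<delta>" for \<delta>
    using pre[of \<delta>] that by (simp add: positive_def)
  then have "hausdorff_outer s ({} :: 'a set) = (SUP \<delta>\<in>{0::real<..}. 0)"
    unfolding hausdorff_outer_def by (intro SUP_cong) auto
  then show "positive (Pow (UNIV :: 'a set)) (hausdorff_outer s)"
    by (simp add: positive_def)
  show "increasing (Pow (UNIV :: 'a set)) (hausdorff_outer s)"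
    unfolding increasing_def hausdorff_outer_def
  proof (intro ballI impI SUP_mono)
    fix x y :: "'a set" and \<delta> :: real assume "x \<subseteq> y" "\<delta> \<in> {0<..}"
    then show "\<exists>m\<in>{0<..}. hausdorff_pre s \<delta> x \<le> hausdorff_pre s m y"
      using pre[of \<delta>] by (intro bexI[of _ \<delta>]) (auto simp: increasing_def)
  qed
  show "countably_subadditive (Pow (UNIV :: 'a set)) (hausdorff_outer s)"
    unfolding countably_subadditive_def
  proof (intro allI impI)
    fix A :: "nat \<Rightarrow> 'a set" assume A: "range A \<subseteq> Pow UNIV" "disjoint_family A"
    show "hausdorff_outer s (\<Union>i. A i) \<le> (\<Sum>i. hausdorff_outer s (A i))"
      unfolding hausdorff_outer_def[of s "\<Union>i. A i"]
    proof (rule SUP_least)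
      fix \<delta> :: real assume \<delta>: "\<delta> \<in> {0<..}"
      have "hausdorff_pre s \<delta> (\<Union>i. A i) \<le> (\<Sum>i. hausdorff_pre s \<delta> (A i))"
        using pre[of \<delta>] A \<delta> by (auto simp: countably_subadditive_def)
      also have "\<dots> \<le> (\<Sum>i. hausdorff_outer s (A i))"
        using \<delta> by (intro suminf_le summableI hausdorff_pre_le_outer) auto
      finally show "hausdorff_pre s \<delta> (\<Union>i. A i) \<le> (\<Sum>i. hausdorff_outer s (A i))" .
    qed
  qed
qed

lemma hausdorff_outer_mono:
  fixes E F :: "'a::metric_space set"
  shows "0 < s \<Longrightarrow> E \<subseteq> F \<Longrightarrow> hausdorff_outer s E \<le> hausdorff_outer s F"
  using hausdorff_outer_measure_space[of s, where 'a = 'a] by (simp add: outer_measure_space_def increasing_def)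

lemma hausdorff_outer_empty: "0 < s \<Longrightarrow> hausdorff_outer s ({} :: 'a::metric_space set) = 0"
  using hausdorff_outer_measure_space[of s, where 'a = 'a] by (simp add: outer_measure_space_def positive_def)

lemma outer_measure_space_Un:
  assumes f: "outer_measure_space (Pow (UNIV :: 'a set)) f"
  shows "f (A \<union> B) \<le> f A + f B"
proof -
  interpret ring_of_sets "UNIV :: 'a set" "Pow UNIV" by (rule ring_of_sets_Pow)
  have "subadditive (Pow (UNIV :: 'a set)) f"
    using f by (intro countably_subadditive_subadditive) (auto simp: outer_measure_space_def)
  then have "f (A \<union> (B - A)) \<le> f A + f (B - A)"
    by (rule subadditiveD) auto
  also have "\<dots> \<le> f A + f B"
    using f by (intro add_left_mono) (auto simp: outer_measure_space_def increasing_def)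
  finally show ?thesis by simp
qed

lemma outer_measure_space_UN:
  fixes A :: "nat \<Rightarrow> 'a set"
  assumes f: "outer_measure_space (Pow UNIV) f"
  shows "f (\<Union>i. A i) \<le> (\<Sum>i. f (A i))"
proof -
  have "f (\<Union>i. disjointed A i) \<le> (\<Sum>i. f (disjointed A i))"
    using f disjoint_family_disjointed[of A]
    by (auto simp: outer_measure_space_def countably_subadditive_def)
  also have "\<dots> \<le> (\<Sum>i. f (A i))"
    using f disjointed_subset[of A]
    by (intro suminf_le summableI) (auto simp: outer_measure_space_def increasing_def)
  finally show ?thesis by (simp add: UN_disjointed_eq)
qed

lemmas hausdorff_outer_Un = outer_measure_space_Un[OF hausdorff_outer_measure_space]
lemmas hausdorff_outer_UN = outer_measure_space_UN[OF hausdorff_outer_measure_space]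

text \<open>In a cover by sets of diameter below \<open>\<eta>\<close> no member meets both
  \<open>A\<close> and \<open>B\<close>, so it splits into a cover of each.\<close>

lemma hausdorff_outer_metric:
  fixes A B :: "'a::metric_space set"
  assumes s: "0 < s" and \<eta>: "0 < \<eta>" and sep: "\<And>x y. x \<in> A \<Longrightarrow> y \<in> B \<Longrightarrow> \<eta> \<le> dist x y"
  shows "hausdorff_outer s A + hausdorff_outer s B \<le> hausdorff_outer s (A \<union> B)"
proof -
  have small: "hausdorff_pre s \<delta> A + hausdorff_pre s \<delta> B \<le> hausdorff_pre s \<delta> (A \<union> B)"
    if \<delta>: "0 < \<delta>" "\<delta> < \<eta>" for \<delta>
    unfolding hausdorff_pre_def[of s \<delta> "A \<union> B"]
  proof (rule INF_greatest)
    fix C :: "nat \<Rightarrow> 'a set"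
    assume C: "C \<in> {C. A \<union> B \<subseteq> (\<Union>i. C i) \<and> (\<forall>i. bounded (C i) \<and> diameter (C i) \<le> \<delta>)}"
    define CA where "CA i = (if C i \<inter> A = {} then {} else C i)" for i
    define CB where "CB i = (if C i \<inter> B = {} then {} else C i)" for i
    have z: "hausdorff_cost s \<delta> ({} :: 'a set) = 0" using \<delta> s by (simp add: hausdorff_cost_def)
    have "hausdorff_cost s \<delta> (CA i) + hausdorff_cost s \<delta> (CB i) \<le> hausdorff_cost s \<delta> (C i)" for i
    proof -
      have "C i \<inter> A = {} \<or> C i \<inter> B = {}"
      proof (rule ccontr)
        assume "\<not> (C i \<inter> A = {} \<or> C i \<inter> B = {})"
        then obtain x y where xy: "x \<in> C i" "x \<in> A" "y \<in> C i" "y \<in> B" by blast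
        have "dist x y \<le> diameter (C i)" using C xy by (intro diameter_bounded_bound) auto
        also have "\<dots> \<le> \<delta>" using C by auto
        finally show False using sep[OF xy(2,4)] \<delta> by simp
      qed
      then show ?thesis by (auto simp: CA_def CB_def z)
    qed
    then have "(\<Sum>i. hausdorff_cost s \<delta> (CA i) + hausdorff_cost s \<delta> (CB i)) \<le> (\<Sum>i. hausdorff_cost s \<delta> (C i))"
      by (intro suminf_le summableI)
    also have "(\<Sum>i. hausdorff_cost s \<delta> (CA i) + hausdorff_cost s \<delta> (CB i))
       = (\<Sum>i. hausdorff_cost s \<delta> (CA i)) + (\<Sum>i. hausdorff_cost s \<delta> (CB i))"
      by (rule suminf_add[symmetric]) (rule summableI)+
    finally have "(\<Sum>i. hausdorff_cost s \<delta> (CA i)) + (\<Sum>i. hausdorff_cost s \<delta> (CB i))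
       \<le> (\<Sum>i. hausdorff_cost s \<delta> (C i))" .
    moreover have "A \<subseteq> (\<Union>i. CA i)" using C by (fastforce simp: CA_def)
    then have "hausdorff_pre s \<delta> A \<le> (\<Sum>i. hausdorff_cost s \<delta> (CA i))" by (rule hausdorff_pre_le)
    moreover have "B \<subseteq> (\<Union>i. CB i)" using C by (fastforce simp: CB_def)
    then have "hausdorff_pre s \<delta> B \<le> (\<Sum>i. hausdorff_cost s \<delta> (CB i))" by (rule hausdorff_pre_le)
    moreover have "(\<Sum>i. hausdorff_cost s \<delta> (C i)) = (\<Sum>i. ennreal (unit_ball_vol s * (diameter (C i) / 2) powr s))"
      using C by (simp add: hausdorff_cost_def)
    ultimately show "hausdorff_pre s \<delta> A + hausdorff_pre s \<delta> B
       \<le> (\<Sum>i. ennreal (unit_ball_vol s * (diameter (C i) / 2) powr s))"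
      by (metis add_mono order_trans)
  qed
  \<comment> \<open>The two suprema run over independent scales; a common smaller scale reduces them
    to the case just treated.\<close>
  have "hausdorff_pre s \<delta> A + hausdorff_pre s \<delta>' B \<le> hausdorff_outer s (A \<union> B)"
    if "\<delta> \<in> {0<..}" "\<delta>' \<in> {0<..}" for \<delta> \<delta>'
  proof -
    define d where "d = min (min \<delta> \<delta>') (\<eta> / 2)"
    have d: "0 < d" "d < \<eta>" "d \<le> \<delta>" "d \<le> \<delta>'" using that \<eta> by (auto simp: d_def)
    have "hausdorff_pre s \<delta> A + hausdorff_pre s \<delta>' B \<le> hausdorff_pre s d A + hausdorff_pre s d B"
      by (intro add_mono hausdorff_pre_antimono d)
    also have "\<dots> \<le> hausdorff_pre s d (A \<union> B)" by (rule small[OF d(1,2)])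
    also have "\<dots> \<le> hausdorff_outer s (A \<union> B)" by (rule hausdorff_pre_le_outer[OF d(1)])
    finally show ?thesis .
  qed
  then have "hausdorff_pre s \<delta> A + hausdorff_outer s B \<le> hausdorff_outer s (A \<union> B)" if "\<delta> \<in> {0<..}" for \<delta>
    unfolding hausdorff_outer_def[of s B] using that
    by (simp add: ennreal_SUP_add_right SUP_le_iff)
  then show ?thesis
    unfolding hausdorff_outer_def[of s A]
    by (simp add: ennreal_SUP_add_left[symmetric] SUP_le_iff)
qed

section \<open>Measurability of Borel sets for the Hausdorff outer measure\<close>

lemma summable_tail_ennreal:
  fixes f :: "nat \<Rightarrow> ennreal"
  assumes "(\<Sum>k. f k) < \<infinity>" "0 < e"
  obtains n where "(\<Sum>k. f (k + n)) \<le> ennreal e"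
proof -
  have fin: "f k < top" for k
  proof -
    have "f k \<le> (\<Sum>k. f k)" using sum_le_suminf[OF summableI, of "{k}" f] by simp
    then show ?thesis using assms(1) by (simp add: le_less_trans)
  qed
  define g where "g k = enn2real (f k)" for k
  have fg: "f k = ennreal (g k)" for k using fin[of k] by (simp add: g_def)
  have g0: "0 \<le> g k" for k by (simp add: g_def)
  have sg: "summable g"
    by (rule summable_suminf_not_top) (use assms g0 in \<open>auto simp: fg\<close>)
  have "(\<lambda>n. \<Sum>k. g (k + n)) \<longlonglongrightarrow> 0" by (rule suminf_exist_split2[OF sg])
  then have "eventually (\<lambda>n. (\<Sum>k. g (k + n)) < e) sequentially"
    using assms(2) by (rule order_tendstoD)
  then obtain n where n: "(\<Sum>k. g (k + n)) < e" by (auto simp: eventually_sequentially)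
  have "(\<Sum>k. f (k + n)) = ennreal (\<Sum>k. g (k + n))"
    unfolding fg using sg g0 by (intro suminf_ennreal2) (auto simp: summable_iff_shift)
  then show thesis using n by (intro that[of n]) (simp add: ennreal_leI)
qed

text \<open>Caratheodory's criterion: the rings \<open>{1/(k+2) < dist(\<cdot>,F) \<le> 1/(k+1)}\<close> of equal parity are
  pairwise separated, so their outer measures are summable.\<close>

lemma closed_in_hausdorff_lambda_system:
  fixes F :: "'a::metric_space set"
  assumes s: "0 < s" and F: "closed F"
  shows "F \<in> lambda_system UNIV (Pow UNIV) (hausdorff_outer s)"
proof -
  let ?H = "hausdorff_outer s :: 'a set \<Rightarrow> ennreal"
  have "?H (F \<inter> X) + ?H (X - F) \<le> ?H X" for X
  proof (cases "F = {} \<or> ?H X = \<infinity>")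
    case True
    then show ?thesis using hausdorff_outer_empty[OF s, where 'a = 'a] by auto
  next
    case False
    then have ne: "F \<noteq> {}" and fin: "?H X < \<infinity>" by (auto simp: less_top)
    define d where "d x = infdist x F" for x
    have dd: "\<bar>d x - d y\<bar> \<le> dist x y" for x y unfolding d_def by (rule infdist_triangle_abs)
    define Y where "Y n = {x \<in> X. 1 / real (n + 1) < d x}" for n :: nat
    define R where "R k = {x \<in> X. 1 / real (k + 2) < d x \<and> d x \<le> 1 / real (k + 1)}" for k :: nat
    have even: "(\<Sum>k<m. ?H (R (2 * k + p))) \<le> ?H X" if "p \<le> 1" for m p
    proof -
      have "(\<Sum>k<m. ?H (R (2 * k + p))) \<le> ?H (\<Union>k<m. R (2 * k + p))"
      proof (induction m)
        case (Suc m)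
        have "?H (\<Union>k<m. R (2 * k + p)) + ?H (R (2 * m + p)) \<le> ?H ((\<Union>k<m. R (2 * k + p)) \<union> R (2 * m + p))"
        \<comment> \<open>The gap used below involves \<open>1 / (2 * m + p)\<close>, which for
          \<open>m = p = 0\<close> would be \<open>1 / 0 = 0\<close>; with \<open>m = 0\<close>
          there is no earlier ring to separate from.\<close>
        proof (cases "m = 0")
          case True
          then show ?thesis by (simp add: hausdorff_outer_empty[OF s])
        next
          case False
          have pos: "0 < 1 / real (2 * m + p) - 1 / real (2 * m + p + 1)"
          proof -
            have "1 / real (2 * m + p + 1) < 1 / real (2 * m + p)"
              using False by (intro divide_strict_left_mono) auto
            then show ?thesis by simp
          qed
          show ?thesis
          proof (rule hausdorff_outer_metric[OF s pos])
            fix x y assume x: "x \<in> (\<Union>k<m. R (2 * k + p))" and y: "y \<in> R (2 * m + p)"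
            then obtain k where k: "k < m" "x \<in> R (2 * k + p)" by blast
            have "1 / real (2 * m + p) \<le> 1 / real (2 * k + p + 2)"
              using k by (intro divide_left_mono) auto
            then have "1 / real (2 * m + p) < d x" using k by (simp add: R_def add.commute)
            moreover have "d y \<le> 1 / real (2 * m + p + 1)" using y by (simp add: R_def)
            ultimately show "1 / real (2 * m + p) - 1 / real (2 * m + p + 1) \<le> dist x y"
              using dd[of x y] by linarith
          qed
        qed
        also have "(\<Union>k<m. R (2 * k + p)) \<union> R (2 * m + p) = (\<Union>k<Suc m. R (2 * k + p))"
          by (auto simp: less_Suc_eq)
        finally have "?H (\<Union>k<m. R (2 * k + p)) + ?H (R (2 * m + p)) \<le> ?H (\<Union>k<Suc m. R (2 * k + p))" .
        with add_right_mono[OF Suc.IH, of "?H (R (2 * m + p))"] show ?case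
          unfolding sum.lessThan_Suc by (rule order_trans)
      qed simp
      also have "\<dots> \<le> ?H X" by (rule hausdorff_outer_mono[OF s]) (auto simp: R_def)
      finally show ?thesis .
    qed
    have "(\<Sum>k<m. ?H (R k)) \<le> ?H X + ?H X" for m
    proof -
      have "(\<Sum>k<m. ?H (R k)) \<le> (\<Sum>k<2 * m. ?H (R k))" by (rule sum_mono2) auto
      also have "\<dots> = (\<Sum>k<m. ?H (R (2 * k + 0)) + ?H (R (2 * k + 1)))"
        by (induction m) (auto simp: ac_simps)
      also have "\<dots> \<le> ?H X + ?H X"
        unfolding sum.distrib by (intro add_mono even) auto
      finally show ?thesis .
    qed
    then have "(\<Sum>k. ?H (R k)) \<le> ?H X + ?H X" by (intro suminf_le_const summableI)
    also have "\<dots> < \<infinity>" using fin by simp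
    finally have sum_fin: "(\<Sum>k. ?H (R k)) < \<infinity>" .
    show ?thesis
    proof (rule ennreal_le_epsilon)
      fix e :: real assume e: "0 < e"
      obtain n where n: "(\<Sum>k. ?H (R (k + n))) \<le> ennreal e"
        using summable_tail_ennreal[OF sum_fin e] .
      have "X - F \<subseteq> Y n \<union> (\<Union>k. R (k + n))"
      proof
        fix x assume x: "x \<in> X - F"
        then have dx: "0 < d x" unfolding d_def using F ne by (simp add: infdist_pos_not_in_closed)
        show "x \<in> Y n \<union> (\<Union>k. R (k + n))"
        proof (cases "1 / real (n + 1) < d x")
          case True
          then show ?thesis using x by (simp add: Y_def)
        next
          case False
          \<comment> \<open>The first level \<open>1 / (j + 1)\<close> that the distance of
            \<open>x\<close> exceeds. Since \<open>n < j\<close>, the point lies in ring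
            \<open>j - 1\<close>, which belongs to the tail.\<close>
          define j where "j = (LEAST j. 1 / real (j + 1) < d x)"
          obtain i where "1 / real (Suc i) < d x" using nat_approx_posE[OF dx] .
          then have j: "1 / real (j + 1) < d x" unfolding j_def by (intro LeastI) simp
          have jn: "n < j"
          proof (rule ccontr)
            assume "\<not> n < j"
            then have "1 / real (n + 1) \<le> 1 / real (j + 1)" by (intro divide_left_mono) auto
            then show False using False j by simp
          qed
          then obtain k where k: "j = k + n + 1" by (metis less_imp_Suc_add add.commute add_Suc_right Suc_eq_plus1)
          have "\<not> 1 / real (k + n + 1) < d x"
            using not_less_Least[of "k + n" "\<lambda>j. 1 / real (j + 1) < d x"] k unfolding j_def by simp
          then have "x \<in> R (k + n)" using j x by (simp add: R_def k)
          then show ?thesis by blast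
        qed
      qed
      then have "?H (X - F) \<le> ?H (Y n \<union> (\<Union>k. R (k + n)))" by (rule hausdorff_outer_mono[OF s])
      also have "\<dots> \<le> ?H (Y n) + ?H (\<Union>k. R (k + n))" by (rule hausdorff_outer_Un[OF s])
      also have "\<dots> \<le> ?H (Y n) + (\<Sum>k. ?H (R (k + n)))"
        by (intro add_left_mono hausdorff_outer_UN[OF s])
      also have "\<dots> \<le> ?H (Y n) + ennreal e" by (intro add_left_mono n)
      finally have "?H (F \<inter> X) + ?H (X - F) \<le> ?H (F \<inter> X) + (?H (Y n) + ennreal e)"
        by (rule add_left_mono)
      also have "\<dots> = (?H (F \<inter> X) + ?H (Y n)) + ennreal e" by (simp add: add.assoc)
      also have "?H (F \<inter> X) + ?H (Y n) \<le> ?H ((F \<inter> X) \<union> Y n)"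
      proof (rule hausdorff_outer_metric[OF s, of "1 / real (n + 1)"])
        fix x y assume "x \<in> F \<inter> X" "y \<in> Y n"
        then have "d x = 0" "1 / real (n + 1) < d y" by (auto simp: d_def Y_def)
        then show "1 / real (n + 1) \<le> dist x y" using dd[of x y] by linarith
      qed simp
      also have "?H ((F \<inter> X) \<union> Y n) \<le> ?H X" by (rule hausdorff_outer_mono[OF s]) (auto simp: Y_def)
      finally show "?H (F \<inter> X) + ?H (X - F) \<le> ?H X + ennreal e" by (simp add: add_right_mono)
    qed
  qed
  moreover have "?H X \<le> ?H (F \<inter> X) + ?H (X - F)" for X
  proof -
    have "F \<inter> X \<union> (X - F) = X" by blast
    then show ?thesis using hausdorff_outer_Un[OF s, of "F \<inter> X" "X - F"] by (simp only:)
  qed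
  ultimately have "?H (F \<inter> X) + ?H (X - F) = ?H X" for X by (intro antisym)
  moreover have "(UNIV - F) \<inter> X = X - F" for X by blast
  ultimately show ?thesis by (simp add: lambda_system_def)
qed

text \<open>\<open>measure_of\<close> yields the zero measure when its set function is not countably
  additive, so the Hausdorff measure can be evaluated only once the Borel sets are known to be
  measurable in Caratheodory's sense.\<close>

lemma hausdorff_measure_space:
  assumes s: "0 < s"
  shows "measure_space (UNIV :: 'a::metric_space set) (sets borel) (hausdorff_outer s)"
proof -
  let ?L = "lambda_system (UNIV :: 'a set) (Pow UNIV) (hausdorff_outer s)"
  have L: "measure_space UNIV ?L (hausdorff_outer s)"
    by (rule sigma_algebra.caratheodory_lemma[OF sigma_algebra_Pow hausdorff_outer_measure_space[OF s]])
  then have sig: "sigma_algebra UNIV ?L" by (simp add: measure_space_def)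
  have "Collect closed \<subseteq> ?L" using closed_in_hausdorff_lambda_system[OF s] by blast
  then have "sigma_sets UNIV (Collect closed) \<subseteq> ?L"
    by (rule sigma_algebra.sigma_sets_subset[OF sig])
  then have "sets (borel :: 'a measure) \<subseteq> ?L" by (simp add: borel_eq_closed)
  then show ?thesis
    by (intro measure_down[OF L]) (use sets.sigma_algebra_axioms[of "borel :: 'a measure"] in auto)
qed

lemma sets_hausdorff_measure [simp, measurable_cong]: "sets (hausdorff_measure s) = sets borel"
  unfolding hausdorff_measure_def using sets.sets_measure_of_eq[of borel] by simp

lemma emeasure_hausdorff_measure:
  fixes E :: "'a::metric_space set"
  assumes "0 < s" "E \<in> sets borel"
  shows "emeasure (hausdorff_measure s) E = hausdorff_outer s E"
  unfolding hausdorff_measure_def using hausdorff_measure_space[OF assms(1), where 'a = 'a] assms(2)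
  by (intro emeasure_measure_of_sigma) (auto simp: measure_space_def)

section \<open>Area of the unit sphere\<close>

text \<open>Cavalieri's principle for balls: the Beta value is the integral of
  \<open>sqrt (1 - x\<^sup>2) ^ m\<close> over \<open>{-1..1}\<close>.\<close>

lemma unit_ball_vol_recurrence:
  "unit_ball_vol (real m) * Beta (1 / 2) (real m / 2 + 1) = unit_ball_vol (real (Suc m))"
proof -
  have "0 < Gamma (real m / 2 + 1)" by (rule Gamma_real_pos) (simp add: add_nonneg_pos)
  then have "Gamma (real m / 2 + 1) \<noteq> 0" by (rule less_imp_neq[THEN not_sym])
  moreover have "pi powr (real m / 2) * sqrt pi = pi powr (real (Suc m) / 2)"
  proof -
    have "sqrt pi = pi powr (1 / 2)" by (simp add: powr_half_sqrt)
    then have "pi powr (real m / 2) * sqrt pi = pi powr (real m / 2 + 1 / 2)" by (simp add: powr_add)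
    also have "real m / 2 + 1 / 2 = real (Suc m) / 2" by simp
    finally show ?thesis .
  qed
  moreover have "1 / 2 + (real m / 2 + 1) = real (Suc m) / 2 + 1" by (simp add: field_simps)
  ultimately show ?thesis
    unfolding unit_ball_vol_def Beta_def by (simp add: Gamma_one_half_real mult_ac)
qed

lemma hausdorff_pre_le_cost:
  assumes "0 < s" "0 \<le> \<delta>" shows "hausdorff_pre s \<delta> C \<le> hausdorff_cost s \<delta> C"
proof -
  let ?D = "\<lambda>i::nat. if i = 0 then C else {}"
  have z: "hausdorff_cost s \<delta> {} = 0" using assms by (simp add: hausdorff_cost_def)
  have "hausdorff_pre s \<delta> C \<le> (\<Sum>i. hausdorff_cost s \<delta> (?D i))"
    by (rule hausdorff_pre_le) (auto split: if_splits)
  also have "\<dots> = (\<Sum>i\<in>{0}. hausdorff_cost s \<delta> (?D i))"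
    by (rule suminf_finite) (auto simp: z)
  finally show ?thesis by simp
qed

lemma hausdorff_pre_contraction:
  fixes f :: "'a::metric_space \<Rightarrow> 'b::metric_space"
  assumes s: "0 < s" and f: "\<And>x y. dist (f x) (f y) \<le> dist x y" and \<delta>: "0 \<le> \<delta>"
  shows "hausdorff_pre s \<delta> (f ` E) \<le> hausdorff_pre s \<delta> E"
  unfolding hausdorff_pre_def[of s \<delta> E]
proof (rule INF_greatest)
  fix C :: "nat \<Rightarrow> 'a set" assume C: "C \<in> {C. E \<subseteq> (\<Union>i. C i) \<and> (\<forall>i. bounded (C i) \<and> diameter (C i) \<le> \<delta>)}"
  have d: "bounded (f ` C i) \<and> diameter (f ` C i) \<le> diameter (C i)" for i
  proof
    have b: "dist x y \<le> diameter (C i)" if "x \<in> C i" "y \<in> C i" for x y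
      using C that by (intro diameter_bounded_bound) auto
    show "bounded (f ` C i)"
      unfolding bounded_two_points
    proof (intro exI[of _ "diameter (C i)"] ballI)
      fix x' y' assume "x' \<in> f ` C i" "y' \<in> f ` C i"
      then obtain x y where "x' = f x" "x \<in> C i" "y' = f y" "y \<in> C i" by blast
      then show "dist x' y' \<le> diameter (C i)" using order_trans[OF f b] by simp
    qed
    show "diameter (f ` C i) \<le> diameter (C i)"
    proof (cases "C i = {}")
      case False
      then show ?thesis
        unfolding diameter_def[of "f ` C i"] using b order_trans[OF f]
        by (auto intro!: cSUP_least)
    qed simp
  qed
  have "hausdorff_pre s \<delta> (f ` E) \<le> (\<Sum>i. hausdorff_cost s \<delta> (f ` C i))"
  proof (rule hausdorff_pre_le)
    have "E \<subseteq> (\<Union>i. C i)" using C by simp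
    then show "f ` E \<subseteq> (\<Union>i. f ` C i)" by blast
  qed
  also have "\<dots> \<le> (\<Sum>i. ennreal (unit_ball_vol s * (diameter (C i) / 2) powr s))"
  proof (intro suminf_le summableI)
    fix i
    have "diameter (C i) \<le> \<delta>" using C by auto
    then have "hausdorff_cost s \<delta> (f ` C i) = ennreal (unit_ball_vol s * (diameter (f ` C i) / 2) powr s)"
      using d[of i] by (simp add: hausdorff_cost_def)
    also have "\<dots> \<le> ennreal (unit_ball_vol s * (diameter (C i) / 2) powr s)"
      using d[of i] s diameter_ge_0[of "f ` C i"]
      by (intro ennreal_leI mult_left_mono powr_mono2) auto
    finally show "hausdorff_cost s \<delta> (f ` C i) \<le> \<dots>" .
  qed
  finally show "hausdorff_pre s \<delta> (f ` E) \<le> (\<Sum>i. ennreal (unit_ball_vol s * (diameter (C i) / 2) powr s))" .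
qed

text \<open>The cone over a cap of radius \<open>\<delta>\<close> stays near a segment of length 1.
  About \<open>1 / \<delta>\<close> balls of radius \<open>2 * \<delta>\<close> with centres on the
  segment cover it, so its volume has the order of \<open>\<delta> ^ (DIM('a) - 1)\<close>, like the
  Hausdorff cost of the cap.\<close>

lemma cone_cover_emeasure:
  fixes x0 :: "'a::euclidean_space"
  assumes \<delta>: "0 < \<delta>" "\<delta> \<le> 1" and x0: "norm x0 = 1"
  obtains B where "B \<in> sets borel" "\<And>x t. norm x = 1 \<Longrightarrow> dist x0 x \<le> \<delta> \<Longrightarrow> 0 \<le> t \<Longrightarrow> t \<le> 1 \<Longrightarrow> t *\<^sub>R x \<in> B"
    "emeasure lborel B \<le> ennreal (3 * unit_ball_vol (real DIM('a)) * 2 ^ DIM('a) * \<delta> ^ (DIM('a) - 1))"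
proof -
  let ?n = "DIM('a)"
  define k where "k = nat \<lceil>1 / \<delta>\<rceil>"
  have k: "1 / \<delta> \<le> real k" "real k \<le> 1 / \<delta> + 1"
  proof -
    have "0 < 1 / \<delta>" using \<delta> by simp
    then have "0 \<le> \<lceil>1 / \<delta>\<rceil>" by linarith
    then have "real k = of_int \<lceil>1 / \<delta>\<rceil>" by (simp add: k_def)
    then show "1 / \<delta> \<le> real k" "real k \<le> 1 / \<delta> + 1" by linarith+
  qed
  have "0 < 1 / \<delta>" using \<delta> by simp
  then have k0: "0 < real k" using k(1) by linarith
  define B where "B = (\<Union>j\<in>{..k}. cball ((real j / real k) *\<^sub>R x0) (2 * \<delta>))"
  show thesis
  proof (rule that[of B])
    show "B \<in> sets borel" unfolding B_def by (intro sets.finite_UN) auto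
    fix x :: 'a and t :: real assume x: "norm x = 1" "dist x0 x \<le> \<delta>" and t: "0 \<le> t" "t \<le> 1"
    define j where "j = nat \<lfloor>t * real k\<rfloor>"
    have j: "real j \<le> t * real k" "t * real k < real j + 1"
    proof -
      have "real j = of_int \<lfloor>t * real k\<rfloor>" using t by (simp add: j_def)
      then show "real j \<le> t * real k" "t * real k < real j + 1" by linarith+
    qed
    have "t * real k \<le> real k" using t k0 by (simp add: mult_left_le_one_le)
    then have jk: "j \<le> k" using j(1) by linarith
    have d1: "\<bar>t - real j / real k\<bar> \<le> 1 / real k"
    proof -
      have "t - real j / real k = (t * real k - real j) / real k" using k0 by (simp add: field_simps)
      moreover have "0 \<le> (t * real k - real j) / real k" using j k0 by simp
      moreover have "(t * real k - real j) / real k \<le> 1 / real k"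
        using j k0 by (intro divide_right_mono) auto
      ultimately show ?thesis by simp
    qed
    have d2: "1 / real k \<le> \<delta>" using k(1) k0 \<delta> by (simp add: field_simps)
    have "norm ((real j / real k) *\<^sub>R x0 - t *\<^sub>R x) = norm ((real j / real k) *\<^sub>R (x0 - x) + (real j / real k - t) *\<^sub>R x)"
      by (simp add: algebra_simps)
    also have "\<dots> \<le> (real j / real k) * norm (x0 - x) + \<bar>real j / real k - t\<bar> * norm x"
      using norm_triangle_ineq[of "(real j / real k) *\<^sub>R (x0 - x)" "(real j / real k - t) *\<^sub>R x"] k0 by simp
    also have "\<dots> \<le> 1 * \<delta> + \<delta> * 1"
      using jk k0 x d1 d2 by (intro add_mono mult_mono) (auto simp: dist_norm abs_minus_commute)
    finally show "t *\<^sub>R x \<in> B" using jk by (auto simp: B_def dist_norm)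
  next
    have "emeasure lborel B \<le> (\<Sum>j\<in>{..k}. emeasure lborel (cball ((real j / real k) *\<^sub>R x0) (2 * \<delta>)))"
      unfolding B_def by (rule emeasure_subadditive_finite) auto
    also have "\<dots> = ennreal (real (k + 1) * (unit_ball_vol (real ?n) * (2 * \<delta>) ^ ?n))"
      using \<delta> by (simp add: emeasure_cball ennreal_mult ennreal_of_nat_eq_real_of_nat[symmetric])
    also have "\<dots> \<le> ennreal (3 * unit_ball_vol (real ?n) * 2 ^ ?n * \<delta> ^ (?n - 1))"
    proof (rule ennreal_leI)
      have "real (k + 1) \<le> 3 / \<delta>"
      proof -
        have "1 \<le> 1 / \<delta>" using \<delta> by simp
        moreover have "3 / \<delta> = 1 / \<delta> + 1 / \<delta> + 1 / \<delta>" by simp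
        ultimately show ?thesis using k(2) by simp
      qed
      then have "real (k + 1) * (unit_ball_vol (real ?n) * (2 * \<delta>) ^ ?n) \<le> 3 / \<delta> * (unit_ball_vol (real ?n) * (2 * \<delta>) ^ ?n)"
        using \<delta> by (intro mult_right_mono) auto
      also have "\<dots> = 3 * unit_ball_vol (real ?n) * 2 ^ ?n * \<delta> ^ (?n - 1)"
      proof -
        have "(2 * \<delta>) ^ ?n = 2 ^ ?n * (\<delta> * \<delta> ^ (?n - 1))"
          by (simp add: power_mult_distrib power_eq_if[of \<delta> ?n])
        then show ?thesis using \<delta> by simp
      qed
      finally show "real (k + 1) * (unit_ball_vol (real ?n) * (2 * \<delta>) ^ ?n) \<le> 3 * unit_ball_vol (real ?n) * 2 ^ ?n * \<delta> ^ (?n - 1)" .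
    qed
    finally show "emeasure lborel B \<le> ennreal (3 * unit_ball_vol (real ?n) * 2 ^ ?n * \<delta> ^ (?n - 1))" .
  qed
qed

text \<open>Positivity matters because a vanishing area would turn the final constant into
  \<open>1 / 0 = 0\<close>. The cones over the members of a cover of the sphere cover the punctured
  unit ball, so their volumes, controlled by the costs of the members, add up to at least the volume
  of the ball.\<close>

lemma hausdorff_sphere_pos:
  assumes n: "2 \<le> DIM('a::euclidean_space)"
  shows "0 < hausdorff_outer (real DIM('a) - 1) (sphere (0::'a) 1)"
proof -
  let ?n = "DIM('a)"
  define m where "m = ?n - 1"
  define s where "s = real ?n - 1"
  have sm: "s = real m" "0 < m" "0 < s" using n by (auto simp: s_def m_def)
  define K where "K = 3 * unit_ball_vol (real ?n) * 2 ^ ?n"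
  have K: "0 < K" by (simp add: K_def)
  \<comment> \<open>Converts the cone bound into Hausdorff cost: \<open>K * d i ^ m\<close> equals
    \<open>K'\<close> times the cost of a set of diameter \<open>d i\<close>.\<close>
  define K' where "K' = K * 2 ^ m / unit_ball_vol s"
  have us: "0 < unit_ball_vol s" using sm by simp
  have K': "0 < K'" using K us by (simp add: K'_def)
  have "ennreal (unit_ball_vol (real ?n) / K') \<le> hausdorff_pre s 1 (sphere (0::'a) 1)"
    unfolding hausdorff_pre_def
  proof (rule INF_greatest)
    fix C :: "nat \<Rightarrow> 'a set"
    assume C: "C \<in> {C. sphere 0 1 \<subseteq> (\<Union>i. C i) \<and> (\<forall>i. bounded (C i) \<and> diameter (C i) \<le> 1)}"
    define d where "d i = diameter (C i)" for i
    have d: "0 \<le> d i" "d i \<le> 1" for i using C by (auto simp: d_def diameter_ge_0)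
    let ?X = "\<Sum>i. ennreal (unit_ball_vol s * (d i / 2) powr s)"
    have "ennreal (unit_ball_vol (real ?n)) \<le> ennreal K' * ?X"
    proof (rule ennreal_le_epsilon)
      fix e :: real assume e: "0 < e"
      \<comment> \<open>A member of the cover may have diameter 0, while the cone estimate needs a
        positive radius. Radii are raised to at least \<open>\<eta> i\<close>, which adds at most
        \<open>e\<close> to the total volume.\<close>
      define \<eta> where "\<eta> i = min 1 (e / K) * (1 / 2) ^ Suc i" for i :: nat
      have \<eta>: "0 < \<eta> i" "\<eta> i \<le> 1" for i
      proof -
        show "0 < \<eta> i" using e K by (simp add: \<eta>_def)
        have "min 1 (e / K) * (1 / 2) ^ Suc i \<le> 1 * 1"
          by (intro mult_mono power_le_one) (use e K in auto)
        then show "\<eta> i \<le> 1" by (simp add: \<eta>_def)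
      qed
      define Q where "Q i B \<longleftrightarrow> B \<in> sets borel \<and> (\<forall>x\<in>C i \<inter> sphere 0 1. \<forall>t. 0 \<le> t \<longrightarrow> t \<le> 1 \<longrightarrow> t *\<^sub>R x \<in> B) \<and>
          emeasure lborel B \<le> ennreal (K * max (d i) (\<eta> i) ^ m)" for i B
      have "\<exists>B. Q i B" for i
      proof (cases "C i \<inter> sphere 0 1 = {}")
        case True
        then show ?thesis by (intro exI[of _ "{}"]) (simp add: Q_def)
      next
        case False
        then obtain x0 where x0: "x0 \<in> C i" "norm x0 = 1" by auto
        obtain B where B: "B \<in> sets borel"
          "\<And>x t. norm x = 1 \<Longrightarrow> dist x0 x \<le> max (d i) (\<eta> i) \<Longrightarrow> 0 \<le> t \<Longrightarrow> t \<le> 1 \<Longrightarrow> t *\<^sub>R x \<in> B"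
          "emeasure lborel B \<le> ennreal (3 * unit_ball_vol (real ?n) * 2 ^ ?n * max (d i) (\<eta> i) ^ (?n - 1))"
          by (rule cone_cover_emeasure[of "max (d i) (\<eta> i)" x0]) (use d[of i] \<eta>[of i] x0 in auto)
        have "dist x0 x \<le> max (d i) (\<eta> i)" if "x \<in> C i" for x
        proof -
          have "dist x0 x \<le> d i" unfolding d_def using C x0 that by (intro diameter_bounded_bound) auto
          then show ?thesis by simp
        qed
        then show ?thesis using B by (intro exI[of _ B]) (simp add: Q_def K_def m_def)
      qed
      then obtain B where "\<And>i. Q i (B i)" by metis
      then have B: "B i \<in> sets borel"
        "\<And>x t. x \<in> C i \<inter> sphere 0 1 \<Longrightarrow> 0 \<le> t \<Longrightarrow> t \<le> 1 \<Longrightarrow> t *\<^sub>R x \<in> B i"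
        "emeasure lborel (B i) \<le> ennreal (K * max (d i) (\<eta> i) ^ m)" for i
        unfolding Q_def by blast+
      have sub: "cball 0 1 - {0} \<subseteq> (\<Union>i. B i)"
      proof
        fix y :: 'a assume y: "y \<in> cball 0 1 - {0}"
        define x where "x = (1 / norm y) *\<^sub>R y"
        have x: "x \<in> sphere 0 1" "y = norm y *\<^sub>R x" using y by (auto simp: x_def)
        then obtain i where "x \<in> C i" using C by blast
        then have "norm y *\<^sub>R x \<in> B i" using x y by (intro B(2)) auto
        then show "y \<in> (\<Union>i. B i)" using x(2) by auto
      qed
      have "ennreal (unit_ball_vol (real ?n)) = emeasure lborel (cball (0::'a) 1)"
        by (simp add: emeasure_cball)
      also have "\<dots> = emeasure lborel (cball (0::'a) 1 - {0})"
        by (rule emeasure_Diff_null_set[symmetric]) (auto simp: null_sets_def)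
      also have "\<dots> \<le> emeasure lborel (\<Union>i. B i)"
        using sub B(1) by (intro emeasure_mono) auto
      also have "\<dots> \<le> (\<Sum>i. emeasure lborel (B i))"
        using B(1) by (intro emeasure_subadditive_countably) auto
      also have "\<dots> \<le> (\<Sum>i. ennreal K' * ennreal (unit_ball_vol s * (d i / 2) powr s) + ennreal (e * (1 / 2) ^ Suc i))"
      proof (intro suminf_le summableI)
        fix i
        have "max (d i) (\<eta> i) ^ m \<le> d i ^ m + \<eta> i ^ m"
          using d[of i] \<eta>[of i] by (cases "d i \<le> \<eta> i") (auto simp: max_def)
        also have "\<eta> i ^ m \<le> \<eta> i" using \<eta>[of i] sm by (simp add: power_le_one_iff power_decreasing[of 1 m "\<eta> i", simplified] less_imp_le Suc_leI)
        finally have "K * max (d i) (\<eta> i) ^ m \<le> K * d i ^ m + K * \<eta> i"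
          using K by (simp add: distrib_left[symmetric] mult_left_mono)
        also have "K * \<eta> i \<le> e * (1 / 2) ^ Suc i"
        proof -
          have "K * min 1 (e / K) \<le> e" using K by (simp add: min_def field_simps)
          then have "K * min 1 (e / K) * (1 / 2) ^ Suc i \<le> e * (1 / 2) ^ Suc i"
            by (rule mult_right_mono) simp
          then show ?thesis by (simp add: \<eta>_def mult.assoc)
        qed
        also have "K * d i ^ m = K' * (unit_ball_vol s * (d i / 2) powr s)"
        proof -
          have "(d i / 2) powr s = (d i / 2) ^ m"
            using d[of i] sm by (cases "d i = 0") (auto simp: powr_realpow)
          then show ?thesis using us by (simp add: K'_def power_divide)
        qed
        finally have le: "K * max (d i) (\<eta> i) ^ m \<le> K' * (unit_ball_vol s * (d i / 2) powr s) + e * (1 / 2) ^ Suc i" by simp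
        have "emeasure lborel (B i) \<le> ennreal (K' * (unit_ball_vol s * (d i / 2) powr s) + e * (1 / 2) ^ Suc i)"
          by (rule order_trans[OF B(3) ennreal_leI[OF le]])
        also have "\<dots> = ennreal (K' * (unit_ball_vol s * (d i / 2) powr s)) + ennreal (e * (1 / 2) ^ Suc i)"
          using K' us e by (intro ennreal_plus) auto
        also have "ennreal (K' * (unit_ball_vol s * (d i / 2) powr s)) = ennreal K' * ennreal (unit_ball_vol s * (d i / 2) powr s)"
          using K' us by (intro ennreal_mult) auto
        finally show "emeasure lborel (B i) \<le> ennreal K' * ennreal (unit_ball_vol s * (d i / 2) powr s) + ennreal (e * (1 / 2) ^ Suc i)" .
      qed
      also have "\<dots> = (\<Sum>i. ennreal K' * ennreal (unit_ball_vol s * (d i / 2) powr s)) + (\<Sum>i. ennreal (e * (1 / 2) ^ Suc i))"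
        by (rule suminf_add[symmetric]) (rule summableI)+
      also have "(\<Sum>i. ennreal (e * (1 / 2) ^ Suc i)) = ennreal e"
      proof (rule suminf_ennreal_eq)
        show "(\<lambda>i. e * (1 / 2) ^ Suc i) sums e"
          using sums_mult[OF power_half_series, of e] by simp
      qed (use e in simp)
      also have "(\<Sum>i. ennreal K' * ennreal (unit_ball_vol s * (d i / 2) powr s)) = ennreal K' * ?X"
        by (rule ennreal_suminf_cmult)
      finally show "ennreal (unit_ball_vol (real ?n)) \<le> ennreal K' * ?X + ennreal e" .
    qed
    then have "ennreal (1 / K') * ennreal (unit_ball_vol (real ?n)) \<le> ennreal (1 / K') * (ennreal K' * ?X)"
      by (rule mult_left_mono) simp
    also have "\<dots> = ?X" using K' by (simp add: mult.assoc[symmetric] ennreal_mult[symmetric])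
    finally show "ennreal (unit_ball_vol (real ?n) / K') \<le> (\<Sum>i. ennreal (unit_ball_vol s * (diameter (C i) / 2) powr s))"
      using K' by (simp add: ennreal_mult[symmetric] d_def)
  qed
  also have "\<dots> \<le> hausdorff_outer s (sphere (0::'a) 1)" by (rule hausdorff_pre_le_outer) simp
  finally have le: "ennreal (unit_ball_vol (real ?n) / K') \<le> hausdorff_outer s (sphere (0::'a) 1)" .
  have "0 < ennreal (unit_ball_vol (real ?n) / K')" using K' by simp
  from less_le_trans[OF this le] show ?thesis unfolding s_def .
qed

text \<open>A flat slice of the ball at height \<open>t - norm c\<close> has radius
  \<open>sqrt (r\<^sup>2 - (t - norm c)\<^sup>2)\<close>; bending the plane into a sphere of radius
  \<open>t\<close> costs at most the factor \<open>1 + r\<close>, negligible for small balls.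
  Splitting vectors along and across \<open>c\<close> reduces the claim to a planar triangle with
  sides \<open>t\<close>, \<open>norm c\<close> and \<open>r\<close>.\<close>

lemma sphere_slice_diam:
  fixes c :: "'a::euclidean_space"
  assumes c: "1 \<le> norm c" and r: "0 \<le> r" "r \<le> 1" and t: "0 < t"
    and x: "norm x = t" "dist c x \<le> r" and y: "norm y = t" "dist c y \<le> r"
  shows "norm (x - y) \<le> 2 * ((1 + r) * sqrt (r\<^sup>2 - (t - norm c)\<^sup>2))" "\<bar>t - norm c\<bar> \<le> r"
proof -
  show tc: "\<bar>t - norm c\<bar> \<le> r"
    using norm_triangle_ineq3[of x c] x by (simp add: dist_norm norm_minus_commute)
  define N where "N = norm c"
  have N: "1 \<le> N" using c by (simp add: N_def)
  have cc: "c \<bullet> c = N\<^sup>2" by (simp add: N_def power2_norm_eq_inner)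
  define w where "w = r\<^sup>2 - (t - N)\<^sup>2"
  have w0: "0 \<le> w"
    using tc r power_mono[of "\<bar>t - N\<bar>" r 2] by (simp add: w_def N_def)
  \<comment> \<open>A lower bound for \<open>z \<bullet> c\<close> over the slice, with equality for
    points at distance exactly \<open>r\<close> from \<open>c\<close>.\<close>
  define g where "g = (t\<^sup>2 + N\<^sup>2 - r\<^sup>2) / 2"
  have proj: "g \<le> z \<bullet> c" if z: "norm z = t" "dist c z \<le> r" for z
  proof -
    have "(norm (c - z))\<^sup>2 \<le> r\<^sup>2" using z by (intro power_mono) (auto simp: dist_norm)
    moreover have "(norm (c - z))\<^sup>2 = N\<^sup>2 - 2 * (z \<bullet> c) + t\<^sup>2"
      using z(1) by (simp add: power2_norm_eq_inner inner_diff_left inner_diff_right inner_commute N_def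
          flip: z(1))
    ultimately show ?thesis by (simp add: g_def)
  qed
  have g0: "0 \<le> g"
  proof -
    have "r\<^sup>2 \<le> N\<^sup>2" using r N by (intro power_mono) auto
    moreover have "0 \<le> t\<^sup>2" by simp
    ultimately have "0 \<le> t\<^sup>2 + N\<^sup>2 - r\<^sup>2" by linarith
    then show ?thesis by (simp add: g_def)
  qed
  define a b where "a = x \<bullet> c" and "b = y \<bullet> c"
  have ab: "g \<le> a" "g \<le> b" using proj x y by (auto simp: a_def b_def)
  define u v where "u = x - (a / N\<^sup>2) *\<^sub>R c" and "v = y - (b / N\<^sup>2) *\<^sub>R c"
  have N2: "0 < N\<^sup>2" using N by simp
  have uu: "(norm u)\<^sup>2 = t\<^sup>2 - a\<^sup>2 / N\<^sup>2"
  proof -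
    have "(norm u)\<^sup>2 = x \<bullet> x - 2 * (a / N\<^sup>2) * (x \<bullet> c) + (a / N\<^sup>2)\<^sup>2 * (c \<bullet> c)"
      unfolding power2_norm_eq_inner u_def
      by (simp add: inner_diff_left inner_diff_right inner_commute power2_eq_square algebra_simps)
    also have "\<dots> = t\<^sup>2 - 2 * (a / N\<^sup>2) * a + (a / N\<^sup>2)\<^sup>2 * N\<^sup>2"
      using x(1) by (simp add: cc a_def[symmetric]) (simp add: power2_norm_eq_inner[symmetric])
    also have "\<dots> = t\<^sup>2 - a\<^sup>2 / N\<^sup>2"
      using N by (simp add: power2_eq_square field_simps)
    finally show ?thesis .
  qed
  have vv: "(norm v)\<^sup>2 = t\<^sup>2 - b\<^sup>2 / N\<^sup>2"
  proof -
    have "(norm v)\<^sup>2 = y \<bullet> y - 2 * (b / N\<^sup>2) * (y \<bullet> c) + (b / N\<^sup>2)\<^sup>2 * (c \<bullet> c)"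
      unfolding power2_norm_eq_inner v_def
      by (simp add: inner_diff_left inner_diff_right inner_commute power2_eq_square algebra_simps)
    also have "\<dots> = t\<^sup>2 - 2 * (b / N\<^sup>2) * b + (b / N\<^sup>2)\<^sup>2 * N\<^sup>2"
      using y(1) by (simp add: cc b_def[symmetric]) (simp add: power2_norm_eq_inner[symmetric])
    also have "\<dots> = t\<^sup>2 - b\<^sup>2 / N\<^sup>2"
      using N by (simp add: power2_eq_square field_simps)
    finally show ?thesis .
  qed
  have xy: "x \<bullet> y = a * b / N\<^sup>2 + u \<bullet> v"
  proof -
    have "u \<bullet> v = x \<bullet> y - (b / N\<^sup>2) * (x \<bullet> c) - (a / N\<^sup>2) * (y \<bullet> c) + (a / N\<^sup>2) * (b / N\<^sup>2) * (c \<bullet> c)"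
      unfolding u_def v_def
      by (simp add: inner_diff_left inner_diff_right inner_commute algebra_simps)
    also have "\<dots> = x \<bullet> y - a * b / N\<^sup>2"
      using N2 by (simp add: cc a_def[symmetric] b_def[symmetric] field_simps power2_eq_square)
    finally show ?thesis by simp
  qed
  define h where "h = t\<^sup>2 - g\<^sup>2 / N\<^sup>2"
  have "a\<^sup>2 / N\<^sup>2 \<ge> g\<^sup>2 / N\<^sup>2" "b\<^sup>2 / N\<^sup>2 \<ge> g\<^sup>2 / N\<^sup>2"
    using ab g0 by (intro divide_right_mono power_mono; simp)+
  then have uv: "(norm u)\<^sup>2 \<le> h" "(norm v)\<^sup>2 \<le> h" by (simp_all add: uu vv h_def)
  have "\<bar>u \<bullet> v\<bar> \<le> h"
  proof -
    have "\<bar>u \<bullet> v\<bar> \<le> norm u * norm v" by (rule Cauchy_Schwarz_ineq2)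
    also have "\<dots> \<le> ((norm u)\<^sup>2 + (norm v)\<^sup>2) / 2"
      using sum_squares_bound[of "norm u" "norm v"] by simp
    finally show ?thesis using uv by simp
  qed
  moreover have "g\<^sup>2 / N\<^sup>2 \<le> a * b / N\<^sup>2"
    using ab g0 by (intro divide_right_mono) (auto simp: power2_eq_square intro: mult_mono)
  ultimately have "(norm (x - y))\<^sup>2 \<le> 4 * h"
  proof -
    have "(norm (x - y))\<^sup>2 = x \<bullet> x - 2 * (x \<bullet> y) + y \<bullet> y"
      unfolding power2_norm_eq_inner by (simp add: inner_diff_left inner_diff_right inner_commute)
    moreover have "x \<bullet> x = t\<^sup>2" "y \<bullet> y = t\<^sup>2"
      using power2_norm_eq_inner[of x] power2_norm_eq_inner[of y] x(1) y(1) by simp_all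
    ultimately have "(norm (x - y))\<^sup>2 = 2 * t\<^sup>2 - 2 * (x \<bullet> y)" by linarith
    then show ?thesis
      using \<open>\<bar>u \<bullet> v\<bar> \<le> h\<close> \<open>g\<^sup>2 / N\<^sup>2 \<le> a * b / N\<^sup>2\<close> xy by (simp add: h_def abs_le_iff)
  qed
  \<comment> \<open>Heron's formula: \<open>h\<close> is the squared height over the side
    \<open>N\<close> of the triangle with sides \<open>t\<close>, \<open>N\<close>,
    \<open>r\<close>, and the factorisation isolates the squared flat radius
    \<open>w\<close>.\<close>
  also have "4 * h = ((t + N)\<^sup>2 - r\<^sup>2) * w / N\<^sup>2"
  proof -
    have "4 * h = (4 * N\<^sup>2 * t\<^sup>2 - (2 * g)\<^sup>2) / N\<^sup>2"
      using N2 by (simp add: h_def diff_divide_distrib power_mult_distrib)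
    also have "2 * g = t\<^sup>2 + N\<^sup>2 - r\<^sup>2" by (simp add: g_def)
    also have "4 * N\<^sup>2 * t\<^sup>2 - (t\<^sup>2 + N\<^sup>2 - r\<^sup>2)\<^sup>2 = ((t + N)\<^sup>2 - r\<^sup>2) * w"
      unfolding w_def by (simp add: power2_eq_square algebra_simps)
    finally show ?thesis .
  qed
  also have "\<dots> \<le> (2 * (1 + r))\<^sup>2 * w"
  proof -
    have "(t + N)\<^sup>2 - r\<^sup>2 \<le> (t + N)\<^sup>2" by simp
    also have "(t + N)\<^sup>2 \<le> (2 * (1 + r) * N)\<^sup>2"
    proof (rule power_mono)
      have "r * 1 \<le> r * N" using r N by (intro mult_left_mono) auto
      then show "t + N \<le> 2 * (1 + r) * N" using tc r N by (simp add: N_def algebra_simps)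
    qed (use t N in auto)
    finally have "((t + N)\<^sup>2 - r\<^sup>2) * w \<le> (2 * (1 + r) * N)\<^sup>2 * w" using w0 by (rule mult_right_mono)
    then show ?thesis using N2 by (simp add: pos_divide_le_eq power_mult_distrib mult_ac)
  qed
  finally have "norm (x - y) \<le> sqrt ((2 * (1 + r))\<^sup>2 * w)" by (rule real_le_rsqrt)
  also have "\<dots> = 2 * ((1 + r) * sqrt w)" using r by (simp add: real_sqrt_mult)
  finally show "norm (x - y) \<le> 2 * ((1 + r) * sqrt (r\<^sup>2 - (t - norm c)\<^sup>2))" by (simp add: w_def N_def)
qed

text \<open>Volume of an \<open>m\<close>-ball whose radius is the flat slice radius enlarged by
  \<open>1 + r\<close>, as a function of the radius \<open>t\<close> of the sphere; \<open>p\<close>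
  is the distance of the centre of the ball from the origin. The indicator is needed because
  \<open>sqrt\<close> of a negative number is not 0.\<close>

definition slice_bound :: "nat \<Rightarrow> real \<Rightarrow> real \<Rightarrow> real \<Rightarrow> ennreal" where
  "slice_bound m p r t = ennreal (indicator {-r..r} (t - p) * (unit_ball_vol (real m) * ((1 + r) * sqrt (r\<^sup>2 - (t - p)\<^sup>2)) ^ m))"

lemma slice_bound_measurable [measurable]: "slice_bound m p r \<in> borel_measurable borel"
  unfolding slice_bound_def[abs_def] by measurable

text \<open>After the substitution \<open>t = p + r * x\<close> this is the volume of a ball
  computed from parallel slices; only the curvature factor \<open>(1 + r) ^ m\<close> is
  extra.\<close>

lemma nn_integral_slice_bound:
  assumes r: "0 < r"
  shows "(\<integral>\<^sup>+t. slice_bound m p r t \<partial>lborel) = ennreal ((1 + r) ^ m * (unit_ball_vol (real (Suc m)) * r ^ Suc m))"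
proof -
  have "(\<integral>\<^sup>+t. slice_bound m p r t \<partial>lborel) = ennreal \<bar>r\<bar> * (\<integral>\<^sup>+x. slice_bound m p r (p + r * x) \<partial>lborel)"
    using r by (intro nn_integral_real_affine) auto
  also have "(\<integral>\<^sup>+x. slice_bound m p r (p + r * x) \<partial>lborel)
     = (\<integral>\<^sup>+x. ennreal (unit_ball_vol (real m) * ((1 + r) * r) ^ m) * ennreal (indicator {-1..1} x * sqrt (1 - x\<^sup>2) ^ m) \<partial>lborel)"
  proof (rule nn_integral_cong)
    fix x :: real
    have i: "indicat_real {-r..r} (p + r * x - p) = indicat_real {-1..1} x"
      using r by (auto simp: indicator_def mult_le_cancel_left_pos[of r x 1, simplified] mult_le_cancel_left_pos[of r "-1" x, simplified])
    have "sqrt (r\<^sup>2 - (r * x)\<^sup>2) = r * sqrt (1 - x\<^sup>2)"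
    proof -
      have "r\<^sup>2 - (r * x)\<^sup>2 = r\<^sup>2 * (1 - x\<^sup>2)" by (simp add: power_mult_distrib algebra_simps)
      then show ?thesis using r by (simp add: real_sqrt_mult)
    qed
    then have e: "indicat_real {-r..r} (p + r * x - p) * (unit_ball_vol (real m) * ((1 + r) * sqrt (r\<^sup>2 - (p + r * x - p)\<^sup>2)) ^ m)
      = unit_ball_vol (real m) * ((1 + r) * r) ^ m * (indicat_real {-1..1} x * sqrt (1 - x\<^sup>2) ^ m)"
      unfolding i by (simp add: power_mult_distrib mult_ac)
    show "slice_bound m p r (p + r * x) = ennreal (unit_ball_vol (real m) * ((1 + r) * r) ^ m) * ennreal (indicator {-1..1} x * sqrt (1 - x\<^sup>2) ^ m)"
      unfolding slice_bound_def e using r by (intro ennreal_mult') simp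
  qed
  also have "\<dots> = ennreal (unit_ball_vol (real m) * ((1 + r) * r) ^ m) * ennreal (Beta (1 / 2) (real m / 2 + 1))"
    by (subst nn_integral_cmult) (auto simp: emeasure_cball_aux_integral)
  also have "ennreal \<bar>r\<bar> * \<dots> = ennreal (r * (unit_ball_vol (real m) * ((1 + r) * r) ^ m * Beta (1 / 2) (real m / 2 + 1)))"
    using r by (simp add: ennreal_mult'[symmetric])
  also have "r * (unit_ball_vol (real m) * ((1 + r) * r) ^ m * Beta (1 / 2) (real m / 2 + 1))
     = (1 + r) ^ m * (unit_ball_vol (real (Suc m)) * r ^ Suc m)"
    by (simp only: unit_ball_vol_recurrence[symmetric]) (simp add: power_mult_distrib)
  finally show ?thesis .
qed

text \<open>The slice serves as its own one-member cover; its cost is the volume of an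
  \<open>m\<close>-ball of half its diameter.\<close>

lemma hausdorff_pre_slice_le:
  fixes c :: "'a::euclidean_space"
  assumes m: "0 < m" and r: "0 < r" "r \<le> 1" "2 * r \<le> \<delta>" and c: "1 \<le> norm c" and t: "0 < t"
  shows "hausdorff_pre (real m) \<delta> (cball c r \<inter> sphere 0 t) \<le> slice_bound m (norm c) r t"
proof (cases "cball c r \<inter> sphere 0 t = {}")
  case True
  have "outer_measure_space (Pow UNIV) (hausdorff_pre (real m) \<delta> :: 'a set \<Rightarrow> ennreal)"
    using m r by (intro hausdorff_pre_outer_measure_space) auto
  then show ?thesis using True by (simp add: outer_measure_space_def positive_def)
next
  case False
  let ?D = "cball c r \<inter> sphere 0 t"
  define q where "q = (1 + r) * sqrt (r\<^sup>2 - (t - norm c)\<^sup>2)"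
  obtain z where "z \<in> ?D" using False by blast
  then have z: "norm z = t" "dist c z \<le> r" by simp_all
  have tc: "\<bar>t - norm c\<bar> \<le> r" using sphere_slice_diam(2)[OF c _ r(2) t z z] r by simp
  have b: "bounded ?D" by (rule bounded_Int) simp
  have d: "diameter ?D \<le> 2 * q"
    unfolding q_def using sphere_slice_diam(1)[OF c _ r(2) t] r False
    by (intro diameter_le) auto
  have "diameter ?D \<le> diameter (cball c r)" by (rule diameter_subset) auto
  then have d\<delta>: "diameter ?D \<le> \<delta>" using r by simp
  have d0: "0 \<le> diameter ?D" using b by (rule diameter_ge_0)
  have "hausdorff_pre (real m) \<delta> ?D \<le> hausdorff_cost (real m) \<delta> ?D"
    using m r by (intro hausdorff_pre_le_cost) auto
  also have "\<dots> = ennreal (unit_ball_vol (real m) * (diameter ?D / 2) powr real m)"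
    using b d\<delta> by (simp add: hausdorff_cost_def)
  also have "\<dots> \<le> ennreal (unit_ball_vol (real m) * q ^ m)"
  proof (intro ennreal_leI mult_left_mono)
    have "(diameter ?D / 2) powr real m = (diameter ?D / 2) ^ m"
      using d0 m by (cases "diameter ?D = 0") (auto simp: powr_realpow)
    also have "\<dots> \<le> q ^ m" using d d0 by (intro power_mono) auto
    finally show "(diameter ?D / 2) powr real m \<le> q ^ m" .
  qed simp
  also have "\<dots> = slice_bound m (norm c) r t"
    using tc by (simp add: slice_bound_def q_def abs_le_iff)
  finally show ?thesis .
qed

text \<open>\<open>C\<close> may be finite or empty, so the enumeration is restricted to an index
  set \<open>P\<close> and padded with zeros; later sums can then run over all natural
  numbers.\<close>

lemma disjoint_balls_enum:
  fixes C :: "('a::euclidean_space \<times> real) set"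
  assumes C: "countable C" "pairwise (\<lambda>i j. disjnt (cball (fst i) (snd i)) (cball (fst j) (snd j))) C"
    and T: "T \<in> sets lborel" and CT: "\<And>i. i \<in> C \<Longrightarrow> 0 < snd i \<and> cball (fst i) (snd i) \<subseteq> T"
  obtains b :: "nat \<Rightarrow> 'a \<times> real" and P :: "nat set" where "\<And>k. k \<in> P \<Longrightarrow> b k \<in> C" "C \<subseteq> b ` P"
    "(\<Sum>k. ennreal (if k \<in> P then unit_ball_vol (real DIM('a)) * snd (b k) ^ DIM('a) else 0)) \<le> emeasure lborel T"
proof -
  define P where "P = to_nat_on C ` C"
  define b where "b = from_nat_into C"
  have inj: "inj_on (to_nat_on C) C" using C(1) by (rule inj_on_to_nat_on)
  have bt: "b (to_nat_on C i) = i" if "i \<in> C" for i unfolding b_def using C(1) that by (rule from_nat_into_to_nat_on)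
  have bP: "b k \<in> C" if "k \<in> P" for k using that bt by (auto simp: P_def)
  have injb: "b k \<noteq> b l" if "k \<in> P" "l \<in> P" "k \<noteq> l" for k l using that bt by (auto simp: P_def)
  define D where "D k = (if k \<in> P then cball (fst (b k)) (snd (b k)) else {})" for k
  have "disjoint_family D"
    unfolding disjoint_family_on_def
  proof (intro ballI impI)
    fix k l :: nat assume "k \<noteq> l"
    show "D k \<inter> D l = {}"
    proof (cases "k \<in> P \<and> l \<in> P")
      case True
      then have "disjnt (cball (fst (b k)) (snd (b k))) (cball (fst (b l)) (snd (b l)))"
        using pairwiseD[OF C(2)] bP injb \<open>k \<noteq> l\<close> by blast
      then show ?thesis using True by (simp add: D_def disjnt_def)
    qed (auto simp: D_def)
  qed
  moreover have "range D \<subseteq> sets lborel" by (auto simp: D_def)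
  ultimately have "(\<Sum>k. emeasure lborel (D k)) = emeasure lborel (\<Union>k. D k)"
    by (intro suminf_emeasure)
  also have "\<dots> \<le> emeasure lborel T"
  proof (rule emeasure_mono[OF _ T])
    have "D k \<subseteq> T" for k using CT[OF bP[of k]] by (cases "k \<in> P") (simp_all add: D_def)
    then show "(\<Union>k. D k) \<subseteq> T" by blast
  qed
  finally have le: "(\<Sum>k. emeasure lborel (D k)) \<le> emeasure lborel T" .
  have "emeasure lborel (D k) = ennreal (if k \<in> P then unit_ball_vol (real DIM('a)) * snd (b k) ^ DIM('a) else 0)" for k
    using CT[OF bP, of k] by (cases "k \<in> P") (auto simp: D_def emeasure_cball less_imp_le)
  then have sum: "(\<Sum>k. ennreal (if k \<in> P then unit_ball_vol (real DIM('a)) * snd (b k) ^ DIM('a) else 0))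
      \<le> emeasure lborel T"
    using le by presburger
  have "C \<subseteq> b ` P"
  proof
    fix i assume i: "i \<in> C"
    show "i \<in> b ` P"
      by (rule image_eqI[of _ _ "to_nat_on C i"]) (simp_all add: bt i P_def)
  qed
  from bP this sum show thesis by (rule that)
qed

lemma emeasure_shell:
  assumes \<tau>: "0 < \<tau>"
  shows "emeasure lborel (ball (0::'a::euclidean_space) (1 + \<tau>) - cball 0 1)
    = ennreal (unit_ball_vol (real DIM('a)) * ((1 + \<tau>) ^ DIM('a) - 1))"
proof -
  have "emeasure lborel (ball (0::'a) (1 + \<tau>) - cball 0 1)
     = emeasure lborel (ball (0::'a) (1 + \<tau>)) - emeasure lborel (cball (0::'a) 1)"
    by (rule emeasure_Diff) (use \<tau> in \<open>auto simp: emeasure_cball\<close>)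
  also have "\<dots> = ennreal (unit_ball_vol (real DIM('a)) * (1 + \<tau>) ^ DIM('a) - unit_ball_vol (real DIM('a)))"
    using \<tau> by (simp add: emeasure_ball emeasure_cball ennreal_minus)
  finally show ?thesis by (simp add: right_diff_distrib)
qed

text \<open>Used with \<open>f = 1\<close> for the disjoint balls that fill the shell up to a null
  set, and with \<open>f = 5\<close> for the enlarged balls over that null set. In both cases the
  volume of the disjoint balls before enlargement pays, at the price of
  \<open>f ^ n\<close>.\<close>

lemma slice_family_bound:
  fixes C :: "('a::euclidean_space \<times> real) set"
  defines "n \<equiv> DIM('a)"
  assumes n: "n = Suc m" "0 < m" and C: "countable C" "pairwise (\<lambda>i j. disjnt (cball (fst i) (snd i)) (cball (fst j) (snd j))) C"
    and T: "T \<in> sets lborel" and CT: "\<And>i. i \<in> C \<Longrightarrow> 0 < snd i \<and> cball (fst i) (snd i) \<subseteq> T"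
    and f: "1 \<le> f" and \<rho>: "\<rho> \<le> 1" "2 * \<rho> \<le> \<delta>"
    and Cr: "\<And>i. i \<in> C \<Longrightarrow> f * snd i \<le> \<rho> \<and> 1 \<le> norm (fst i)" and \<rho>0: "0 < \<rho>"
  obtains G where "G \<in> borel_measurable lborel"
    "\<And>t. 0 < t \<Longrightarrow> hausdorff_pre (real m) \<delta> ((\<Union>i\<in>C. cball (fst i) (f * snd i)) \<inter> sphere 0 t) \<le> G t"
    "(\<integral>\<^sup>+t. G t \<partial>lborel) \<le> ennreal ((1 + \<rho>) ^ m * f ^ n) * emeasure lborel T"
proof -
  obtain b :: "nat \<Rightarrow> 'a \<times> real" and P :: "nat set"
    where b: "\<And>k. k \<in> P \<Longrightarrow> b k \<in> C" "C \<subseteq> b ` P"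
    "(\<Sum>k. ennreal (if k \<in> P then unit_ball_vol (real DIM('a)) * snd (b k) ^ DIM('a) else 0)) \<le> emeasure lborel T"
  proof (rule disjoint_balls_enum[OF C T CT])
    fix b :: "nat \<Rightarrow> 'a \<times> real" and P :: "nat set"
    assume b: "\<And>k. k \<in> P \<Longrightarrow> b k \<in> C" "C \<subseteq> b ` P"
      "(\<Sum>k. ennreal (if k \<in> P then unit_ball_vol (real DIM('a)) * snd (b k) ^ DIM('a) else 0)) \<le> emeasure lborel T"
    show thesis by (rule that) (fact b)+
  qed
  note b(3)[folded n_def]
  note b = b(1,2) this
  define g where "g k t = (if k \<in> P then slice_bound m (norm (fst (b k))) (f * snd (b k)) t else 0)" for k t
  have gm: "g k \<in> borel_measurable lborel" for k
    by (cases "k \<in> P") (simp_all add: g_def[abs_def] slice_bound_measurable)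
  have oms: "outer_measure_space (Pow UNIV) (hausdorff_pre (real m) \<delta> :: 'a set \<Rightarrow> ennreal)"
    using n \<rho> \<rho>0 by (intro hausdorff_pre_outer_measure_space) auto
  have pos: "0 < f * snd (b k)" if "k \<in> P" for k
    using CT[OF b(1)[OF that]] f by simp
  show thesis
  proof (rule that[of "\<lambda>t. \<Sum>k. g k t"])
    show "(\<lambda>t. \<Sum>k. g k t) \<in> borel_measurable lborel"
      by (rule borel_measurable_suminf_order) (rule gm)
    fix t :: real assume t: "0 < t"
    define D where "D k = (if k \<in> P then cball (fst (b k)) (f * snd (b k)) \<inter> sphere 0 t else {})" for k
    have "(\<Union>i\<in>C. cball (fst i) (f * snd i)) \<inter> sphere 0 t \<subseteq> (\<Union>k. D k)"
    proof
      fix x assume "x \<in> (\<Union>i\<in>C. cball (fst i) (f * snd i)) \<inter> sphere 0 t"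
      then obtain i where "i \<in> C" and x: "x \<in> cball (fst i) (f * snd i)" "x \<in> sphere 0 t" by blast
      then obtain k where "k \<in> P" "i = b k" using b(2) by blast
      then have "x \<in> D k" unfolding D_def using x by simp
      then show "x \<in> (\<Union>k. D k)" by blast
    qed
    then have "hausdorff_pre (real m) \<delta> ((\<Union>i\<in>C. cball (fst i) (f * snd i)) \<inter> sphere 0 t) \<le> hausdorff_pre (real m) \<delta> (\<Union>k. D k)"
      using oms by (simp add: outer_measure_space_def increasing_def)
    also have "\<dots> \<le> (\<Sum>k. hausdorff_pre (real m) \<delta> (D k))" by (rule outer_measure_space_UN[OF oms])
    also have "\<dots> \<le> (\<Sum>k. g k t)"
    proof (intro suminf_le summableI)
      fix k
      show "hausdorff_pre (real m) \<delta> (D k) \<le> g k t"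
      proof (cases "k \<in> P")
        case True
        then show ?thesis
          using Cr[OF b(1)[OF True]] \<rho> unfolding D_def g_def
          by (simp, intro hausdorff_pre_slice_le[OF n(2) pos[OF True] _ _ _ t]) auto
      next
        case False
        then show ?thesis using oms by (simp add: D_def outer_measure_space_def positive_def)
      qed
    qed
    finally show "hausdorff_pre (real m) \<delta> ((\<Union>i\<in>C. cball (fst i) (f * snd i)) \<inter> sphere 0 t) \<le> (\<Sum>k. g k t)" .
  next
    have "(\<integral>\<^sup>+t. (\<Sum>k. g k t) \<partial>lborel) = (\<Sum>k. \<integral>\<^sup>+t. g k t \<partial>lborel)"
      by (rule nn_integral_suminf) (rule gm)
    also have "\<dots> \<le> (\<Sum>k. ennreal ((1 + \<rho>) ^ m * f ^ n) * ennreal (if k \<in> P then unit_ball_vol (real n) * snd (b k) ^ n else 0))"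
    proof (intro suminf_le summableI)
      fix k
      show "(\<integral>\<^sup>+t. g k t \<partial>lborel) \<le> ennreal ((1 + \<rho>) ^ m * f ^ n) * ennreal (if k \<in> P then unit_ball_vol (real n) * snd (b k) ^ n else 0)"
      proof (cases "k \<in> P")
        case True
        define r where "r = snd (b k)"
        have r: "0 < r" "f * r \<le> \<rho>" using CT[OF b(1)[OF True]] Cr[OF b(1)[OF True]] by (auto simp: r_def)
        have "(\<integral>\<^sup>+t. g k t \<partial>lborel) = ennreal ((1 + f * r) ^ m * (unit_ball_vol (real (Suc m)) * (f * r) ^ Suc m))"
          using nn_integral_slice_bound[OF pos[OF True]] True by (simp add: g_def r_def)
        also have "\<dots> = ennreal ((1 + f * r) ^ m * f ^ n * (unit_ball_vol (real n) * r ^ n))"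
          unfolding n(1)[symmetric] by (simp only: power_mult_distrib mult_ac)
        also have "\<dots> \<le> ennreal ((1 + \<rho>) ^ m * f ^ n * (unit_ball_vol (real n) * r ^ n))"
          using r f by (intro ennreal_leI mult_right_mono power_mono) auto
        also have "\<dots> = ennreal ((1 + \<rho>) ^ m * f ^ n) * ennreal (unit_ball_vol (real n) * r ^ n)"
          using r f \<rho>0 by (intro ennreal_mult) auto
        finally show ?thesis using True by (simp add: r_def)
      qed (simp add: g_def)
    qed
    also have "\<dots> = ennreal ((1 + \<rho>) ^ m * f ^ n) * (\<Sum>k. ennreal (if k \<in> P then unit_ball_vol (real n) * snd (b k) ^ n else 0))"
      by (rule ennreal_suminf_cmult)
    also have "\<dots> \<le> ennreal ((1 + \<rho>) ^ m * f ^ n) * emeasure lborel T"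
      by (rule mult_left_mono[OF b(3)]) simp
    finally show "(\<integral>\<^sup>+t. (\<Sum>k. g k t) \<partial>lborel) \<le> ennreal ((1 + \<rho>) ^ m * f ^ n) * emeasure lborel T" .
  qed
qed

text \<open>Slicing an efficient ball covering of the shell \<open>1 < |x| < 1 + \<tau>\<close> by the spheres \<open>|x| = t\<close>
  and averaging over \<open>t\<close>: the slices of one ball contribute its volume, up to a factor near 1.\<close>

lemma hausdorff_pre_sphere_shell:
  defines "n \<equiv> DIM('a::euclidean_space)"
  assumes n: "n = Suc m" "0 < m" and \<tau>: "0 < \<tau>" and \<rho>: "0 < \<rho>" "\<rho> \<le> 1" "2 * \<rho> \<le> \<delta>" and e: "0 < e"
  shows "ennreal \<tau> * hausdorff_pre (real m) \<delta> (sphere (0::'a) 1)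
    \<le> ennreal ((1 + \<rho>) ^ m * (unit_ball_vol (real n) * ((1 + \<tau>) ^ n - 1)) + (1 + \<rho>) ^ m * 5 ^ n * e)"
proof -
  define A :: "'a set" where "A = ball 0 (1 + \<tau>) - cball 0 1"
  have A: "open A" unfolding A_def by (rule open_Diff[OF open_ball closed_cball])
  define K where "K = {i :: 'a \<times> real. 0 < snd i \<and> snd i \<le> \<rho> \<and> fst i \<in> A \<and> cball (fst i) (snd i) \<subseteq> A}"
  have K: "\<exists>i. i \<in> K \<and> x \<in> cball (fst i) (snd i) \<and> snd i < d" if xA: "x \<in> A" and d0: "0 < d" for x d
  proof -
    obtain r where r: "0 < r" "cball x r \<subseteq> A" using bspec[OF A[unfolded open_contains_cball] xA] by blast
    define q where "q = min r (min \<rho> (d / 2))"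
    have "0 < q" "q \<le> \<rho>" "q < d" "q \<le> r" using r(1) \<rho>(1) d0 unfolding q_def by linarith+
    moreover have "cball x q \<subseteq> A" using subset_cball[OF \<open>q \<le> r\<close>] r(2) by (rule subset_trans)
    ultimately have "(x, q) \<in> K \<and> x \<in> cball (fst (x, q)) (snd (x, q)) \<and> snd (x, q) < d"
      using xA by (simp add: K_def)
    then show ?thesis by (rule exI)
  qed
  obtain C where C: "countable C" "C \<subseteq> K"
     "pairwise (\<lambda>i j. disjnt (cball (fst i) (snd i)) (cball (fst j) (snd j))) C"
     "negligible (A - (\<Union>i \<in> C. cball (fst i) (snd i)))"
    by (rule Vitali_covering_theorem_cballs[of K snd A fst]) (use K in \<open>auto simp: K_def\<close>)
  \<comment> \<open>Vanishing volume does not make every spherical slice of \<open>Z\<close> small,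
    so \<open>Z\<close> is covered as well, by enlarged balls whose disjoint originals fit into an
    open set of measure at most \<open>e\<close>.\<close>
  define Z where "Z = A - (\<Union>i \<in> C. cball (fst i) (snd i))"
  have Z: "negligible Z" using C(4) by (simp add: Z_def)
  then have Zn: "Z \<in> null_sets lebesgue" by (simp add: negligible_iff_null_sets)
  then have Zs: "Z \<in> sets lebesgue" by auto
  obtain T where T: "open T" "Z \<subseteq> T" "T - Z \<in> lmeasurable" "emeasure lebesgue (T - Z) < ennreal e"
    using sets_lebesgue_outer_open[OF Zs e] .
  have "emeasure lborel T = emeasure lebesgue T" using T(1) by simp
  also have "\<dots> = emeasure lebesgue (T - Z)"
    by (rule emeasure_Diff_null_set[OF Zn, symmetric]) (use T(1) in auto)
  finally have Te: "emeasure lborel T \<le> ennreal e" using T(4) by simp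
  define K2 where "K2 = {i :: 'a \<times> real. 0 < snd i \<and> snd i \<le> \<rho> / 5 \<and> fst i \<in> Z \<and> cball (fst i) (snd i) \<subseteq> T}"
  have ZK: "Z \<subseteq> (\<Union>i\<in>K2. cball (fst i) (snd i))"
  proof
    fix x assume x: "x \<in> Z"
    obtain r where r: "0 < r" "cball x r \<subseteq> T" using bspec[OF T(1)[unfolded open_contains_cball] subsetD[OF T(2) x]] by blast
    define q where "q = min r (\<rho> / 5)"
    have q: "0 < q" "q \<le> \<rho> / 5" "q \<le> r" using r(1) \<rho>(1) unfolding q_def by linarith+
    moreover have "cball x q \<subseteq> T" using subset_cball[OF q(3)] r(2) by (rule subset_trans)
    ultimately have "(x, q) \<in> K2" "x \<in> cball (fst (x, q)) (snd (x, q))" using x by (simp_all add: K2_def)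
    then show "x \<in> (\<Union>i\<in>K2. cball (fst i) (snd i))" by (rule UN_I)
  qed
  obtain C2 where C2: "countable C2" "C2 \<subseteq> K2"
     "pairwise (\<lambda>i j. disjnt (cball (fst i) (snd i)) (cball (fst j) (snd j))) C2"
     "Z \<subseteq> (\<Union>i\<in>C2. cball (fst i) (5 * snd i))"
    by (rule Vitali_covering_lemma_cballs[where S = Z and K = K2 and a = fst and r = snd and B = "\<rho> / 5"]) (use ZK in \<open>auto simp: K2_def\<close>)
  have A1: "1 \<le> norm x" if "x \<in> A" for x using that by (auto simp: A_def)
  obtain G where G: "G \<in> borel_measurable lborel"
    "\<And>t. 0 < t \<Longrightarrow> hausdorff_pre (real m) \<delta> ((\<Union>i\<in>C. cball (fst i) (1 * snd i)) \<inter> sphere 0 t) \<le> G t"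
    "(\<integral>\<^sup>+t. G t \<partial>lborel) \<le> ennreal ((1 + \<rho>) ^ m * 1 ^ DIM('a)) * emeasure lborel A"
  proof (rule slice_family_bound[of m C A 1 \<rho> \<delta>, OF _ n(2) C(1,3)], goal_cases)
    case 1 show ?case using n by (simp add: n_def)
  next
    case 2 show ?case using A by simp
  next
    case (3 i) then show ?case using C(2) by (auto simp: K_def)
  next
    case (7 i) then show ?case using C(2) A1 by (auto simp: K_def)
  qed (use \<rho> in auto)
  obtain G2 where G2: "G2 \<in> borel_measurable lborel"
    "\<And>t. 0 < t \<Longrightarrow> hausdorff_pre (real m) \<delta> ((\<Union>i\<in>C2. cball (fst i) (5 * snd i)) \<inter> sphere 0 t) \<le> G2 t"
    "(\<integral>\<^sup>+t. G2 t \<partial>lborel) \<le> ennreal ((1 + \<rho>) ^ m * 5 ^ DIM('a)) * emeasure lborel T"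
  proof (rule slice_family_bound[of m C2 T 5 \<rho> \<delta>, OF _ n(2) C2(1,3)], goal_cases)
    case 1 show ?case using n by (simp add: n_def)
  next
    case 2 show ?case using T by simp
  next
    case (3 i) then show ?case using C2(2) by (auto simp: K2_def)
  next
    case (7 i) then show ?case using C2(2) A1 by (auto simp: K2_def Z_def)
  qed (use \<rho> in auto)
  have [measurable]: "G \<in> borel_measurable lborel" "G2 \<in> borel_measurable lborel" by (rule G(1), rule G2(1))
  let ?S = "hausdorff_pre (real m) \<delta> (sphere (0::'a) 1)"
  have oms: "outer_measure_space (Pow UNIV) (hausdorff_pre (real m) \<delta> :: 'a set \<Rightarrow> ennreal)"
    using n \<rho> by (intro hausdorff_pre_outer_measure_space) auto
  have mono: "hausdorff_pre (real m) \<delta> X \<le> hausdorff_pre (real m) \<delta> Y" if "X \<subseteq> Y" for X Y :: "'a set"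
    using oms that by (simp add: outer_measure_space_def increasing_def)
  \<comment> \<open>Scaling a sphere of radius \<open>t > 1\<close> down to the unit sphere is a
    contraction, so the slices at all \<open>t\<close> dominate the same number
    \<open>?S\<close>.\<close>
  have S_le: "?S \<le> G t + G2 t" if t: "1 < t" "t < 1 + \<tau>" for t
  proof -
    have t0: "0 < t" using t by simp
    have "sphere (0::'a) 1 \<subseteq> (\<lambda>x. (1 / t) *\<^sub>R x) ` sphere 0 t"
    proof
      fix x :: 'a assume "x \<in> sphere 0 1"
      then show "x \<in> (\<lambda>x. (1 / t) *\<^sub>R x) ` sphere 0 t"
        using t0 by (intro image_eqI[of _ _ "t *\<^sub>R x"]) auto
    qed
    then have "?S \<le> hausdorff_pre (real m) \<delta> ((\<lambda>x. (1 / t) *\<^sub>R x) ` sphere (0::'a) t)" by (rule mono)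
    also have "\<dots> \<le> hausdorff_pre (real m) \<delta> (sphere (0::'a) t)"
    proof (rule hausdorff_pre_contraction)
      fix x y :: 'a
      have "dist ((1 / t) *\<^sub>R x) ((1 / t) *\<^sub>R y) = (1 / t) * dist x y"
        using t0 by (simp add: dist_norm flip: scaleR_diff_right)
      also have "\<dots> \<le> 1 * dist x y" using t by (intro mult_right_mono) auto
      finally show "dist ((1 / t) *\<^sub>R x) ((1 / t) *\<^sub>R y) \<le> dist x y" by simp
    qed (use n \<rho> in auto)
    also have "\<dots> \<le> hausdorff_pre (real m) \<delta> ((\<Union>i\<in>C. cball (fst i) (1 * snd i)) \<inter> sphere 0 t
        \<union> (\<Union>i\<in>C2. cball (fst i) (5 * snd i)) \<inter> sphere 0 t)"
    proof (rule mono, rule subsetI)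
      fix x :: 'a assume x: "x \<in> sphere 0 t"
      then have "x \<in> A" using t by (simp add: A_def)
      then have "x \<in> (\<Union>i\<in>C. cball (fst i) (1 * snd i)) \<or> x \<in> Z" by (auto simp: Z_def)
      then show "x \<in> (\<Union>i\<in>C. cball (fst i) (1 * snd i)) \<inter> sphere 0 t
        \<union> (\<Union>i\<in>C2. cball (fst i) (5 * snd i)) \<inter> sphere 0 t" using x C2(4) by blast
    qed
    also have "\<dots> \<le> hausdorff_pre (real m) \<delta> ((\<Union>i\<in>C. cball (fst i) (1 * snd i)) \<inter> sphere 0 t)
        + hausdorff_pre (real m) \<delta> ((\<Union>i\<in>C2. cball (fst i) (5 * snd i)) \<inter> sphere 0 t)"
      by (rule outer_measure_space_Un[OF oms])
    also have "\<dots> \<le> G t + G2 t" by (intro add_mono G(2) G2(2) t0)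
    finally show ?thesis .
  qed
  \<comment> \<open>\<open>?S\<close> does not depend on \<open>t\<close>; integrating over the
    thickness of the shell turns the bounds for slices into bounds by volumes.\<close>
  have "ennreal \<tau> * ?S = (\<integral>\<^sup>+t. ?S * indicator {1<..<1+\<tau>} t \<partial>lborel)"
    using \<tau> by (simp add: nn_integral_cmult_indicator mult.commute)
  also have "\<dots> \<le> (\<integral>\<^sup>+t. G t + G2 t \<partial>lborel)"
    using S_le by (intro nn_integral_mono) (auto simp: indicator_def)
  also have "\<dots> = (\<integral>\<^sup>+t. G t \<partial>lborel) + (\<integral>\<^sup>+t. G2 t \<partial>lborel)"
    by (rule nn_integral_add) auto
  also have "\<dots> \<le> ennreal ((1 + \<rho>) ^ m * 1 ^ DIM('a)) * emeasure lborel A + ennreal ((1 + \<rho>) ^ m * 5 ^ DIM('a)) * emeasure lborel T"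
    by (intro add_mono G(3) G2(3))
  also have "\<dots> \<le> ennreal ((1 + \<rho>) ^ m * 1 ^ DIM('a)) * ennreal (unit_ball_vol (real n) * ((1 + \<tau>) ^ n - 1))
      + ennreal ((1 + \<rho>) ^ m * 5 ^ DIM('a)) * ennreal e"
    using Te emeasure_shell[OF \<tau>, where 'a = 'a]
    by (intro add_mono mult_left_mono) (auto simp: A_def n_def)
  also have "\<dots> = ennreal ((1 + \<rho>) ^ m * (unit_ball_vol (real n) * ((1 + \<tau>) ^ n - 1)) + (1 + \<rho>) ^ m * 5 ^ n * e)"
  proof -
    have v: "0 \<le> unit_ball_vol (real n) * ((1 + \<tau>) ^ n - 1)" using \<tau> by (simp add: one_le_power)
    have "0 \<le> (1 + \<rho>) ^ m" using \<rho> by simp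
    then show ?thesis
      using v e by (simp add: n_def[symmetric] ennreal_mult[symmetric])
  qed
  finally show ?thesis .
qed

text \<open>At a fixed scale \<open>\<delta>\<close> the radii and the error tend to 0 first, which
  leaves the volume of the shell over its thickness. Then the thickness tends to 0, and the quotient
  becomes \<open>\<omega>\<close> times the derivative of \<open>x ^ ?n\<close> at 1.\<close>

lemma hausdorff_outer_sphere_le:
  assumes n: "2 \<le> DIM('a::euclidean_space)"
  shows "hausdorff_outer (real DIM('a) - 1) (sphere (0::'a) 1) \<le> ennreal (real DIM('a) * unit_ball_vol (real DIM('a)))"
proof -
  let ?n = "DIM('a)"
  obtain m where m: "?n = Suc m" "0 < m" using n by (cases ?n) auto
  define \<omega> where "\<omega> = unit_ball_vol (real ?n)"
  have "hausdorff_pre (real m) \<delta> (sphere (0::'a) 1) \<le> ennreal (real ?n * \<omega>)" if \<delta>: "0 < \<delta>" for \<delta>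
  proof -
    let ?S = "hausdorff_pre (real m) \<delta> (sphere (0::'a) 1)"
    \<comment> \<open>The same sequence serves as the bound on the radii and as the error
      \<open>e\<close> of the shell estimate.\<close>
    define \<rho> where "\<rho> k = min 1 (\<delta> / 2) / real (Suc k)" for k
    have \<rho>: "0 < \<rho> k" "\<rho> k \<le> 1" "2 * \<rho> k \<le> \<delta>" for k
    proof -
      have "min 1 (\<delta> / 2) / real (Suc k) \<le> min 1 (\<delta> / 2) / 1" using \<delta> by (intro divide_left_mono) auto
      then show "0 < \<rho> k" "\<rho> k \<le> 1" "2 * \<rho> k \<le> \<delta>" using \<delta> by (auto simp: \<rho>_def)
    qed
    have \<rho>lim: "\<rho> \<longlonglongrightarrow> 0"
    proof -
      have "(\<lambda>k. min 1 (\<delta> / 2) * (1 / real (Suc k))) \<longlonglongrightarrow> min 1 (\<delta> / 2) * 0"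
        by (intro tendsto_intros LIMSEQ_Suc[OF lim_1_over_n])
      then show ?thesis by (simp add: \<rho>_def[abs_def])
    qed
    have le: "ennreal \<tau> * ?S \<le> ennreal (\<omega> * ((1 + \<tau>) ^ ?n - 1))" if \<tau>: "0 < \<tau>" for \<tau>
    proof (rule LIMSEQ_le_const)
      have "(\<lambda>k. (1 + \<rho> k) ^ m * (\<omega> * ((1 + \<tau>) ^ ?n - 1)) + (1 + \<rho> k) ^ m * 5 ^ ?n * \<rho> k)
        \<longlonglongrightarrow> (1 + 0) ^ m * (\<omega> * ((1 + \<tau>) ^ ?n - 1)) + (1 + 0) ^ m * 5 ^ ?n * 0"
        by (intro tendsto_intros \<rho>lim)
      then show "(\<lambda>k. ennreal ((1 + \<rho> k) ^ m * (\<omega> * ((1 + \<tau>) ^ ?n - 1)) + (1 + \<rho> k) ^ m * 5 ^ ?n * \<rho> k))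
        \<longlonglongrightarrow> ennreal (\<omega> * ((1 + \<tau>) ^ ?n - 1))"
        by (intro tendsto_ennrealI) simp
      show "\<exists>N. \<forall>k\<ge>N. ennreal \<tau> * ?S \<le> ennreal ((1 + \<rho> k) ^ m * (\<omega> * ((1 + \<tau>) ^ ?n - 1)) + (1 + \<rho> k) ^ m * 5 ^ ?n * \<rho> k)"
        unfolding \<omega>_def by (intro exI[of _ 0] allI impI hausdorff_pre_sphere_shell m \<tau> \<rho>)
    qed
    have le2: "?S \<le> ennreal (\<omega> * (((1 + \<tau>) ^ ?n - 1) / \<tau>))" if \<tau>: "0 < \<tau>" for \<tau>
    proof -
      have "?S = ennreal (1 / \<tau>) * (ennreal \<tau> * ?S)"
        using \<tau> by (simp add: mult.assoc[symmetric] ennreal_mult[symmetric])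
      also have "\<dots> \<le> ennreal (1 / \<tau>) * ennreal (\<omega> * ((1 + \<tau>) ^ ?n - 1))"
        by (rule mult_left_mono[OF le[OF \<tau>]]) simp
      also have "\<dots> = ennreal (\<omega> * (((1 + \<tau>) ^ ?n - 1) / \<tau>))"
        using \<tau> by (simp add: \<omega>_def ennreal_mult[symmetric] one_le_power)
      finally show ?thesis .
    qed
    show ?thesis
    proof (rule LIMSEQ_le_const)
      have "((\<lambda>x::real. x ^ ?n) has_real_derivative real ?n * 1 ^ (?n - 1)) (at 1)"
        by (auto intro!: derivative_eq_intros)
      then have "((\<lambda>h. ((1 + h) ^ ?n - 1) / h) \<longlongrightarrow> real ?n) (at 0)" by (simp add: DERIV_def)
      moreover have "filterlim (\<lambda>k. 1 / real (Suc k)) (at 0) sequentially"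
        unfolding filterlim_at using LIMSEQ_Suc[OF lim_1_over_n] by auto
      ultimately have "(\<lambda>k. ((1 + 1 / real (Suc k)) ^ ?n - 1) / (1 / real (Suc k))) \<longlonglongrightarrow> real ?n"
        by (rule filterlim_compose)
      then have "(\<lambda>k. \<omega> * (((1 + 1 / real (Suc k)) ^ ?n - 1) / (1 / real (Suc k)))) \<longlonglongrightarrow> \<omega> * real ?n"
        by (intro tendsto_intros)
      then show "(\<lambda>k. ennreal (\<omega> * (((1 + 1 / real (Suc k)) ^ ?n - 1) / (1 / real (Suc k))))) \<longlonglongrightarrow> ennreal (real ?n * \<omega>)"
        unfolding mult.commute[of "real ?n" \<omega>] by (rule tendsto_ennrealI)
      show "\<exists>N. \<forall>k\<ge>N. ?S \<le> ennreal (\<omega> * (((1 + 1 / real (Suc k)) ^ ?n - 1) / (1 / real (Suc k))))"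
        by (intro exI[of _ 0] allI impI le2) simp
    qed
  qed
  moreover have "real ?n - 1 = real m" using m by simp
  ultimately show ?thesis
    unfolding hausdorff_outer_def \<omega>_def by (auto intro!: SUP_least)
qed

lemma measure_hausdorff_sphere:
  assumes n: "2 \<le> DIM('a::euclidean_space)"
  defines "\<sigma> \<equiv> measure (hausdorff_measure (real DIM('a) - 1)) (sphere (0::'a) 1)"
  shows "0 < \<sigma>" "\<sigma> \<le> real DIM('a) * unit_ball_vol (real DIM('a))"
proof -
  have s: "0 < real DIM('a) - 1" using n by simp
  have em: "emeasure (hausdorff_measure (real DIM('a) - 1)) (sphere (0::'a) 1) = hausdorff_outer (real DIM('a) - 1) (sphere (0::'a) 1)"
    by (rule emeasure_hausdorff_measure[OF s]) auto
  have le: "hausdorff_outer (real DIM('a) - 1) (sphere (0::'a) 1) \<le> ennreal (real DIM('a) * unit_ball_vol (real DIM('a)))"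
    by (rule hausdorff_outer_sphere_le[OF n])
  \<comment> \<open>For an infinite value the passage to real numbers would return 0 and positivity
    would be lost.\<close>
  have fin: "hausdorff_outer (real DIM('a) - 1) (sphere (0::'a) 1) < top"
    using le by (rule le_less_trans) simp
  show "0 < \<sigma>"
    unfolding \<sigma>_def measure_def em using hausdorff_sphere_pos[OF n] fin by (simp add: enn2real_positive_iff)
  show "\<sigma> \<le> real DIM('a) * unit_ball_vol (real DIM('a))"
    unfolding \<sigma>_def measure_def em using le by (intro enn2real_leI) auto
qed

section \<open>Testing against the gradient of a potential\<close>

text \<open>The pointwise bound \<open>t \<le> 1 + t powr p\<close> for nonnegative
  \<open>t\<close>, integrated over the compact closure of the bounded set.\<close>

lemma Lp_loc_sym_component_integrable:
  fixes A :: "real^'n \<Rightarrow> real^'n^'n"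
  assumes A: "Lp_loc_sym p A" and p: "1 \<le> p" and bdd: "bounded \<Omega>" and \<Omega>: "\<Omega> \<in> sets lebesgue"
  shows "set_integrable lebesgue \<Omega> (\<lambda>x. A x $ i $ j)"
  unfolding set_integrable_def
proof (rule integrableI_bounded)
  let ?K = "closure \<Omega>"
  have mA: "A \<in> borel_measurable lebesgue" using A by (simp add: Lp_loc_sym_def)
  have m1: "(\<lambda>x. A x $ i $ j) \<in> borel_measurable lebesgue"
    by (rule measurable_compose[OF mA borel_measurable_continuous_onI]) (intro continuous_intros)
  have m2: "(\<lambda>x. norm (A x)) \<in> borel_measurable lebesgue"
    by (rule measurable_compose[OF mA borel_measurable_norm])
  have m3: "(\<lambda>x. norm (A x) powr p) \<in> borel_measurable lebesgue"
    using measurable_abs_powr[OF m2, of p] by simp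
  have K: "compact ?K" using bdd by (simp add: compact_closure)
  then have Ks: "?K \<in> sets lebesgue" by (intro fmeasurableD lmeasurable_compact)
  show "(\<lambda>x. indicat_real \<Omega> x *\<^sub>R (A x $ i $ j)) \<in> borel_measurable lebesgue"
    using \<Omega> m1 by (intro borel_measurable_scaleR borel_measurable_indicator)
  have pw: "ennreal (norm (indicat_real \<Omega> x *\<^sub>R (A x $ i $ j)))
      \<le> indicator ?K x + ennreal (indicator ?K x * norm (A x) powr p)" for x
  proof (cases "x \<in> \<Omega>")
    case True
    then have "x \<in> ?K" using closure_subset by blast
    have "norm (A x $ i $ j) \<le> norm (A x)"
      using Finite_Cartesian_Product.norm_nth_le[of "A x $ i" j]
        Finite_Cartesian_Product.norm_nth_le[of "A x" i] by linarith
    also have "norm (A x) \<le> 1 + norm (A x) powr p"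
    proof (cases "norm (A x) \<le> 1")
      case False
      then have "norm (A x) powr 1 \<le> norm (A x) powr p" using p by (intro powr_mono) auto
      then show ?thesis using False by simp
    qed (simp add: add_increasing2)
    finally have "ennreal (norm (A x $ i $ j)) \<le> ennreal (1 + norm (A x) powr p)" by (rule ennreal_leI)
    then show ?thesis using True \<open>x \<in> ?K\<close> by (simp add: ennreal_plus)
  qed simp
  have "(\<integral>\<^sup>+x. ennreal (norm (indicat_real \<Omega> x *\<^sub>R (A x $ i $ j))) \<partial>lebesgue)
     \<le> (\<integral>\<^sup>+x. indicator ?K x + ennreal (indicator ?K x * norm (A x) powr p) \<partial>lebesgue)"
    by (intro nn_integral_mono pw)
  also have "\<dots> = (\<integral>\<^sup>+x. indicator ?K x \<partial>lebesgue) + (\<integral>\<^sup>+x. ennreal (indicator ?K x * norm (A x) powr p) \<partial>lebesgue)"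
    using Ks m3 by (intro nn_integral_add borel_measurable_indicator measurable_compose[OF _ measurable_ennreal]
        borel_measurable_times)
  also have "\<dots> = emeasure lebesgue ?K + (\<integral>\<^sup>+x. ennreal (indicator ?K x * norm (A x) powr p) \<partial>lebesgue)"
    using Ks by simp
  also have "\<dots> < \<infinity>"
  proof -
    have "emeasure lebesgue ?K < \<infinity>" using lmeasurable_compact[OF K] by (simp add: fmeasurable_def)
    moreover have "(\<integral>\<^sup>+x. ennreal (indicator ?K x * norm (A x) powr p) \<partial>lebesgue) < \<infinity>"
      using A K by (simp add: Lp_loc_sym_def)
    ultimately show ?thesis by simp
  qed
  finally show "(\<integral>\<^sup>+x. ennreal (norm (indicat_real \<Omega> x *\<^sub>R (A x $ i $ j))) \<partial>lebesgue) < \<infinity>" .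
qed

lemma integrable_scaleR_bounded:
  fixes f :: "'a \<Rightarrow> 'b::{banach, second_countable_topology}" and w :: "'a \<Rightarrow> real"
  assumes f: "integrable M f" and w: "w \<in> borel_measurable M" "\<And>x. \<bar>w x\<bar> \<le> R"
  shows "integrable M (\<lambda>x. w x *\<^sub>R f x)"
proof (rule Bochner_Integration.integrable_bound)
  show "integrable M (\<lambda>x. R *\<^sub>R f x)" using f by simp
  show "(\<lambda>x. w x *\<^sub>R f x) \<in> borel_measurable M"
    using w(1) borel_measurable_integrable[OF f] by (rule borel_measurable_scaleR)
  show "AE x in M. norm (w x *\<^sub>R f x) \<le> norm (R *\<^sub>R f x)"
    using w(2) by (auto intro!: mult_right_mono order_trans[OF w(2)])
qed

lemma vec_eq_sum_axis: "(v :: real^'n) = (\<Sum>k\<in>UNIV. v $ k *\<^sub>R axis k 1)"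
  by (simp add: vec_eq_iff axis_def if_distrib cong: if_cong)

text \<open>The vector identity is used with \<open>w\<close> the partial derivative of
  \<open>W\<close> in direction \<open>i\<close>, only component \<open>i\<close> is kept, and the
  results are summed over \<open>i\<close>. Over the domain this produces the trace of the matrix
  against the Hessian; the other two integrals become \<open>grad W\<close> paired with
  \<open>g\<close> and with \<open>h\<close>, and Cauchy-Schwarz bounds both.\<close>

lemma hess_integral_le:
  fixes A :: "real^'n \<Rightarrow> real^'n^'n" and g h :: "real^'n \<Rightarrow> real^'n"
  assumes bdd: "bounded \<Omega>" and \<Omega>: "\<Omega> \<in> sets lebesgue"
    and A: "\<And>i j. set_integrable lebesgue \<Omega> (\<lambda>x. A x $ i $ j)"
    and H: "sets H = sets borel" and \<nu>: "finite_measure \<nu>" "sets \<nu> = sets borel"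
    and h: "h \<in> borel_measurable borel" "AE x in \<nu>. norm (h x) = 1"
    and g: "set_integrable H F g"
    and trace: "\<And>w. smooth w \<Longrightarrow> (LINT x:F|H. w x *\<^sub>R g x)
       = (LINT x:\<Omega>|lebesgue. A x *v grad w x) + (LINT x|\<nu>. w x *\<^sub>R h x)"
    and W: "smooth W" and R: "0 \<le> R" "\<And>x. norm (grad W x) \<le> R"
  shows "(LINT x:\<Omega>|lebesgue. mat_inner (A x) (hess_mat W x))
     \<le> R * ((LINT x:F|H. norm (g x)) + measure \<nu> UNIV)"
proof -
  interpret \<nu>: finite_measure \<nu> by fact
  define w where "w i = partial_deriv i W" for i
  have sm: "smooth (w i)" for i unfolding w_def using W by (rule smooth_partial_deriv)
  have wR: "\<bar>w i x\<bar> \<le> R" for i x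
    using component_le_norm_cart[of "grad W x" i] R(2)[of x] by (simp add: grad_def w_def)
  have wb: "w i \<in> borel_measurable borel" for i
    using smooth_continuous[OF sm] by (rule borel_measurable_continuous_onI)
  have wH: "w i \<in> borel_measurable H" for i using wb measurable_cong_sets[OF H refl] by blast
  have w\<nu>: "w i \<in> borel_measurable \<nu>" for i using wb measurable_cong_sets[OF \<nu>(2) refl] by blast
  have h\<nu>: "h \<in> borel_measurable \<nu>" using h(1) measurable_cong_sets[OF \<nu>(2) refl] by blast
  define g' where "g' x = indicator F x *\<^sub>R g x" for x
  have g': "integrable H g'" using g by (simp add: set_integrable_def g'_def[abs_def])
  have inth: "integrable \<nu> h" using h(2) h\<nu> by (intro \<nu>.integrable_const_bound[of _ 1]) auto
  \<comment> \<open>Integrability of the vector integrands comes first: a Bochner integral that does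
    not exist is 0 by convention, so components may be taken inside only when it does.\<close>
  have I1: "integrable H (\<lambda>x. w i x *\<^sub>R g' x)" for i by (rule integrable_scaleR_bounded[OF g' wH wR])
  have I2: "integrable \<nu> (\<lambda>x. w i x *\<^sub>R h x)" for i by (rule integrable_scaleR_bounded[OF inth w\<nu> wR])
  define a where "a i x = indicator \<Omega> x *\<^sub>R (A x *v grad (w i) x)" for i x
  have I3: "integrable lebesgue (a i)" for i
  proof -
    have ai: "a i x = (\<Sum>k\<in>UNIV. (\<Sum>j\<in>UNIV. indicator \<Omega> x *\<^sub>R (A x $ k $ j * partial_deriv j (w i) x)) *\<^sub>R axis k 1)" for x
      by (subst vec_eq_sum_axis) (simp add: a_def matrix_vector_mult_def grad_def sum_distrib_left)
    have "set_integrable lebesgue \<Omega> (\<lambda>x. A x $ k $ j * partial_deriv j (w i) x)" for k j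
      by (intro set_integrable_mult_continuous A bdd \<Omega> smooth_continuous smooth_partial_deriv sm)
    then have "integrable lebesgue (\<lambda>x. indicator \<Omega> x *\<^sub>R (A x $ k $ j * partial_deriv j (w i) x))" for k j
      by (simp only: set_integrable_def)
    then show ?thesis
      unfolding ai[abs_def] by (intro Bochner_Integration.integrable_sum integrable_scaleR_left)
  qed
  have comp: "(LINT x|H. w i x * g' x $ i) = (LINT x|lebesgue. a i x $ i) + (LINT x|\<nu>. w i x * h x $ i)" for i
  proof -
    have c: "(LINT x|M. f x $ i) = (LINT x|M. f x) $ i" if "integrable M f" for M :: "(real^'n) measure" and f :: "real^'n \<Rightarrow> real^'n"
      by (rule integral_bounded_linear[OF bounded_linear_vec_nth that])
    have "(LINT x|H. w i x *\<^sub>R g' x) = (LINT x|lebesgue. a i x) + (LINT x|\<nu>. w i x *\<^sub>R h x)"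
      using trace[OF sm[of i]] by (simp add: set_lebesgue_integral_def g'_def a_def mult.commute)
    then show ?thesis
      using c[OF I1[of i]] c[OF I2[of i]] c[OF I3[of i]] by simp
  qed
  have J1: "integrable H (\<lambda>x. w i x * g' x $ i)" for i
    using integrable_bounded_linear[OF bounded_linear_vec_nth I1[of i], of i] by simp
  have J2: "integrable \<nu> (\<lambda>x. w i x * h x $ i)" for i
    using integrable_bounded_linear[OF bounded_linear_vec_nth I2[of i], of i] by simp
  have J3: "integrable lebesgue (\<lambda>x. a i x $ i)" for i
    by (rule integrable_bounded_linear[OF bounded_linear_vec_nth I3])
  have inner: "(\<Sum>i\<in>UNIV. w i x * v $ i) = grad W x \<bullet> v" for x v
    by (simp add: inner_vec_def grad_def w_def)
  have inner_le: "\<bar>grad W x \<bullet> v\<bar> \<le> R * norm v" for x v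
    by (rule order_trans[OF Cauchy_Schwarz_ineq2 mult_right_mono[OF R(2) norm_ge_zero]])
  have "(LINT x:\<Omega>|lebesgue. mat_inner (A x) (hess_mat W x)) = (LINT x|lebesgue. (\<Sum>i\<in>UNIV. a i x $ i))"
    unfolding set_lebesgue_integral_def
    by (simp add: mat_inner_def hess_mat_def a_def matrix_vector_mult_def grad_def w_def sum_distrib_left)
  also have "\<dots> = (\<Sum>i\<in>UNIV. LINT x|lebesgue. a i x $ i)"
    by (rule Bochner_Integration.integral_sum) (rule J3)
  also have "\<dots> = (\<Sum>i\<in>UNIV. (LINT x|H. w i x * g' x $ i)) - (\<Sum>i\<in>UNIV. (LINT x|\<nu>. w i x * h x $ i))"
    by (simp add: comp sum.distrib)
  also have "(\<Sum>i\<in>UNIV. (LINT x|H. w i x * g' x $ i)) = (LINT x|H. grad W x \<bullet> g' x)"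
    using Bochner_Integration.integral_sum[of UNIV H "\<lambda>i x. w i x * g' x $ i", OF J1] by (simp add: inner)
  also have "(\<Sum>i\<in>UNIV. (LINT x|\<nu>. w i x * h x $ i)) = (LINT x|\<nu>. grad W x \<bullet> h x)"
    using Bochner_Integration.integral_sum[of UNIV \<nu> "\<lambda>i x. w i x * h x $ i", OF J2] by (simp add: inner)
  finally have eq: "(LINT x:\<Omega>|lebesgue. mat_inner (A x) (hess_mat W x))
     = (LINT x|H. grad W x \<bullet> g' x) - (LINT x|\<nu>. grad W x \<bullet> h x)" .
  have K1: "integrable H (\<lambda>x. grad W x \<bullet> g' x)"
    unfolding inner[symmetric] by (intro Bochner_Integration.integrable_sum J1)
  have K2: "integrable \<nu> (\<lambda>x. grad W x \<bullet> h x)"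
    unfolding inner[symmetric] by (intro Bochner_Integration.integrable_sum J2)
  have "(LINT x|H. grad W x \<bullet> g' x) \<le> (LINT x|H. R * norm (g' x))"
    using g' by (intro integral_mono K1 integrable_mult_right integrable_norm abs_le_D1[OF inner_le])
  also have "\<dots> = R * (LINT x:F|H. norm (g x))"
    by (simp add: set_lebesgue_integral_def g'_def)
  finally have b1: "(LINT x|H. grad W x \<bullet> g' x) \<le> R * (LINT x:F|H. norm (g x))" .
  have "(LINT x|\<nu>. - (grad W x \<bullet> h x)) \<le> (LINT x|\<nu>. R)"
  proof (rule integral_mono_AE)
    show "AE x in \<nu>. - (grad W x \<bullet> h x) \<le> R"
      using h(2)
    proof eventually_elim
      case (elim x)
      then show ?case using abs_le_D2[OF inner_le[of x "h x"]] by simp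
    qed
  qed (use K2 in auto)
  also have "\<dots> = R * measure \<nu> UNIV"
    using sets_eq_imp_space_eq[OF \<nu>(2)] by simp
  finally have b2: "- (LINT x|\<nu>. grad W x \<bullet> h x) \<le> R * measure \<nu> UNIV" by simp
  show ?thesis unfolding eq using b1 b2 by (simp add: distrib_left)
qed

text \<open>The divergence is given by its polar decomposition, density \<open>h\<close> of norm 1
  against \<open>\<nu>\<close>, so its total mass is \<open>measure \<nu> UNIV\<close>. A vanishing
  divergence is the case of the null measure, and one statement covers both assertions.\<close>

lemma det_integral_le_normal_trace:
  fixes \<Omega> :: "(real^'n) set" and A :: "real^'n \<Rightarrow> real^'n^'n" and g h :: "real^'n \<Rightarrow> real^'n"
  defines "d \<equiv> real CARD('n)" and "H \<equiv> hausdorff_measure (real CARD('n) - 1) :: (real^'n) measure"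
  assumes d2: "CARD('n) \<ge> 2" and bdd: "bounded \<Omega>" and opn: "open \<Omega>"
    and A: "Lp_loc_sym (d / (d - 1)) A" "AE x in lebesgue. x \<in> \<Omega> \<longrightarrow> psd_mat (A x)"
    and \<nu>: "finite_measure \<nu>" "sets \<nu> = sets borel"
    and h: "h \<in> borel_measurable borel" "AE x in \<nu>. norm (h x) = 1"
    and g: "set_integrable H (frontier \<Omega>) g"
    and trace: "\<And>w. smooth w \<Longrightarrow> (LINT x:frontier \<Omega>|H. w x *\<^sub>R g x)
       = (LINT x:\<Omega>|lebesgue. A x *v grad w x) + (LINT x|\<nu>. w x *\<^sub>R h x)"
  shows "(\<integral>\<^sup>+ x. ennreal (indicator \<Omega> x * det (A x) powr (1 / (d - 1))) \<partial>lebesgue)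
     \<le> ennreal (1 / (d * measure H (sphere 0 1) powr (1 / (d - 1)))
        * ((LINT x:frontier \<Omega>|H. norm (g x)) + measure \<nu> UNIV) powr (d / (d - 1)))"
  unfolding d_def
proof (rule det_integral_estimate[OF d2 opn bdd])
  have \<Omega>: "\<Omega> \<in> sets lebesgue" using opn by auto
  have p: "1 \<le> d / (d - 1)" using d2 by (simp add: d_def le_divide_eq)
  show mA: "A \<in> borel_measurable lebesgue" using A(1) by (simp add: Lp_loc_sym_def)
  show int: "set_integrable lebesgue \<Omega> (\<lambda>x. A x $ i $ j)" for i j
    by (rule Lp_loc_sym_component_integrable[OF A(1) p bdd \<Omega>])
  show "AE x in lebesgue. x \<in> \<Omega> \<longrightarrow> psd_mat (A x)" by (rule A(2))
  have H: "sets H = sets borel" by (simp add: H_def)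
  show "(LINT x:\<Omega>|lebesgue. mat_inner (A x) (hess_mat W x))
      \<le> R * ((LINT x:frontier \<Omega>|H. norm (g x)) + measure \<nu> UNIV)"
    if "smooth W" "0 \<le> R" "\<And>x. norm (grad W x) \<le> R" for W R
    by (rule hess_integral_le[OF bdd \<Omega> int H \<nu> h g trace that])
  show "0 \<le> (LINT x:frontier \<Omega>|H. norm (g x)) + measure \<nu> UNIV"
    by (intro add_nonneg_nonneg) (auto simp: set_lebesgue_integral_def)
  show "0 < measure H (sphere 0 1)" "measure H (sphere 0 1) \<le> real CARD('n) * unit_ball_vol (real CARD('n))"
    using measure_hausdorff_sphere[where 'a = "real^'n"] d2 by (simp_all add: H_def)
qed

theorem theorem2p3:
  fixes \<Omega> :: "(real^'n) set"
  assumes d2: "CARD('n) \<ge> 2"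
    and bdd: "bounded \<Omega>" and cvx: "convex \<Omega>" and opn: "open \<Omega>"
  defines "d \<equiv> real CARD('n)"
    and "H \<equiv> hausdorff_measure (real CARD('n) - 1) :: (real^'n) measure"
  shows
   "(\<forall>(A :: real^'n \<Rightarrow> real^'n^'n) (g :: real^'n \<Rightarrow> real^'n).
      Lp_loc_sym (d / (d - 1)) A
      \<and> (AE x in lebesgue. x \<in> \<Omega> \<longrightarrow> psd_mat (A x))
      \<and> (\<forall>\<phi>. test_fun \<Omega> \<phi> \<longrightarrow> (LINT x:\<Omega>|lebesgue. A x *v grad \<phi> x) = 0)
      \<and> set_integrable H (frontier \<Omega>) g
      \<and> (\<forall>w. smooth w \<longrightarrow>
           (LINT x:frontier \<Omega>|H. w x *\<^sub>R g x) = (LINT x:\<Omega>|lebesgue. A x *v grad w x))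
      \<longrightarrow> (\<integral>\<^sup>+ x. ennreal (indicator \<Omega> x * det (A x) powr (1 / (d - 1))) \<partial>lebesgue)
          \<le> ennreal (1 / (d * measure H (sphere 0 1) powr (1 / (d - 1)))
                     * (LINT x:frontier \<Omega>|H. norm (g x)) powr (d / (d - 1))))
    \<and>
    (\<forall>(A :: real^'n \<Rightarrow> real^'n^'n) (g :: real^'n \<Rightarrow> real^'n)
       (\<nu> :: (real^'n) measure) (h :: real^'n \<Rightarrow> real^'n).
      Lp_loc_sym (d / (d - 1)) A
      \<and> (AE x in lebesgue. x \<in> \<Omega> \<longrightarrow> psd_mat (A x))
      \<and> finite_measure \<nu> \<and> sets \<nu> = sets borel \<and> emeasure \<nu> (UNIV - \<Omega>) = 0
      \<and> h \<in> borel_measurable borel \<and> (AE x in \<nu>. norm (h x) = 1)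
      \<and> (\<forall>\<phi>. test_fun \<Omega> \<phi> \<longrightarrow>
           (LINT x:\<Omega>|lebesgue. A x *v grad \<phi> x) + (LINT x|\<nu>. \<phi> x *\<^sub>R h x) = 0)
      \<and> set_integrable H (frontier \<Omega>) g
      \<and> (\<forall>w. smooth w \<longrightarrow>
           (LINT x:frontier \<Omega>|H. w x *\<^sub>R g x)
             = (LINT x:\<Omega>|lebesgue. A x *v grad w x) + (LINT x|\<nu>. w x *\<^sub>R h x))
      \<longrightarrow> (\<integral>\<^sup>+ x. ennreal (indicator \<Omega> x * det (A x) powr (1 / (d - 1))) \<partial>lebesgue)
          \<le> ennreal (1 / (d * measure H (sphere 0 1) powr (1 / (d - 1)))
                     * ((LINT x:frontier \<Omega>|H. norm (g x)) + measure \<nu> UNIV) powr (d / (d - 1))))"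
  unfolding d_def H_def
proof ((intro conjI allI impI; elim conjE), goal_cases)
  case (1 A g)
  \<comment> \<open>The divergence-free case takes the null measure and \<open>h = 0\<close>; the
    requirement \<open>norm (h x) = 1\<close> almost everywhere then holds vacuously.\<close>
  have "finite_measure (null_measure borel :: (real^'n) measure)"
    by (rule finite_measureI) simp
  moreover have "AE x in (null_measure borel :: (real^'n) measure). norm (0 :: real^'n) = 1"
    by (rule AE_I[of _ _ UNIV]) auto
  ultimately show ?case
    using det_integral_le_normal_trace[OF d2 bdd opn 1(1,2) _ _ _ _ 1(4), of "null_measure borel" "\<lambda>_. 0"] 1(5)
    by simp
next
  case (2 A g \<nu> h)
  show ?case
    by (rule det_integral_le_normal_trace[OF d2 bdd opn 2(1,2,3,4,6,7,9)]) (use 2(10) in blast)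
qed

end
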